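(* For any Jacobi manifold $(M,\pi,\eta)$, the hypercommutative algebra structure on $H_{\mathrm{dR}}^*(M)$ induced by the $\mathcal{H}_\infty$-algebra structure on $\Omega(M)$ associated with $(\pi,\eta)$ (described in the context) is trivial, i.e. its operations satisfy $m_n=0$ for all $n>2$.
   Context: The ground field is $k=\mathbb{R}$; complexes are cochain complexes; operads are symmetric DG operads. $[a,b]=ab-(-1)^{|a||b|}ba$. A Jacobi manifold $(M,\pi,\eta)$ is a smooth manifold $M$ with a bivector field $\pi\in\Gamma(\Lambda^2T(M))$ and a vector field $\eta\in\Gamma(T(M))$ such that $[\pi,\pi]=2\eta\pi$ and $[\pi,\eta]=0$ in $\Gamma(\Lambda^*T(M))$ (Schouten--Nijenhuis bracket). $\Omega(M)$ is the de Rham complex with exterior differential $d$; for a polyvector field $P$, $i_P$ is the interior product ($i_{PQ}=i_Pi_Q$), $L_P=[i_P,d]$, and $i_{[P,Q]}=[L_P,i_Q]$. $\mathcal{H}$, the hypercommutative operad, is the graded operad (zero differential) generated by symmetric operations $m_n$ of arity $n$ and degree $2(2-n)$, $n\geq2$, subject to the relations, for all $n\geq 0$ and elements $a,b,c,x_1,\dots,x_n$ of an algebra, $$\sum_{S_1\sqcup S_2=\{1,\dots,n\}}\pm m(m(a,b,x_{S_1}),c,x_{S_2})=\sum_{S_1\sqcup S_2=\{1,\dots,n\}}\pm m(a,m(b,c,x_{S_1}),x_{S_2}),$$ with Koszul signs. Its degree $0$ part is the commutative operad $\mathcal{C}$, generated by $m_2$. $\mathcal{C}_\infty\subset\mathcal{H}_\infty$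 are the minimal (Koszul) resolutions of $\mathcal{C}\subset\mathcal{H}$. $\mathcal{CBV}_\infty/\Delta$ is the DG operad generated by $\mu$ (arity $2$, degree $0$, symmetric), $\Delta_n$ (arity $1$, degree $1-2n$) and $\phi_n$ (arity $1$, degree $-2n$), $n\geq1$, subject to: $d(\mu)=0$; $\mu$ is associative; $d(\Delta_n)+\sum_{r=1}^{n-1}\Delta_r\Delta_{n-r}=0$ for $n\geq1$; $\Delta_n$ is a differential operator of order $\leq n+1$ with respect to $\mu$; and, for $n\geq1$, $$d(\phi_n)+\sum_{p=2}^n\frac{1}{p!}\sum_{\substack{q_1+\cdots+q_p=n\\ q_1,\dots,q_p\geq 1}}[\phi_{q_1},\dots[\phi_{q_{p-1}},d(\phi_{q_p})]\dots]=-\Delta_n.$$ Here $D$ is a differential operator of order $\leq r$ on a graded commutative algebra if $\sum_{p+q=r+1,\,p\geq1}(-1)^p\sum_{\sigma}\pm D(x_{\sigma(1)}\cdots x_{\sigma(p)})x_{\sigma(p+1)}\cdots x_{\sigma(r+1)}=0$ for all $x_1,\dots,x_{r+1}$, where $\sigma$ runs over $(p,q)$-shuffles and signs follow the Koszul rule. The de Rham complex of a Jacobi manifold is a $\mathcal{CBV}_\infty/\Delta$-algebra with $\mu$ the exterior product, $\Delta_1=L_\pi$, $\Delta_2=-i_\eta i_\pi$, $\phi_1=i_\pi$, and the remaining operations zero. There is a quasi-isomorphism of DG operads $\psi\colon\mathcal{H}_\infty\to\mathcal{CBV}_\infty/\Delta$ whose restriction to $\mathcal{C}_\infty$ is the composite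 $\mathcal{C}_\infty\to\mathcal{C}\to\mathcal{CBV}_\infty/\Delta$, $m_2\mapsto\mu$; it is fixed. Restriction of scalars along $\psi$ makes $\Omega(M)$ an $\mathcal{H}_\infty$-algebra, and in cohomology this induces the hypercommutative algebra structure on $H_{\mathrm{dR}}^*(M)$ in the claim (an $\mathcal{H}_\infty$-algebra structure induces an $\mathcal{H}=H^*(\mathcal{H}_\infty)$-algebra structure on cohomology). *)

theory Defs
  imports "HOL-Analysis.Analysis" "HOL-Library.Function_Algebras"
begin

section \<open>Preliminaries\<close>

instantiation "fun" :: (type, real_vector) real_vector
begin
definition scaleR_fun :: "real \<Rightarrow> ('a \<Rightarrow> 'b) \<Rightarrow> 'a \<Rightarrow> 'b"
  where "scaleR_fun r f = (\<lambda>x. r *\<^sub>R f x)"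
instance
  by standard (simp_all add: scaleR_fun_def fun_eq_iff scaleR_right_distrib scaleR_left_distrib)
end

definition parity_sign :: "int \<Rightarrow> real"
  where "parity_sign k = (if even k then 1 else -1)"

text \<open>The Koszul sign of the rearrangement of $x_0,\dots,x_{n-1}$ into
  $x_{\sigma(0)},\dots,x_{\sigma(n-1)}$, where \<open>ds\<close> lists the degrees of $x_0,\dots,x_{n-1}$.\<close>

definition koszul_sign :: "(nat \<Rightarrow> nat) \<Rightarrow> int list \<Rightarrow> real" where
  "koszul_sign \<sigma> ds =
     (\<Prod>(i, j) \<in> {(i, j). i < j \<and> j < length ds \<and> \<sigma> j < \<sigma> i}. parity_sign (ds ! \<sigma> i * ds ! \<sigma> j))"

definition list_perm :: "nat list \<Rightarrow> nat \<Rightarrow> nat"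
  where "list_perm l j = (if j < length l then l ! j else j)"

definition list_minus :: "nat list \<Rightarrow> nat list \<Rightarrow> nat list"
  where "list_minus xs ys = filter (\<lambda>x. x \<notin> set ys) xs"


section \<open>Cochain complexes and cohomology\<close>

text \<open>The graded pieces are subspaces of one ambient real vector space; they need not be independent.\<close>

record 'v cochain =
  cgrp :: "int \<Rightarrow> 'v set"
  cdif :: "int \<Rightarrow> 'v \<Rightarrow> 'v"

definition cocycles :: "'v::real_vector cochain \<Rightarrow> int \<Rightarrow> 'v set"
  where "cocycles V k = {x \<in> cgrp V k. cdif V k x = 0}"

definition coclass :: "'v::real_vector cochain \<Rightarrow> int \<Rightarrow> 'v \<Rightarrow> 'v set"
  where "coclass V k x = {y \<in> cocycles V k. y - x \<in> cdif V (k - 1) ` cgrp V (k - 1)}"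

definition cohomology :: "'v::real_vector cochain \<Rightarrow> int \<Rightarrow> 'v set set"
  where "cohomology V k = coclass V k ` cocycles V k"


section \<open>Symmetric DG operads\<close>

text \<open>Operads are given by partial compositions: \<open>pcomp P n k m l i x y\<close> is
  $x\circ_i y$ for $x$ of arity $n$ and degree $k$, and $y$ of arity $m$ and degree $l$; the inputs
  of an operation of arity $n$ are numbered $0,\dots,n-1$. Symmetric groups act on the left:
  $\sigma x$ is the operation whose input number $\sigma(i)$ is the input number $i$ of $x$.\<close>

record 'p operad =
  ops :: "nat \<Rightarrow> int \<Rightarrow> 'p set"
  opunit :: 'p
  pcomp :: "nat \<Rightarrow> int \<Rightarrow> nat \<Rightarrow> int \<Rightarrow> nat \<Rightarrow> 'p \<Rightarrow> 'p \<Rightarrow> 'p"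
  pact :: "nat \<Rightarrow> int \<Rightarrow> (nat \<Rightarrow> nat) \<Rightarrow> 'p \<Rightarrow> 'p"
  pdif :: "nat \<Rightarrow> int \<Rightarrow> 'p \<Rightarrow> 'p"

text \<open>The permutation $\sigma\circ_i\tau$ of the $n+m-1$ inputs of $x\circ_i y$ with
  $(\sigma x)\circ_{\sigma(i)}(\tau y)=(\sigma\circ_i\tau)(x\circ_i y)$. The inputs of $y$ occupy the
  positions $i,\dots,i+m-1$ of $x\circ_i y$, the input $j>i$ of $x$ has position $j+m-1$.\<close>

definition block_perm :: "nat \<Rightarrow> nat \<Rightarrow> nat \<Rightarrow> (nat \<Rightarrow> nat) \<Rightarrow> (nat \<Rightarrow> nat) \<Rightarrow> nat \<Rightarrow> nat" where
  "block_perm n m i \<sigma> \<tau> x =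
    (if n + m - 1 \<le> x then x
     else if i \<le> x \<and> x < i + m then \<sigma> i + \<tau> (x - i)
     else let j = \<sigma> (if x < i then x else x + 1 - m)
          in if j < \<sigma> i then j else j + m - 1)"

locale dg_operad =
  fixes P :: "'p::real_vector operad"
  assumes subspace_ops: "subspace (ops P n k)"
    and unit_closed: "opunit P \<in> ops P 1 0"
    and comp_closed: "x \<in> ops P n k \<Longrightarrow> y \<in> ops P m l \<Longrightarrow> i < n \<Longrightarrow>
      pcomp P n k m l i x y \<in> ops P (n + m - 1) (k + l)"
    and act_closed: "x \<in> ops P n k \<Longrightarrow> \<sigma> permutes {..<n} \<Longrightarrow> pact P n k \<sigma> x \<in> ops P n k"
    and dif_closed: "x \<in> ops P n k \<Longrightarrow> pdif P n k x \<in> ops P n (k + 1)"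
    and comp_linear_left: "x \<in> ops P n k \<Longrightarrow> x' \<in> ops P n k \<Longrightarrow> y \<in> ops P m l \<Longrightarrow> i < n \<Longrightarrow>
      pcomp P n k m l i (r *\<^sub>R x + x') y = r *\<^sub>R pcomp P n k m l i x y + pcomp P n k m l i x' y"
    and comp_linear_right: "x \<in> ops P n k \<Longrightarrow> y \<in> ops P m l \<Longrightarrow> y' \<in> ops P m l \<Longrightarrow> i < n \<Longrightarrow>
      pcomp P n k m l i x (r *\<^sub>R y + y') = r *\<^sub>R pcomp P n k m l i x y + pcomp P n k m l i x y'"
    and act_linear: "x \<in> ops P n k \<Longrightarrow> x' \<in> ops P n k \<Longrightarrow> \<sigma> permutes {..<n} \<Longrightarrow>
      pact P n k \<sigma> (r *\<^sub>R x + x') = r *\<^sub>R pact P n k \<sigma> x + pact P n k \<sigma> x'"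
    and dif_linear: "x \<in> ops P n k \<Longrightarrow> x' \<in> ops P n k \<Longrightarrow>
      pdif P n k (r *\<^sub>R x + x') = r *\<^sub>R pdif P n k x + pdif P n k x'"
    and unit_left: "x \<in> ops P n k \<Longrightarrow> pcomp P 1 0 n k 0 (opunit P) x = x"
    and unit_right: "x \<in> ops P n k \<Longrightarrow> i < n \<Longrightarrow> pcomp P n k 1 0 i x (opunit P) = x"
    and comp_sequential: "x \<in> ops P n k \<Longrightarrow> y \<in> ops P m l \<Longrightarrow> z \<in> ops P q e \<Longrightarrow> i < n \<Longrightarrow> j < m \<Longrightarrow>
      pcomp P (n + m - 1) (k + l) q e (i + j) (pcomp P n k m l i x y) z =
      pcomp P n k (m + q - 1) (l + e) i x (pcomp P m l q e j y z)"
    and comp_parallel: "x \<in> ops P n k \<Longrightarrow> y \<in> ops P m l \<Longrightarrow> z \<in> ops P q e \<Longrightarrow> i < j \<Longrightarrow> j < n \<Longrightarrow>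
      pcomp P (n + m - 1) (k + l) q e (j + m - 1) (pcomp P n k m l i x y) z =
      parity_sign (l * e) *\<^sub>R pcomp P (n + q - 1) (k + e) m l i (pcomp P n k q e j x z) y"
    and act_id: "x \<in> ops P n k \<Longrightarrow> pact P n k id x = x"
    and act_comp: "x \<in> ops P n k \<Longrightarrow> \<sigma> permutes {..<n} \<Longrightarrow> \<tau> permutes {..<n} \<Longrightarrow>
      pact P n k (\<sigma> \<circ> \<tau>) x = pact P n k \<sigma> (pact P n k \<tau> x)"
    and equivariant: "x \<in> ops P n k \<Longrightarrow> y \<in> ops P m l \<Longrightarrow> i < n \<Longrightarrow>
      \<sigma> permutes {..<n} \<Longrightarrow> \<tau> permutes {..<m} \<Longrightarrow>
      pcomp P n k m l (\<sigma> i) (pact P n k \<sigma> x) (pact P m l \<tau> y) =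
      pact P (n + m - 1) (k + l) (block_perm n m i \<sigma> \<tau>) (pcomp P n k m l i x y)"
    and dif_dif: "x \<in> ops P n k \<Longrightarrow> pdif P n (k + 1) (pdif P n k x) = 0"
    and dif_comp: "x \<in> ops P n k \<Longrightarrow> y \<in> ops P m l \<Longrightarrow> i < n \<Longrightarrow>
      pdif P (n + m - 1) (k + l) (pcomp P n k m l i x y) =
      pcomp P n (k + 1) m l i (pdif P n k x) y
        + parity_sign k *\<^sub>R pcomp P n k m (l + 1) i x (pdif P m l y)"
    and dif_act: "x \<in> ops P n k \<Longrightarrow> \<sigma> permutes {..<n} \<Longrightarrow>
      pdif P n k (pact P n k \<sigma> x) = pact P n (k + 1) \<sigma> (pdif P n k x)"

locale operad_hom =
  fixes P :: "'p::real_vector operad" and Q :: "'q::real_vector operad"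
    and f :: "nat \<Rightarrow> int \<Rightarrow> 'p \<Rightarrow> 'q"
  assumes hom_closed: "x \<in> ops P n k \<Longrightarrow> f n k x \<in> ops Q n k"
    and hom_linear: "x \<in> ops P n k \<Longrightarrow> y \<in> ops P n k \<Longrightarrow> f n k (r *\<^sub>R x + y) = r *\<^sub>R f n k x + f n k y"
    and hom_unit: "f 1 0 (opunit P) = opunit Q"
    and hom_comp: "x \<in> ops P n k \<Longrightarrow> y \<in> ops P m l \<Longrightarrow> i < n \<Longrightarrow>
      f (n + m - 1) (k + l) (pcomp P n k m l i x y) = pcomp Q n k m l i (f n k x) (f m l y)"
    and hom_act: "x \<in> ops P n k \<Longrightarrow> \<sigma> permutes {..<n} \<Longrightarrow>
      f n k (pact P n k \<sigma> x) = pact Q n k \<sigma> (f n k x)"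
    and hom_dif: "x \<in> ops P n k \<Longrightarrow> f n (k + 1) (pdif P n k x) = pdif Q n k (f n k x)"

definition arity_complex :: "'p operad \<Rightarrow> nat \<Rightarrow> 'p cochain"
  where "arity_complex P n = \<lparr>cgrp = ops P n, cdif = pdif P n\<rparr>"

definition quasi_iso ::
    "'p::real_vector operad \<Rightarrow> 'q::real_vector operad \<Rightarrow> (nat \<Rightarrow> int \<Rightarrow> 'p \<Rightarrow> 'q) \<Rightarrow> bool" where
  "quasi_iso P Q f \<longleftrightarrow> operad_hom P Q f \<and>
     (\<forall>n k. bij_betw (\<lambda>X. coclass (arity_complex Q n) k (f n k (SOME x. x \<in> X)))
        (cohomology (arity_complex P n) k) (cohomology (arity_complex Q n) k))"


section \<open>Presentations by generators and relations\<close>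

text \<open>Formal operadic expressions; \<open>Gen g n k\<close> is a generator of arity $n$ and degree $k$.\<close>

datatype 'g opexpr =
    Gen 'g nat int
  | OpUnit
  | Zero nat int
  | Add "'g opexpr" "'g opexpr"
  | Scale real "'g opexpr"
  | Comp "'g opexpr" nat "'g opexpr"
  | Act "nat \<Rightarrow> nat" "'g opexpr"
  | Dif "'g opexpr"

primrec arity :: "'g opexpr \<Rightarrow> nat" where
  "arity (Gen g n k) = n"
| "arity OpUnit = 1"
| "arity (Zero n k) = n"
| "arity (Add s t) = arity s"
| "arity (Scale r s) = arity s"
| "arity (Comp s i t) = arity s + arity t - 1"
| "arity (Act \<sigma> s) = arity s"
| "arity (Dif s) = arity s"

primrec deg :: "'g opexpr \<Rightarrow> int" where
  "deg (Gen g n k) = k"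
| "deg OpUnit = 0"
| "deg (Zero n k) = k"
| "deg (Add s t) = deg s"
| "deg (Scale r s) = deg s"
| "deg (Comp s i t) = deg s + deg t"
| "deg (Act \<sigma> s) = deg s"
| "deg (Dif s) = deg s + 1"

text \<open>A signature \<open>G\<close> consists of the triples (generator, arity, degree).\<close>

primrec well_formed :: "('g \<times> nat \<times> int) set \<Rightarrow> 'g opexpr \<Rightarrow> bool" where
  "well_formed G (Gen g n k) \<longleftrightarrow> (g, n, k) \<in> G"
| "well_formed G OpUnit \<longleftrightarrow> True"
| "well_formed G (Zero n k) \<longleftrightarrow> True"
| "well_formed G (Add s t) \<longleftrightarrow> well_formed G s \<and> well_formed G t \<and> arity s = arity t \<and> deg s = deg t"
| "well_formed G (Scale r s) \<longleftrightarrow> well_formed G s"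
| "well_formed G (Comp s i t) \<longleftrightarrow> well_formed G s \<and> well_formed G t \<and> i < arity s"
| "well_formed G (Act \<sigma> s) \<longleftrightarrow> well_formed G s \<and> \<sigma> permutes {..<arity s}"
| "well_formed G (Dif s) \<longleftrightarrow> well_formed G s"

primrec op_eval :: "'p::real_vector operad \<Rightarrow> ('g \<Rightarrow> 'p) \<Rightarrow> 'g opexpr \<Rightarrow> 'p" where
  "op_eval P v (Gen g n k) = v g"
| "op_eval P v OpUnit = opunit P"
| "op_eval P v (Zero n k) = 0"
| "op_eval P v (Add s t) = op_eval P v s + op_eval P v t"
| "op_eval P v (Scale r s) = r *\<^sub>R op_eval P v s"
| "op_eval P v (Comp s i t) =
     pcomp P (arity s) (deg s) (arity t) (deg t) i (op_eval P v s) (op_eval P v t)"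
| "op_eval P v (Act \<sigma> s) = pact P (arity s) (deg s) \<sigma> (op_eval P v s)"
| "op_eval P v (Dif s) = pdif P (arity s) (deg s) (op_eval P v s)"

text \<open>The congruence generated by the axioms of DG operads and the relations \<open>R\<close>. Its quotient is the
  free DG operad on the signature \<open>G\<close> modulo the operadic DG ideal generated by \<open>R\<close>.\<close>

inductive op_eq :: "('g \<times> nat \<times> int) set \<Rightarrow> ('g opexpr \<times> 'g opexpr) set \<Rightarrow>
    'g opexpr \<Rightarrow> 'g opexpr \<Rightarrow> bool" for G R where
  rel: "(s, t) \<in> R \<Longrightarrow> well_formed G s \<Longrightarrow> well_formed G t \<Longrightarrow> arity s = arity t \<Longrightarrow> deg s = deg t \<Longrightarrow>
    op_eq G R s t"
| refl: "well_formed G s \<Longrightarrow> op_eq G R s s"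
| sym: "op_eq G R s t \<Longrightarrow> op_eq G R t s"
| trans: "op_eq G R s t \<Longrightarrow> op_eq G R t u \<Longrightarrow> op_eq G R s u"
| add_cong: "op_eq G R s s' \<Longrightarrow> op_eq G R t t' \<Longrightarrow> well_formed G (Add s t) \<Longrightarrow>
    op_eq G R (Add s t) (Add s' t')"
| scale_cong: "op_eq G R s s' \<Longrightarrow> op_eq G R (Scale r s) (Scale r s')"
| comp_cong: "op_eq G R s s' \<Longrightarrow> op_eq G R t t' \<Longrightarrow> well_formed G (Comp s i t) \<Longrightarrow>
    op_eq G R (Comp s i t) (Comp s' i t')"
| act_cong: "op_eq G R s s' \<Longrightarrow> well_formed G (Act \<sigma> s) \<Longrightarrow> op_eq G R (Act \<sigma> s) (Act \<sigma> s')"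
| dif_cong: "op_eq G R s s' \<Longrightarrow> op_eq G R (Dif s) (Dif s')"
| add_commute: "well_formed G (Add s t) \<Longrightarrow> op_eq G R (Add s t) (Add t s)"
| add_assoc: "well_formed G (Add (Add s t) u) \<Longrightarrow> op_eq G R (Add (Add s t) u) (Add s (Add t u))"
| add_zero: "well_formed G s \<Longrightarrow> op_eq G R (Add s (Zero (arity s) (deg s))) s"
| add_neg: "well_formed G s \<Longrightarrow> op_eq G R (Add s (Scale (-1) s)) (Zero (arity s) (deg s))"
| scale_add: "well_formed G (Add s t) \<Longrightarrow> op_eq G R (Scale r (Add s t)) (Add (Scale r s) (Scale r t))"
| add_scale: "well_formed G s \<Longrightarrow> op_eq G R (Scale (r + r') s) (Add (Scale r s) (Scale r' s))"
| scale_scale: "well_formed G s \<Longrightarrow> op_eq G R (Scale r (Scale r' s)) (Scale (r * r') s)"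
| scale_one: "well_formed G s \<Longrightarrow> op_eq G R (Scale 1 s) s"
| comp_add_left: "well_formed G (Comp (Add s s') i t) \<Longrightarrow>
    op_eq G R (Comp (Add s s') i t) (Add (Comp s i t) (Comp s' i t))"
| comp_add_right: "well_formed G (Comp s i (Add t t')) \<Longrightarrow>
    op_eq G R (Comp s i (Add t t')) (Add (Comp s i t) (Comp s i t'))"
| comp_scale_left: "well_formed G (Comp s i t) \<Longrightarrow>
    op_eq G R (Comp (Scale r s) i t) (Scale r (Comp s i t))"
| comp_scale_right: "well_formed G (Comp s i t) \<Longrightarrow>
    op_eq G R (Comp s i (Scale r t)) (Scale r (Comp s i t))"
| act_add: "well_formed G (Act \<sigma> (Add s t)) \<Longrightarrow> op_eq G R (Act \<sigma> (Add s t)) (Add (Act \<sigma> s) (Act \<sigma> t))"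
| act_scale: "well_formed G (Act \<sigma> s) \<Longrightarrow> op_eq G R (Act \<sigma> (Scale r s)) (Scale r (Act \<sigma> s))"
| dif_add: "well_formed G (Add s t) \<Longrightarrow> op_eq G R (Dif (Add s t)) (Add (Dif s) (Dif t))"
| dif_scale: "well_formed G s \<Longrightarrow> op_eq G R (Dif (Scale r s)) (Scale r (Dif s))"
| unit_left: "well_formed G s \<Longrightarrow> op_eq G R (Comp OpUnit 0 s) s"
| unit_right: "well_formed G (Comp s i OpUnit) \<Longrightarrow> op_eq G R (Comp s i OpUnit) s"
| comp_sequential: "well_formed G (Comp s i t) \<Longrightarrow> well_formed G (Comp t j u) \<Longrightarrow>
    op_eq G R (Comp (Comp s i t) (i + j) u) (Comp s i (Comp t j u))"
| comp_parallel: "well_formed G (Comp s i t) \<Longrightarrow> well_formed G (Comp s j u) \<Longrightarrow> i < j \<Longrightarrow>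
    op_eq G R (Comp (Comp s i t) (j + arity t - 1) u)
      (Scale (parity_sign (deg t * deg u)) (Comp (Comp s j u) i t))"
| act_id: "well_formed G s \<Longrightarrow> op_eq G R (Act id s) s"
| act_comp: "well_formed G (Act \<sigma> s) \<Longrightarrow> well_formed G (Act \<tau> s) \<Longrightarrow>
    op_eq G R (Act (\<sigma> \<circ> \<tau>) s) (Act \<sigma> (Act \<tau> s))"
| equivariant: "well_formed G (Comp s i t) \<Longrightarrow> well_formed G (Act \<sigma> s) \<Longrightarrow> well_formed G (Act \<tau> t) \<Longrightarrow>
    op_eq G R (Comp (Act \<sigma> s) (\<sigma> i) (Act \<tau> t))
      (Act (block_perm (arity s) (arity t) i \<sigma> \<tau>) (Comp s i t))"
| dif_dif: "well_formed G s \<Longrightarrow> op_eq G R (Dif (Dif s)) (Zero (arity s) (deg s + 2))"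
| dif_comp: "well_formed G (Comp s i t) \<Longrightarrow>
    op_eq G R (Dif (Comp s i t))
      (Add (Comp (Dif s) i t) (Scale (parity_sign (deg s)) (Comp s i (Dif t))))"
| dif_act: "well_formed G (Act \<sigma> s) \<Longrightarrow> op_eq G R (Dif (Act \<sigma> s)) (Act \<sigma> (Dif s))"

text \<open>\<open>P\<close> is the DG operad presented by the signature \<open>G\<close>, whose generators are sent to \<open>P\<close> by \<open>v\<close>, and
  the relations \<open>R\<close>. This determines \<open>P\<close> and \<open>v\<close> up to a unique isomorphism.\<close>

definition presented_by :: "'p::real_vector operad \<Rightarrow> ('g \<Rightarrow> 'p) \<Rightarrow> ('g \<times> nat \<times> int) set \<Rightarrow>
    ('g opexpr \<times> 'g opexpr) set \<Rightarrow> bool" where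
  "presented_by P v G R \<longleftrightarrow> dg_operad P \<and>
     (\<forall>(g, n, k) \<in> G. v g \<in> ops P n k) \<and>
     (\<forall>n k. \<forall>x \<in> ops P n k. \<exists>s. well_formed G s \<and> arity s = n \<and> deg s = k \<and> op_eval P v s = x) \<and>
     (\<forall>s t. well_formed G s \<longrightarrow> well_formed G t \<longrightarrow> arity s = arity t \<longrightarrow> deg s = deg t \<longrightarrow>
        (op_eval P v s = op_eval P v t \<longleftrightarrow> op_eq G R s t))"

definition expr_sum :: "nat \<Rightarrow> int \<Rightarrow> 'g opexpr list \<Rightarrow> 'g opexpr"
  where "expr_sum n k ss = foldr Add ss (Zero n k)"


section \<open>The hypercommutative operad\<close>

abbreviation hyp_gen :: "nat \<Rightarrow> nat opexpr"
  where "hyp_gen n \<equiv> Gen n n (2 * (2 - int n))"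

definition hyp_signature :: "(nat \<times> nat \<times> int) set"
  where "hyp_signature = {(n, n, 2 * (2 - int n)) | n. 2 \<le> n}"

text \<open>The two sides of the relation with elements $a,b,c,x_1,\dots,x_n$ in the positions
  $0,1,2,3,\dots,n+2$; the lists \<open>S\<close> run over the subsets of the set of positions of $x_1,\dots,x_n$.
  The Koszul signs are those of the action of permutations on an endomorphism operad.\<close>

definition hyp_left :: "nat \<Rightarrow> nat opexpr" where
  "hyp_left n = expr_sum (n + 3) (- 2 * int n)
     (map (\<lambda>S. let T = list_minus [3..<n + 3] S in
        Act (list_perm ([0, 1] @ S @ [2] @ T))
          (Comp (hyp_gen (length T + 2)) 0 (hyp_gen (length S + 2))))
        (subseqs [3..<n + 3]))"

definition hyp_right :: "nat \<Rightarrow> nat opexpr" where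
  "hyp_right n = expr_sum (n + 3) (- 2 * int n)
     (map (\<lambda>S. let T = list_minus [3..<n + 3] S in
        Act (list_perm ([0] @ [1, 2] @ S @ T))
          (Comp (hyp_gen (length T + 2)) 1 (hyp_gen (length S + 2))))
        (subseqs [3..<n + 3]))"

definition hyp_relations :: "(nat opexpr \<times> nat opexpr) set" where
  "hyp_relations =
     {(Act \<sigma> (hyp_gen n), hyp_gen n) | n \<sigma>. 2 \<le> n \<and> \<sigma> permutes {..<n}} \<union>
     {(Dif (hyp_gen n), Zero n (2 * (2 - int n) + 1)) | n. 2 \<le> n} \<union>
     {(hyp_left n, hyp_right n) | n. True}"

definition hypercommutative_operad :: "'p::real_vector operad \<Rightarrow> (nat \<Rightarrow> 'p) \<Rightarrow> bool"
  where "hypercommutative_operad H m \<longleftrightarrow> presented_by H m hyp_signature hyp_relations"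

definition degree_zero_part :: "'p::real_vector operad \<Rightarrow> 'p operad"
  where "degree_zero_part P = P\<lparr>ops := \<lambda>n k. if k = 0 then ops P n 0 else {0}\<rparr>"


section \<open>Minimal resolutions\<close>

text \<open>The graded operad underlying \<open>P\<close>, regarded as a DG operad with zero differential, is free on the
  $\mathbb{S}$-module \<open>E\<close>.\<close>

definition quasi_free_on :: "'p::real_vector operad \<Rightarrow> (nat \<Rightarrow> int \<Rightarrow> 'p set) \<Rightarrow> bool" where
  "quasi_free_on P E \<longleftrightarrow>
     (\<forall>n k. subspace (E n k) \<and> E n k \<subseteq> ops P n k) \<and>
     (\<forall>n k \<sigma>. \<forall>x \<in> E n k. \<sigma> permutes {..<n} \<longrightarrow> pact P n k \<sigma> x \<in> E n k) \<and>
     presented_by (P\<lparr>pdif := \<lambda>n k x. 0\<rparr>) id {(x, n, k). x \<in> E n k}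
       ({(Gen (r *\<^sub>R x + y) n k, Add (Scale r (Gen x n k)) (Gen y n k)) | r x y n k.
           x \<in> E n k \<and> y \<in> E n k} \<union>
        {(Act \<sigma> (Gen x n k), Gen (pact P n k \<sigma> x) n k) | \<sigma> x n k.
           x \<in> E n k \<and> \<sigma> permutes {..<n}} \<union>
        {(Dif (Gen x n k), Zero n (k + 1)) | x n k. x \<in> E n k})"

definition decomposables :: "'p::real_vector operad \<Rightarrow> nat \<Rightarrow> int \<Rightarrow> 'p set" where
  "decomposables P n k = span {pcomp P a e b l i x y | a e b l i x y.
     x \<in> ops P a e \<and> y \<in> ops P b l \<and> 2 \<le> a \<and> 2 \<le> b \<and> i < a \<and> a + b - 1 = n \<and> e + l = k}"

text \<open>The operads to be resolved are trivial in arities 0 and 1, so that the generators lie in arities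
  at least 2; then the triangulation condition on the differential follows from decomposability, by
  induction on the arity. Minimal resolutions are unique up to isomorphism; that of a Koszul operad is
  its Koszul resolution.\<close>

definition minimal_resolution :: "'p::real_vector operad \<Rightarrow> (nat \<Rightarrow> int \<Rightarrow> 'p set) \<Rightarrow>
    (nat \<Rightarrow> int \<Rightarrow> 'p \<Rightarrow> 'q) \<Rightarrow> 'q::real_vector operad \<Rightarrow> bool" where
  "minimal_resolution P E p Q \<longleftrightarrow> dg_operad P \<and> quasi_free_on P E \<and>
     (\<forall>n k. n < 2 \<longrightarrow> E n k = {0}) \<and>
     (\<forall>n k. pdif P n k ` E n k \<subseteq> decomposables P n (k + 1)) \<and>
     quasi_iso P Q p"


section \<open>The operad $\mathcal{CBV}_\infty/\Delta$\<close>

datatype cbv_gen = Mu | Delta nat | Phi nat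

abbreviation mu_gen :: "cbv_gen opexpr" where "mu_gen \<equiv> Gen Mu 2 0"
abbreviation delta_gen :: "nat \<Rightarrow> cbv_gen opexpr" where "delta_gen n \<equiv> Gen (Delta n) 1 (1 - 2 * int n)"
abbreviation phi_gen :: "nat \<Rightarrow> cbv_gen opexpr" where "phi_gen n \<equiv> Gen (Phi n) 1 (- 2 * int n)"

definition cbv_signature :: "(cbv_gen \<times> nat \<times> int) set" where
  "cbv_signature = {(Mu, 2, 0)} \<union> {(Delta n, 1, 1 - 2 * int n) | n. 1 \<le> n} \<union>
     {(Phi n, 1, - 2 * int n) | n. 1 \<le> n}"

primrec mu_power :: "nat \<Rightarrow> cbv_gen opexpr" where
  "mu_power 0 = OpUnit"
| "mu_power (Suc n) = Comp mu_gen 0 (mu_power n)"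

text \<open>\<open>diff_op_term D p q\<close> is $D(x_1\cdots x_p)x_{p+1}\cdots x_{p+q}$; \<open>mu_power n\<close> is the product of
  $n+1$ elements.\<close>

definition diff_op_term :: "cbv_gen opexpr \<Rightarrow> nat \<Rightarrow> nat \<Rightarrow> cbv_gen opexpr" where
  "diff_op_term D p q =
     (if q = 0 then Comp D 0 (mu_power (p - 1))
      else Comp (Comp mu_gen 0 (Comp D 0 (mu_power (p - 1)))) p (mu_power (q - 1)))"

text \<open>The expression whose vanishing says that $D$ is a differential operator of order at most $r$. The
  $(p,q)$-shuffles $\sigma$ correspond to the subsets $\{\sigma(1),\dots,\sigma(p)\}$, listed by \<open>S\<close>.\<close>

definition diff_op_expr :: "nat \<Rightarrow> cbv_gen opexpr \<Rightarrow> cbv_gen opexpr" where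
  "diff_op_expr r D = expr_sum (r + 1) (deg D)
     (map (\<lambda>S. let T = list_minus [0..<r + 1] S in
        Scale ((-1) ^ length S) (Act (list_perm (S @ T)) (diff_op_term D (length S) (length T))))
        (filter (\<lambda>S. S \<noteq> []) (subseqs [0..<r + 1])))"

text \<open>The graded commutator of operations of arity 1.\<close>

definition commutator_expr :: "'g opexpr \<Rightarrow> 'g opexpr \<Rightarrow> 'g opexpr" where
  "commutator_expr s t = Add (Comp s 0 t) (Scale (- parity_sign (deg s * deg t)) (Comp t 0 s))"

fun phi_bracket :: "nat list \<Rightarrow> cbv_gen opexpr" where
  "phi_bracket [] = Zero 1 1"
| "phi_bracket [q] = Dif (phi_gen q)"
| "phi_bracket (q # qs) = commutator_expr (phi_gen q) (phi_bracket qs)"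

definition phi_expr :: "nat \<Rightarrow> cbv_gen opexpr" where
  "phi_expr n = Add (Dif (phi_gen n)) (expr_sum 1 (1 - 2 * int n)
     (concat (map (\<lambda>p. map (\<lambda>qs. Scale (1 / fact p) (phi_bracket qs))
        (filter (\<lambda>qs. sum_list qs = n) (List.n_lists p [1..<n + 1])))
        [2..<n + 1])))"

definition delta_expr :: "nat \<Rightarrow> cbv_gen opexpr" where
  "delta_expr n = Add (Dif (delta_gen n)) (expr_sum 1 (2 - 2 * int n)
     (map (\<lambda>r. Comp (delta_gen r) 0 (delta_gen (n - r))) [1..<n]))"

definition cbv_relations :: "(cbv_gen opexpr \<times> cbv_gen opexpr) set" where
  "cbv_relations =
     {(Act \<sigma> mu_gen, mu_gen) | \<sigma>. \<sigma> permutes {..<2}} \<union>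
     {(Dif mu_gen, Zero 2 1)} \<union>
     {(Comp mu_gen 0 mu_gen, Comp mu_gen 1 mu_gen)} \<union>
     {(delta_expr n, Zero 1 (2 - 2 * int n)) | n. 1 \<le> n} \<union>
     {(diff_op_expr (n + 1) (delta_gen n), Zero (n + 2) (1 - 2 * int n)) | n. 1 \<le> n} \<union>
     {(phi_expr n, Scale (-1) (delta_gen n)) | n. 1 \<le> n}"

definition cbv_mod_delta_operad :: "'p::real_vector operad \<Rightarrow> (cbv_gen \<Rightarrow> 'p) \<Rightarrow> bool"
  where "cbv_mod_delta_operad B b \<longleftrightarrow> presented_by B b cbv_signature cbv_relations"


section \<open>Algebras over operads\<close>

text \<open>Elements of the endomorphism operad take lists of pairs (degree, homogeneous element of this
  degree), and vanish by convention on all other lists.\<close>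

definition tagged_elements :: "'v::real_vector cochain \<Rightarrow> (int \<times> 'v) set"
  where "tagged_elements V = {(k, x). x \<in> cgrp V k}"

definition total_degree :: "(int \<times> 'v) list \<Rightarrow> int"
  where "total_degree xs = sum_list (map fst xs)"

definition end_ops :: "'v::real_vector cochain \<Rightarrow> nat \<Rightarrow> int \<Rightarrow> ((int \<times> 'v) list \<Rightarrow> 'v) set" where
  "end_ops V n e = {f.
     (\<forall>xs. if length xs = n \<and> set xs \<subseteq> tagged_elements V
           then f xs \<in> cgrp V (total_degree xs + e) else f xs = 0) \<and>
     (\<forall>xs i k x y r. length xs = n \<longrightarrow> set xs \<subseteq> tagged_elements V \<longrightarrow> i < n \<longrightarrow>
        x \<in> cgrp V k \<longrightarrow> y \<in> cgrp V k \<longrightarrow>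
        f (xs[i := (k, r *\<^sub>R x + y)]) = r *\<^sub>R f (xs[i := (k, x)]) + f (xs[i := (k, y)]))}"

definition restrict_op :: "'v::real_vector cochain \<Rightarrow> nat \<Rightarrow> ((int \<times> 'v) list \<Rightarrow> 'v) \<Rightarrow> (int \<times> 'v) list \<Rightarrow> 'v"
  where "restrict_op V n f xs = (if length xs = n \<and> set xs \<subseteq> tagged_elements V then f xs else 0)"

definition endomorphism_operad :: "'v::real_vector cochain \<Rightarrow> ((int \<times> 'v) list \<Rightarrow> 'v) operad" where
  "endomorphism_operad V = \<lparr>
     ops = end_ops V,
     opunit = restrict_op V 1 (\<lambda>xs. snd (hd xs)),
     pcomp = (\<lambda>n k m l i f g xs.
       let xs1 = take i xs; xs2 = take m (drop i xs); xs3 = drop (i + m) xs in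
       parity_sign (l * total_degree xs1) *\<^sub>R f (xs1 @ [(total_degree xs2 + l, g xs2)] @ xs3)),
     pact = (\<lambda>n k \<sigma> f. restrict_op V n (\<lambda>xs.
       koszul_sign \<sigma> (map fst xs) *\<^sub>R f (map (\<lambda>i. xs ! \<sigma> i) [0..<n]))),
     pdif = (\<lambda>n k f. restrict_op V n (\<lambda>xs.
       cdif V (total_degree xs + k) (f xs) -
       parity_sign k *\<^sub>R (\<Sum>i<n. parity_sign (total_degree (take i xs)) *\<^sub>R
         f (xs[i := (fst (xs ! i) + 1, cdif V (fst (xs ! i)) (snd (xs ! i)))])))) \<rparr>"

abbreviation operad_algebra :: "'p::real_vector operad \<Rightarrow> 'v::real_vector cochain \<Rightarrow>
    (nat \<Rightarrow> int \<Rightarrow> 'p \<Rightarrow> (int \<times> 'v) list \<Rightarrow> 'v) \<Rightarrow> bool"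
  where "operad_algebra P V \<theta> \<equiv> operad_hom P (endomorphism_operad V) \<theta>"

text \<open>Given a \<open>P\<close>-algebra structure \<open>\<theta>\<close> on \<open>V\<close> and a quasi-isomorphism \<open>p\<close> from \<open>P\<close> onto an operad with
  zero differential (hence identified with the cohomology of \<open>P\<close>), this is the operation on the
  cohomology of \<open>V\<close> induced by an element \<open>h\<close> of arity $n$ and degree $e$ of the target of \<open>p\<close>; \<open>c\<close> is a
  cocycle of \<open>P\<close> representing \<open>h\<close>.\<close>

definition induced_operation :: "'p::real_vector operad \<Rightarrow> 'v::real_vector cochain \<Rightarrow>
    (nat \<Rightarrow> int \<Rightarrow> 'p \<Rightarrow> (int \<times> 'v) list \<Rightarrow> 'v) \<Rightarrow> (nat \<Rightarrow> int \<Rightarrow> 'p \<Rightarrow> 'q) \<Rightarrow>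
    nat \<Rightarrow> int \<Rightarrow> 'q \<Rightarrow> (int \<times> 'v set) list \<Rightarrow> 'v set" where
  "induced_operation P V \<theta> p n e h Xs =
     (let c = (SOME c. c \<in> cocycles (arity_complex P n) e \<and> p n e c = h)
      in coclass V (total_degree Xs + e) (\<theta> n e c (map (\<lambda>(k, X). (k, SOME x. x \<in> X)) Xs)))"


section \<open>Smooth manifolds\<close>

primrec Ck_on :: "nat \<Rightarrow> 'a::real_normed_vector set \<Rightarrow> ('a \<Rightarrow> 'b::real_normed_vector) \<Rightarrow> bool" where
  "Ck_on 0 U f \<longleftrightarrow> continuous_on U f"
| "Ck_on (Suc k) U f \<longleftrightarrow> (\<forall>x \<in> U. f differentiable (at x)) \<and>
     (\<forall>v. Ck_on k U (\<lambda>x. frechet_derivative f (at x) v))"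

definition smooth_on :: "'a::real_normed_vector set \<Rightarrow> ('a \<Rightarrow> 'b::real_normed_vector) \<Rightarrow> bool"
  where "smooth_on U f \<longleftrightarrow> (\<forall>k. Ck_on k U f)"

type_synonym ('m, 'e) atlas = "('m set \<times> ('m \<Rightarrow> 'e)) set"

text \<open>The model space \<open>'e\<close> is a finite-dimensional normed space, rather than of class
  \<open>euclidean_space\<close>, so as to include manifolds of dimension 0.\<close>

definition smooth_manifold ::
    "('m::{t2_space, second_countable_topology}, 'e::real_normed_vector) atlas \<Rightarrow> bool" where
  "smooth_manifold A \<longleftrightarrow>
     (\<exists>basis :: 'e set. finite basis \<and> span basis = UNIV) \<and>
     (\<Union>(U, \<phi>) \<in> A. U) = UNIV \<and>
     (\<forall>(U, \<phi>) \<in> A. open U \<and> open (\<phi> ` U) \<and> (\<exists>\<phi>'. homeomorphism U (\<phi> ` U) \<phi> \<phi>')) \<and>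
     (\<forall>(U, \<phi>) \<in> A. \<forall>(W, \<phi>') \<in> A. smooth_on (\<phi> ` (U \<inter> W)) (\<phi>' \<circ> inv_into U \<phi>))"

definition smooth_functions :: "('m, 'e::real_normed_vector) atlas \<Rightarrow> ('m \<Rightarrow> real) set"
  where "smooth_functions A = {f. \<forall>(U, \<phi>) \<in> A. smooth_on (\<phi> ` U) (f \<circ> inv_into U \<phi>)}"

text \<open>Vector fields are derivations of the algebra of smooth functions, extended by zero.\<close>

type_synonym 'm vfield = "('m \<Rightarrow> real) \<Rightarrow> 'm \<Rightarrow> real"

definition vector_fields :: "('m, 'e::real_normed_vector) atlas \<Rightarrow> 'm vfield set" where
  "vector_fields A = {X.
     (\<forall>f \<in> smooth_functions A. X f \<in> smooth_functions A) \<and>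
     (\<forall>f \<in> smooth_functions A. \<forall>g \<in> smooth_functions A. \<forall>r. X (r *\<^sub>R f + g) = r *\<^sub>R X f + X g) \<and>
     (\<forall>f \<in> smooth_functions A. \<forall>g \<in> smooth_functions A. X (f * g) = X f * g + f * X g) \<and>
     (\<forall>f. f \<notin> smooth_functions A \<longrightarrow> X f = 0)}"

definition lie_bracket :: "'m vfield \<Rightarrow> 'm vfield \<Rightarrow> 'm vfield"
  where "lie_bracket X Y f = X (Y f) - Y (X f)"


section \<open>Differential forms\<close>

text \<open>Differential forms of degree $k$ are the alternating $C^\infty(M)$-multilinear maps from $k$-tuples
  of vector fields to smooth functions, extended by zero to all other lists.\<close>

type_synonym 'm form = "'m vfield list \<Rightarrow> 'm \<Rightarrow> real"

definition forms :: "('m, 'e::real_normed_vector) atlas \<Rightarrow> nat \<Rightarrow> 'm form set" where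
  "forms A k = {\<omega>.
     (\<forall>Xs. if length Xs = k \<and> set Xs \<subseteq> vector_fields A
           then \<omega> Xs \<in> smooth_functions A else \<omega> Xs = 0) \<and>
     (\<forall>Xs i X Y. \<forall>f \<in> smooth_functions A.
        length Xs = k \<longrightarrow> set Xs \<subseteq> vector_fields A \<longrightarrow> i < k \<longrightarrow>
        X \<in> vector_fields A \<longrightarrow> Y \<in> vector_fields A \<longrightarrow>
        \<omega> (Xs[i := (\<lambda>h. f * X h + Y h)]) = f * \<omega> (Xs[i := X]) + \<omega> (Xs[i := Y])) \<and>
     (\<forall>Xs i j. length Xs = k \<longrightarrow> i < j \<longrightarrow> j < k \<longrightarrow> Xs ! i = Xs ! j \<longrightarrow> \<omega> Xs = 0)}"

definition delete_nth :: "nat \<Rightarrow> 'a list \<Rightarrow> 'a list"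
  where "delete_nth i xs = take i xs @ drop (Suc i) xs"

definition exterior_derivative ::
    "('m, 'e::real_normed_vector) atlas \<Rightarrow> 'm form \<Rightarrow> 'm form" where
  "exterior_derivative A \<omega> Xs =
     (if set Xs \<subseteq> vector_fields A then
        (\<Sum>i<length Xs. parity_sign (int i) *\<^sub>R (Xs ! i) (\<omega> (delete_nth i Xs))) +
        (\<Sum>(i, j) \<in> {(i, j). i < j \<and> j < length Xs}.
           parity_sign (int (i + j)) *\<^sub>R
             \<omega> (lie_bracket (Xs ! i) (Xs ! j) # delete_nth i (delete_nth j Xs)))
      else 0)"

text \<open>$(\alpha\wedge\beta)(X_1,\dots,X_{k+l})=\sum_\sigma\mathrm{sgn}(\sigma)
  \alpha(X_{\sigma(1)},\dots,X_{\sigma(k)})\beta(X_{\sigma(k+1)},\dots,X_{\sigma(k+l)})$, where $\sigma$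
  runs over the $(k,l)$-shuffles. The remaining terms in the sum below vanish on homogeneous forms.\<close>

definition wedge :: "'m form \<Rightarrow> 'm form \<Rightarrow> 'm form" where
  "wedge \<alpha> \<beta> Xs = sum_list (map (\<lambda>S. let T = list_minus [0..<length Xs] S in
     koszul_sign (list_perm (S @ T)) (replicate (length Xs) 1) *\<^sub>R
       (\<alpha> (map ((!) Xs) S) * \<beta> (map ((!) Xs) T)))
     (subseqs [0..<length Xs]))"

definition de_rham :: "('m, 'e::real_normed_vector) atlas \<Rightarrow> 'm form cochain" where
  "de_rham A = \<lparr>cgrp = (\<lambda>k. if 0 \<le> k then forms A (nat k) else {0}),
     cdif = (\<lambda>k. exterior_derivative A)\<rparr>"


section \<open>Polyvector fields\<close>

text \<open>A polyvector field $P$ of degree $k$ is encoded by the functional $\omega\mapsto i_P\omega$ on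
  differential forms of degree $k$, extended by zero. The pairing of
  $\Lambda^k_{C^\infty(M)}\Gamma(T(M))=\Gamma(\Lambda^kT(M))$ with $k$-forms is perfect. With $i_{PQ}=i_Pi_Q$
  and $(i_X\omega)(Y_1,Y_2,\dots)=\omega(X,Y_1,Y_2,\dots)$ we have
  $i_{X_1\cdots X_k}\omega=\omega(X_k,\dots,X_1)$.\<close>

type_synonym 'm polyvector = "'m form \<Rightarrow> 'm \<Rightarrow> real"

definition vf_product :: "('m, 'e::real_normed_vector) atlas \<Rightarrow> 'm vfield list \<Rightarrow> 'm polyvector" where
  "vf_product A Xs \<omega> = (if \<omega> \<in> forms A (length Xs) then \<omega> (rev Xs) else 0)"

definition polyvectors :: "('m, 'e::real_normed_vector) atlas \<Rightarrow> nat \<Rightarrow> 'm polyvector set" where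
  "polyvectors A k = {sum_list (map (\<lambda>(f, Xs) \<omega>. f * vf_product A Xs \<omega>) ts) | ts.
     \<forall>(f, Xs) \<in> set ts. f \<in> smooth_functions A \<and> length Xs = k \<and> set Xs \<subseteq> vector_fields A}"

definition interior :: "'m polyvector \<Rightarrow> 'm form \<Rightarrow> 'm form"
  where "interior P \<omega> Zs = P (\<lambda>Ys. \<omega> (Ys @ Zs))"

definition polyvector_mult :: "('m, 'e::real_normed_vector) atlas \<Rightarrow> nat \<Rightarrow> nat \<Rightarrow>
    'm polyvector \<Rightarrow> 'm polyvector \<Rightarrow> 'm polyvector" where
  "polyvector_mult A p q P Q \<omega> = (if \<omega> \<in> forms A (p + q) then P (interior Q \<omega>) else 0)"

definition graded_commutator ::
    "int \<Rightarrow> int \<Rightarrow> ('m form \<Rightarrow> 'm form) \<Rightarrow> ('m form \<Rightarrow> 'm form) \<Rightarrow> 'm form \<Rightarrow> 'm form"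
  where "graded_commutator a b F G \<omega> = F (G \<omega>) - parity_sign (a * b) *\<^sub>R G (F \<omega>)"

definition lie_derivative ::
    "('m, 'e::real_normed_vector) atlas \<Rightarrow> nat \<Rightarrow> 'm polyvector \<Rightarrow> 'm form \<Rightarrow> 'm form"
  where "lie_derivative A p P = graded_commutator (- int p) 1 (interior P) (exterior_derivative A)"

text \<open>The Schouten--Nijenhuis bracket of polyvector fields of degrees $p$ and $q$ is characterized by
  $i_{[P,Q]}=[L_P,i_Q]$.\<close>

definition schouten_bracket :: "('m, 'e::real_normed_vector) atlas \<Rightarrow> nat \<Rightarrow> nat \<Rightarrow>
    'm polyvector \<Rightarrow> 'm polyvector \<Rightarrow> 'm polyvector" where
  "schouten_bracket A p q P Q \<omega> =
     (if \<omega> \<in> forms A (p + q - 1)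
      then graded_commutator (1 - int p) (- int q) (lie_derivative A p P) (interior Q) \<omega> []
      else 0)"

definition jacobi_manifold ::
    "('m::{t2_space, second_countable_topology}, 'e::real_normed_vector) atlas \<Rightarrow>
     'm polyvector \<Rightarrow> 'm polyvector \<Rightarrow> bool" where
  "jacobi_manifold A \<pi> \<eta> \<longleftrightarrow> smooth_manifold A \<and> \<pi> \<in> polyvectors A 2 \<and> \<eta> \<in> polyvectors A 1 \<and>
     schouten_bracket A 2 2 \<pi> \<pi> = 2 *\<^sub>R polyvector_mult A 1 2 \<eta> \<pi> \<and>
     schouten_bracket A 2 1 \<pi> \<eta> = 0"


section \<open>The $\mathcal{CBV}_\infty/\Delta$-algebra of a Jacobi manifold\<close>

definition unary_op :: "('m, 'e::real_normed_vector) atlas \<Rightarrow> ('m form \<Rightarrow> 'm form) \<Rightarrow>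
    (int \<times> 'm form) list \<Rightarrow> 'm form"
  where "unary_op A F = restrict_op (de_rham A) 1 (\<lambda>xs. F (snd (xs ! 0)))"

fun jacobi_operations :: "('m, 'e::real_normed_vector) atlas \<Rightarrow> 'm polyvector \<Rightarrow> 'm polyvector \<Rightarrow>
    cbv_gen \<Rightarrow> (int \<times> 'm form) list \<Rightarrow> 'm form" where
  "jacobi_operations A \<pi> \<eta> Mu = restrict_op (de_rham A) 2 (\<lambda>xs. wedge (snd (xs ! 0)) (snd (xs ! 1)))"
| "jacobi_operations A \<pi> \<eta> (Delta n) =
     (if n = 1 then unary_op A (lie_derivative A 2 \<pi>)
      else if n = 2 then unary_op A (\<lambda>\<omega>. - interior \<eta> (interior \<pi> \<omega>))
      else 0)"
| "jacobi_operations A \<pi> \<eta> (Phi n) = (if n = 1 then unary_op A (interior \<pi>) else 0)"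

definition jacobi_cbv_algebra :: "('m, 'e::real_normed_vector) atlas \<Rightarrow> 'm polyvector \<Rightarrow>
    'm polyvector \<Rightarrow> 'b::real_vector operad \<Rightarrow> (cbv_gen \<Rightarrow> 'b) \<Rightarrow>
    (nat \<Rightarrow> int \<Rightarrow> 'b \<Rightarrow> (int \<times> 'm form) list \<Rightarrow> 'm form) \<Rightarrow> bool" where
  "jacobi_cbv_algebra A \<pi> \<eta> B b \<theta> \<longleftrightarrow> operad_algebra B (de_rham A) \<theta> \<and>
     (\<forall>(g, n, k) \<in> cbv_signature. \<theta> n k (b g) = jacobi_operations A \<pi> \<eta> g)"

end

theory Submission
  imports Defs
begin

text \<open>Let $\phi_1=i_\pi$. Among the operations of the $\mathcal{CBV}_\infty/\Delta$-algebra $\Omega(M)$ the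
  $\phi_n$ with $n\geq2$ vanish, and the last relation expresses all $\Delta_n$ by $\phi_1$ and the
  differential. Give $\phi_n$ and $\Delta_n$ the weight $n$ and $\mu$ the weight $0$; the relations are
  homogeneous. The triviality comes from a fact that distinguishes $i_\pi$ from a general $\phi_1$: since
  $\pi$ is a bivector field, $i_\pi$ is a differential operator of order $\leq2$, just like $\Delta_1$.
  Hence there is a map $h$ of degree $-1$ from $\mathcal{CBV}_\infty/\Delta$ to the operations on $\Omega(M)$, a
  derivation along the action, with $h(\Delta_1)=-\phi_1$ and $h=0$ on the other generators, such that
  $dh+hd$ is $w$ times the action on operations of weight $w$. A cocycle of weight $w>0$
  therefore acts on $\Omega(M)$ by a coboundary. An operation of weight $0$ is built from $\mu$ alone and has
  degree $0$, while $m_n$ has degree $2(2-n)<0$ for $n>2$; so every representative of $m_n$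
  acts by a coboundary in the endomorphism operad, that is, by zero on cohomology.

  The derivation $h$ is encoded as an operad morphism into the tensor product of the image of the
  action with the commutative DG algebra $\mathbb{R}\oplus\mathbb{R}\delta\oplus\mathbb{R}\varepsilon$,
  $d\delta=\varepsilon$ (\<open>path_operad\<close>): its $\delta$-component is the action multiplied by the
  weight, its $\varepsilon$-component is $h$. The morphism comes from the universal property of a
  presentation (\<open>op_eval_sound\<close>), for which the relations have to be checked (\<open>cbv_cocycle_acts_exactly\<close>). A cocycle of
  mixed weight is first split into its homogeneous parts; these are cocycles because rescaling the
  generators according to their weight is an endomorphism (\<open>presented_by_cocycle_parts\<close>). The two
  steps combine to \<open>cocycle_acts_exactly\<close>. The order of $i_\pi$ (\<open>interior_order_relation\<close>) follows from the fact that
  contraction with a vector field is a derivation of the wedge product (\<open>contract_wedge\<close>).\<close>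


section \<open>Evaluation of operadic expressions\<close>

lemma op_eq_arity_deg:
  assumes "op_eq G R s t"
  shows "arity s = arity t \<and> deg s = deg t"
  using assms by induction auto

context dg_operad
begin

lemma zero_closed: "0 \<in> ops P n k"
  and add_closed: "x \<in> ops P n k \<Longrightarrow> y \<in> ops P n k \<Longrightarrow> x + y \<in> ops P n k"
  and scale_closed: "x \<in> ops P n k \<Longrightarrow> r *\<^sub>R x \<in> ops P n k"
  and diff_closed: "x \<in> ops P n k \<Longrightarrow> y \<in> ops P n k \<Longrightarrow> x - y \<in> ops P n k"
  and sum_closed: "(\<And>a. a \<in> A \<Longrightarrow> f a \<in> ops P n k) \<Longrightarrow> sum f A \<in> ops P n k"
  using subspace_ops[of n k]
  by (auto simp: subspace_0 subspace_add subspace_scale subspace_diff subspace_sum)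

lemma comp_add_left:
  "x \<in> ops P n k \<Longrightarrow> x' \<in> ops P n k \<Longrightarrow> y \<in> ops P m l \<Longrightarrow> i < n \<Longrightarrow>
    pcomp P n k m l i (x + x') y = pcomp P n k m l i x y + pcomp P n k m l i x' y"
  using comp_linear_left[of x n k x' y m l i 1] by simp

lemma comp_zero_left: "y \<in> ops P m l \<Longrightarrow> i < n \<Longrightarrow> pcomp P n k m l i 0 y = 0"
  using comp_add_left[of 0 n k 0 y m l i] by (simp add: zero_closed)

lemma comp_scale_left:
  "x \<in> ops P n k \<Longrightarrow> y \<in> ops P m l \<Longrightarrow> i < n \<Longrightarrow>
    pcomp P n k m l i (r *\<^sub>R x) y = r *\<^sub>R pcomp P n k m l i x y"
  using comp_linear_left[of x n k 0 y m l i r] by (simp add: zero_closed comp_zero_left)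

lemma comp_diff_left:
  "x \<in> ops P n k \<Longrightarrow> x' \<in> ops P n k \<Longrightarrow> y \<in> ops P m l \<Longrightarrow> i < n \<Longrightarrow>
    pcomp P n k m l i (x - x') y = pcomp P n k m l i x y - pcomp P n k m l i x' y"
  using comp_add_left[of "x - x'" n k x' y m l i] by (simp add: diff_closed)

lemma comp_add_right:
  "x \<in> ops P n k \<Longrightarrow> y \<in> ops P m l \<Longrightarrow> y' \<in> ops P m l \<Longrightarrow> i < n \<Longrightarrow>
    pcomp P n k m l i x (y + y') = pcomp P n k m l i x y + pcomp P n k m l i x y'"
  using comp_linear_right[of x n k y m l y' i 1] by simp

lemma comp_zero_right: "x \<in> ops P n k \<Longrightarrow> i < n \<Longrightarrow> pcomp P n k m l i x 0 = 0"
  using comp_add_right[of x n k 0 m l 0 i] by (simp add: zero_closed)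

lemma comp_scale_right:
  "x \<in> ops P n k \<Longrightarrow> y \<in> ops P m l \<Longrightarrow> i < n \<Longrightarrow>
    pcomp P n k m l i x (r *\<^sub>R y) = r *\<^sub>R pcomp P n k m l i x y"
  using comp_linear_right[of x n k y m l 0 i r] by (simp add: zero_closed comp_zero_right)

lemma comp_diff_right:
  "x \<in> ops P n k \<Longrightarrow> y \<in> ops P m l \<Longrightarrow> y' \<in> ops P m l \<Longrightarrow> i < n \<Longrightarrow>
    pcomp P n k m l i x (y - y') = pcomp P n k m l i x y - pcomp P n k m l i x y'"
  using comp_add_right[of x n k "y - y'" m l y' i] by (simp add: diff_closed)

lemma act_add:
  "x \<in> ops P n k \<Longrightarrow> y \<in> ops P n k \<Longrightarrow> \<sigma> permutes {..<n} \<Longrightarrow>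
    pact P n k \<sigma> (x + y) = pact P n k \<sigma> x + pact P n k \<sigma> y"
  using act_linear[of x n k y \<sigma> 1] by simp

lemma act_zero: "\<sigma> permutes {..<n} \<Longrightarrow> pact P n k \<sigma> 0 = 0"
  using act_add[of 0 n k 0 \<sigma>] by (simp add: zero_closed)

lemma act_scale:
  "x \<in> ops P n k \<Longrightarrow> \<sigma> permutes {..<n} \<Longrightarrow> pact P n k \<sigma> (r *\<^sub>R x) = r *\<^sub>R pact P n k \<sigma> x"
  using act_linear[of x n k 0 \<sigma> r] by (simp add: zero_closed act_zero)

lemma act_diff:
  "x \<in> ops P n k \<Longrightarrow> y \<in> ops P n k \<Longrightarrow> \<sigma> permutes {..<n} \<Longrightarrow>
    pact P n k \<sigma> (x - y) = pact P n k \<sigma> x - pact P n k \<sigma> y"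
  using act_add[of "x - y" n k y \<sigma>] by (simp add: diff_closed)

lemma dif_add:
  "x \<in> ops P n k \<Longrightarrow> y \<in> ops P n k \<Longrightarrow> pdif P n k (x + y) = pdif P n k x + pdif P n k y"
  using dif_linear[of x n k y 1] by simp

lemma dif_zero: "pdif P n k 0 = 0"
  using dif_add[of 0 n k 0] by (simp add: zero_closed)

lemma dif_scale: "x \<in> ops P n k \<Longrightarrow> pdif P n k (r *\<^sub>R x) = r *\<^sub>R pdif P n k x"
  using dif_linear[of x n k 0 r] by (simp add: zero_closed dif_zero)

lemma dif_diff:
  "x \<in> ops P n k \<Longrightarrow> y \<in> ops P n k \<Longrightarrow> pdif P n k (x - y) = pdif P n k x - pdif P n k y"
  using dif_add[of "x - y" n k y] by (simp add: diff_closed)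

lemma dif_sum:
  assumes "\<And>a. a \<in> A \<Longrightarrow> f a \<in> ops P n k"
  shows "pdif P n k (\<Sum>a\<in>A. f a) = (\<Sum>a\<in>A. pdif P n k (f a))"
  using assms by (induction A rule: infinite_finite_induct) (simp_all add: dif_zero dif_add sum_closed)

lemma op_eval_closed:
  assumes v: "\<And>g n k. (g, n, k) \<in> G \<Longrightarrow> v g \<in> ops P n k"
  shows "well_formed G s \<Longrightarrow> op_eval P v s \<in> ops P (arity s) (deg s)"
  by (induction s)
    (auto simp: v unit_closed zero_closed add_closed scale_closed comp_closed act_closed dif_closed
      simp del: One_nat_def)

text \<open>The universal property of a presented operad: since \<open>op_eq\<close> is generated by instances of the
  axioms of DG operads, an assignment of the generators that satisfies the relations identifies
  equal expressions.\<close>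

lemma op_eval_sound:
  assumes v: "\<And>g n k. (g, n, k) \<in> G \<Longrightarrow> v g \<in> ops P n k"
    and R: "\<And>s t. (s, t) \<in> R \<Longrightarrow> well_formed G s \<Longrightarrow> well_formed G t \<Longrightarrow> arity s = arity t \<Longrightarrow>
      deg s = deg t \<Longrightarrow> op_eval P v s = op_eval P v t"
  shows "op_eq G R s t \<Longrightarrow> op_eval P v s = op_eval P v t"
proof -
  note closed = op_eval_closed[where v = v and G = G, OF v]
    and seq = comp_sequential and par = comp_parallel and equi = equivariant
    and dd = dif_dif and leibniz = dif_comp
  have closed': "op_eval P v s \<in> ops P n k" if "well_formed G s" "arity s = n" "deg s = k" for s n k
    using closed that by blast
  show "op_eq G R s t \<Longrightarrow> op_eval P v s = op_eval P v t"
  proof (induction rule: op_eq.induct)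
    case (comp_sequential s i t j u)
    then show ?case using seq[OF closed[of s] closed[of t] closed[of u], of i j] by auto
  next
    case (comp_parallel s i t j u)
    then show ?case using par[OF closed[of s] closed[of t] closed[of u], of i j] by auto
  next
    case (equivariant s i t \<sigma> \<tau>)
    then show ?case using equi[OF closed[of s] closed[of t], of i \<sigma> \<tau>] by auto
  next
    case (dif_dif s)
    then show ?case using dd[OF closed[of s]] by (simp add: add.assoc)
  next
    case (dif_comp s i t)
    then show ?case using leibniz[OF closed[of s] closed[of t], of i] by auto
  qed (auto dest!: op_eq_arity_deg simp: R closed' add.assoc add.commute scaleR_add_right
    scaleR_add_left comp_add_left comp_add_right comp_scale_left comp_scale_right act_add act_scale
    dif_add dif_scale unit_left unit_right act_id act_comp dif_act
    simp del: One_nat_def)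
qed

end

section \<open>Images of operads\<close>

lemma block_perm_permutes:
  assumes i: "i < n" and \<sigma>: "\<sigma> permutes {..<n}" and \<tau>: "\<tau> permutes {..<m}"
  shows "block_perm n m i \<sigma> \<tau> permutes {..<n + m - 1}"
proof -
  define b where "b = block_perm n m i \<sigma> \<tau>"
  define out where "out x = (if x < i then x else x + 1 - m)" for x
  have b_in: "b x = \<sigma> i + \<tau> (x - i)" if "i \<le> x" "x < i + m" for x
    using that i by (auto simp: b_def block_perm_def)
  have b_out: "b x = (if \<sigma> (out x) < \<sigma> i then \<sigma> (out x) else \<sigma> (out x) + m - 1)"
    if "x < n + m - 1" "\<not> (i \<le> x \<and> x < i + m)" for x
    using that unfolding b_def block_perm_def out_def Let_def by (auto split: if_splits)
  have \<sigma>_less: "\<sigma> x < n" if "x < n" for x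
    using permutes_in_image[OF \<sigma>, of x] that by simp
  have \<tau>_less: "\<tau> x < m" if "x < m" for x
    using permutes_in_image[OF \<tau>, of x] that by simp
  have out: "out x < n" "\<sigma> (out x) \<noteq> \<sigma> i" if "x < n + m - 1" "\<not> (i \<le> x \<and> x < i + m)" for x
  proof -
    have "out x < n \<and> out x \<noteq> i" using that i by (auto simp: out_def)
    then show "out x < n" "\<sigma> (out x) \<noteq> \<sigma> i"
      using inj_eq[OF permutes_inj[OF \<sigma>]] by auto
  qed
  have image_in: "\<sigma> i \<le> b x \<and> b x < \<sigma> i + m" if "i \<le> x" "x < i + m" for x
    using b_in[OF that] \<tau>_less[of "x - i"] that by auto
  have image_out: "b x < \<sigma> i \<or> \<sigma> i + m \<le> b x" if "x < n + m - 1" "\<not> (i \<le> x \<and> x < i + m)" for x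
    using b_out[OF that] out[OF that] by auto
  have "inj_on b {..<n + m - 1}"
  proof (rule inj_onI)
    fix x y assume x: "x \<in> {..<n + m - 1}" and y: "y \<in> {..<n + m - 1}" and eq: "b x = b y"
    consider (inside) "i \<le> x" "x < i + m" "i \<le> y" "y < i + m"
      | (outside) "\<not> (i \<le> x \<and> x < i + m)" "\<not> (i \<le> y \<and> y < i + m)"
      using image_in[of x] image_in[of y] image_out[of x] image_out[of y] x y eq by fastforce
    then show "x = y"
    proof cases
      case inside
      then have "x - i = y - i"
        using eq b_in[of x] b_in[of y] inj_eq[OF permutes_inj[OF \<tau>]] by auto
      then show ?thesis using inside by simp
    next
      case outside
      have "\<sigma> (out x) = \<sigma> (out y)"
        using eq b_out[of x] b_out[of y] out[of x] out[of y] x y outside by (auto split: if_splits)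
      then have "out x = out y" using inj_eq[OF permutes_inj[OF \<sigma>]] by auto
      then show ?thesis using outside by (auto simp: out_def split: if_splits)
    qed
  qed
  moreover have "b ` {..<n + m - 1} \<subseteq> {..<n + m - 1}"
  proof (rule image_subsetI)
    fix x assume x: "x \<in> {..<n + m - 1}"
    show "b x \<in> {..<n + m - 1}"
    proof (cases "i \<le> x \<and> x < i + m")
      case True
      then show ?thesis using image_in[of x] \<sigma>_less[OF i] by auto
    next
      case False
      then show ?thesis using b_out[of x] out[of x] x \<sigma>_less[OF i] \<sigma>_less[of "out x"] by auto
    qed
  qed
  ultimately have "bij_betw b {..<n + m - 1} {..<n + m - 1}"
    by (simp add: bij_betw_def endo_inj_surj)
  moreover have "b x = x" if "x \<notin> {..<n + m - 1}" for x
    using that by (simp add: b_def block_perm_def)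
  ultimately show ?thesis unfolding b_def by (rule bij_imp_permutes)
qed

context operad_hom
begin

lemma hom_zero: "dg_operad P \<Longrightarrow> f n k 0 = 0"
  using hom_linear[of 0 n k 0 1] by (simp add: dg_operad.zero_closed)

lemma hom_scale: "dg_operad P \<Longrightarrow> x \<in> ops P n k \<Longrightarrow> f n k (r *\<^sub>R x) = r *\<^sub>R f n k x"
  using hom_linear[of x n k 0 r] by (simp add: dg_operad.zero_closed hom_zero)

lemma hom_add: "x \<in> ops P n k \<Longrightarrow> y \<in> ops P n k \<Longrightarrow> f n k (x + y) = f n k x + f n k y"
  using hom_linear[of x n k y 1] by simp

lemma hom_sum:
  assumes "dg_operad P" "\<And>a. a \<in> A \<Longrightarrow> g a \<in> ops P n k"
  shows "f n k (\<Sum>a\<in>A. g a) = (\<Sum>a\<in>A. f n k (g a))"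
  using assms(2) by (induction A rule: infinite_finite_induct)
    (simp_all add: hom_zero hom_add assms(1) dg_operad.sum_closed)

lemma hom_op_eval:
  assumes P: "dg_operad P" and v: "\<And>g n k. (g, n, k) \<in> G \<Longrightarrow> v g \<in> ops P n k"
    and w: "\<And>g n k. (g, n, k) \<in> G \<Longrightarrow> f n k (v g) = w g"
  shows "well_formed G s \<Longrightarrow> f (arity s) (deg s) (op_eval P v s) = op_eval Q w s"
proof -
  have cl: "op_eval P v s \<in> ops P n k" if "well_formed G s" "arity s = n" "deg s = k" for s n k
    using dg_operad.op_eval_closed[OF P, where v = v and G = G and s = s] v that by blast
  show "well_formed G s \<Longrightarrow> f (arity s) (deg s) (op_eval P v s) = op_eval Q w s"
  proof (induction s)
    case OpUnit
    then show ?case by (simp add: hom_unit del: One_nat_def)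
  qed (auto simp: cl w hom_zero[OF P] hom_add hom_scale[OF P] hom_comp hom_act hom_dif simp del: One_nat_def)
qed

definition image_operad :: "'q operad"
  where "image_operad = Q\<lparr>ops := \<lambda>n k. f n k ` ops P n k\<rparr>"

lemma image_operad_sel [simp]:
  "ops image_operad n k = f n k ` ops P n k" "opunit image_operad = opunit Q"
  "pcomp image_operad = pcomp Q" "pact image_operad = pact Q" "pdif image_operad = pdif Q"
  by (simp_all add: image_operad_def)

lemma op_eval_image_operad: "op_eval image_operad v s = op_eval Q v s"
  by (induction s) simp_all

text \<open>The operations of the target are compatible with those of the source on the image, so every axiom of
  DG operads is inherited from the source. This provides a DG operad inside an endomorphism operad without any
  computation with Koszul signs there.\<close>

lemma dg_operad_image:
  assumes P: "dg_operad P"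
  shows "dg_operad image_operad"
proof -
  interpret P: dg_operad P by (rule P)
  note cl = P.unit_closed P.comp_closed P.act_closed P.dif_closed P.scale_closed P.add_closed
    P.zero_closed
  have comp_img: "pcomp Q n k m l i (f n k x) (f m l y) = f (n + m - 1) (k + l) (pcomp P n k m l i x y)"
    if "x \<in> ops P n k" "y \<in> ops P m l" "i < n" for n k m l i x y
    using hom_comp[OF that] by simp
  have act_img: "pact Q n k \<sigma> (f n k x) = f n k (pact P n k \<sigma> x)"
    if "x \<in> ops P n k" "\<sigma> permutes {..<n}" for n k \<sigma> x
    using hom_act[OF that] by simp
  have dif_img: "pdif Q n k (f n k x) = f n (k + 1) (pdif P n k x)" if "x \<in> ops P n k" for n k x
    using hom_dif[OF that] by simp
  have lin: "r *\<^sub>R f n k x + f n k y = f n k (r *\<^sub>R x + y)" if "x \<in> ops P n k" "y \<in> ops P n k" for n k r x y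
    using hom_linear[OF that] by simp
  have scale: "r *\<^sub>R f n k x = f n k (r *\<^sub>R x)" if "x \<in> ops P n k" for n k r x
    using hom_scale[OF P that] by simp
  have add: "f n k x + f n k y = f n k (x + y)" if "x \<in> ops P n k" "y \<in> ops P n k" for n k x y
    using hom_add[OF that] by simp
  note img = comp_img act_img dif_img lin scale add hom_unit[symmetric]
  have ar: "n + m - 1 + q - 1 = n + (m + q - 1) - 1" if "i < n" "j < m" for n m q i j :: nat
    using that by simp
  have ar': "n + m - 1 + q - 1 = n + q - 1 + m - 1" "j + m - 1 < n + m - 1" "i < n + q - 1"
    if "i < j" "j < n" for n m q i j :: nat
    using that by auto
  show ?thesis
  proof (unfold_locales; unfold image_operad_sel)
    fix n k
    show "subspace (f n k ` ops P n k)"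
      by (auto simp: subspace_def add scale cl intro!: image_eqI[of 0 "f n k" 0] simp: hom_zero[OF P])
  next
    show "opunit Q \<in> f 1 0 ` ops P 1 0" by (simp add: img cl del: One_nat_def)
  next
    fix x n k y m l z q e and i j :: nat
    assume *: "x \<in> f n k ` ops P n k" "y \<in> f m l ` ops P m l" "z \<in> f q e ` ops P q e" "i < n" "j < m"
    then obtain x' y' z' where x': "x' \<in> ops P n k" "x = f n k x'" and y': "y' \<in> ops P m l" "y = f m l y'"
      and z': "z' \<in> ops P q e" "z = f q e z'" by auto
    have "i + j < n + m - 1" using * by linarith
    then have "pcomp Q (n + m - 1) (k + l) q e (i + j) (pcomp Q n k m l i x y) z =
       f (n + m - 1 + q - 1) (k + l + e) (pcomp P (n + m - 1) (k + l) q e (i + j) (pcomp P n k m l i x' y') z')"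
      using x' y' z' * by (simp add: img cl del: One_nat_def diff_diff_left)
    also have "\<dots> = f (n + (m + q - 1) - 1) (k + (l + e)) (pcomp P n k (m + q - 1) (l + e) i x' (pcomp P m l q e j y' z'))"
      using x' y' z' * P.comp_sequential[of x' n k y' m l z' q e i j] ar[OF *(4,5)] by (simp add: add.assoc del: One_nat_def diff_diff_left)
    also have "\<dots> = pcomp Q n k (m + q - 1) (l + e) i x (pcomp Q m l q e j y z)"
      using x' y' z' * by (simp add: img cl del: One_nat_def diff_diff_left)
    finally show "pcomp Q (n + m - 1) (k + l) q e (i + j) (pcomp Q n k m l i x y) z =
       pcomp Q n k (m + q - 1) (l + e) i x (pcomp Q m l q e j y z)" .
  next
    fix x n k y m l z q e and i j :: nat
    assume *: "x \<in> f n k ` ops P n k" "y \<in> f m l ` ops P m l" "z \<in> f q e ` ops P q e" "i < j" "j < n"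
    then obtain x' y' z' where x': "x' \<in> ops P n k" "x = f n k x'" and y': "y' \<in> ops P m l" "y = f m l y'"
      and z': "z' \<in> ops P q e" "z = f q e z'" by auto
    have i: "i < n" using * by simp
    have "pcomp Q (n + m - 1) (k + l) q e (j + m - 1) (pcomp Q n k m l i x y) z =
       f (n + m - 1 + q - 1) (k + l + e) (pcomp P (n + m - 1) (k + l) q e (j + m - 1) (pcomp P n k m l i x' y') z')"
      using x' y' z' * ar'[OF *(4,5)] i by (simp add: img cl del: One_nat_def diff_diff_left)
    also have "\<dots> = f (n + q - 1 + m - 1) (k + e + l)
        (parity_sign (l * e) *\<^sub>R pcomp P (n + q - 1) (k + e) m l i (pcomp P n k q e j x' z') y')"
      using P.comp_parallel[OF x'(1) y'(1) z'(1) *(4,5)] ar'(1)[OF *(4,5), of m q]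
      by (simp only: add.assoc add.commute[of l e])
    also have "\<dots> = parity_sign (l * e) *\<^sub>R pcomp Q (n + q - 1) (k + e) m l i (pcomp Q n k q e j x z) y"
    proof -
      have 1: "pcomp P n k q e j x' z' \<in> ops P (n + q - 1) (k + e)"
        using x' z' * by (simp add: cl del: One_nat_def)
      have 2: "i < n + q - 1" by (rule ar'(3)[OF *(4,5)])
      show ?thesis
        unfolding x'(2) y'(2) z'(2) comp_img[OF x'(1) z'(1) *(5)] comp_img[OF 1 y'(1) 2]
        by (rule scale[OF P.comp_closed[OF 1 y'(1) 2], symmetric])
    qed
    finally show "pcomp Q (n + m - 1) (k + l) q e (j + m - 1) (pcomp Q n k m l i x y) z =
       parity_sign (l * e) *\<^sub>R pcomp Q (n + q - 1) (k + e) m l i (pcomp Q n k q e j x z) y" .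
  next
    fix x n k y m l i \<sigma> \<tau>
    assume *: "x \<in> f n k ` ops P n k" "y \<in> f m l ` ops P m l" "i < n"
      "\<sigma> permutes {..<n}" "\<tau> permutes {..<m}"
    then obtain x' y' where x': "x' \<in> ops P n k" "x = f n k x'" and y': "y' \<in> ops P m l" "y = f m l y'"
      by auto
    have \<sigma>i: "\<sigma> i < n" using * permutes_in_image[of \<sigma> "{..<n}" i] by simp
    have block: "block_perm n m i \<sigma> \<tau> permutes {..<n + m - 1}"
      using *(3-5) by (rule block_perm_permutes)
    show "pcomp Q n k m l (\<sigma> i) (pact Q n k \<sigma> x) (pact Q m l \<tau> y) =
       pact Q (n + m - 1) (k + l) (block_perm n m i \<sigma> \<tau>) (pcomp Q n k m l i x y)"
      using x' y' * \<sigma>i block P.equivariant[of x' n k y' m l i \<sigma> \<tau>] by (simp add: img cl del: One_nat_def diff_diff_left)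
  next
    fix x n k y m l and i :: nat
    assume *: "x \<in> f n k ` ops P n k" "y \<in> f m l ` ops P m l" "i < n"
    then obtain x' y' where x': "x' \<in> ops P n k" "x = f n k x'" and y': "y' \<in> ops P m l" "y = f m l y'"
      by auto
    have c1: "pcomp P n (k + 1) m l i (pdif P n k x') y' \<in> ops P (n + m - 1) (k + l + 1)"
      and c2: "pcomp P n k m (l + 1) i x' (pdif P m l y') \<in> ops P (n + m - 1) (k + l + 1)"
      using P.comp_closed[OF P.dif_closed[OF x'(1)] y'(1) *(3)] P.comp_closed[OF x'(1) P.dif_closed[OF y'(1)] *(3)]
      by (simp_all add: ac_simps)
    have "f (n + m - 1) (k + l + 1) (pdif P (n + m - 1) (k + l) (pcomp P n k m l i x' y')) =
        f (n + m - 1) (k + 1 + l) (pcomp P n (k + 1) m l i (pdif P n k x') y') + parity_sign k *\<^sub>R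
        f (n + m - 1) (k + (l + 1)) (pcomp P n k m (l + 1) i x' (pdif P m l y'))"
      using P.dif_comp[of x' n k y' m l i] x' y' * c1 c2
      by (simp add: add scale cl add.assoc add.commute[of l] add.left_commute[of l] del: One_nat_def)
    then show "pdif Q (n + m - 1) (k + l) (pcomp Q n k m l i x y) =
       pcomp Q n (k + 1) m l i (pdif Q n k x) y + parity_sign k *\<^sub>R pcomp Q n k m (l + 1) i x (pdif Q m l y)"
      using x' y' * by (simp add: comp_img dif_img cl del: One_nat_def)
  next
    fix x n k assume "x \<in> f n k ` ops P n k"
    then obtain x' where x': "x' \<in> ops P n k" "x = f n k x'" by auto
    show "pcomp Q 1 0 n k 0 (opunit Q) x = x"
      using x' P.unit_left[of x' n k] comp_img[of "opunit P" 1 0 x' n k 0] by (simp add: cl hom_unit[symmetric] del: One_nat_def)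
    show "pdif Q n (k + 1) (pdif Q n k x) = 0"
      using x' P.dif_dif[of x' n k] by (simp add: img cl hom_zero[OF P])
    show "pact Q n k id x = x" using x' by (simp add: img permutes_id P.act_id)
    show "pdif Q n k x \<in> f n (k + 1) ` ops P n (k + 1)" using x' by (simp add: img cl del: One_nat_def diff_diff_left)
  next
    fix x n k and i :: nat assume "x \<in> f n k ` ops P n k" and i: "i < n"
    then obtain x' where x': "x' \<in> ops P n k" "x = f n k x'" by auto
    show "pcomp Q n k 1 0 i x (opunit Q) = x"
      using x' i P.unit_right[of x' n k i] comp_img[of x' n k "opunit P" 1 0 i] by (simp add: cl hom_unit[symmetric] del: One_nat_def)
  qed (auto simp: img cl P.comp_linear_left P.comp_linear_right P.act_linear P.dif_linear P.act_comp
      P.dif_act permutes_compose simp del: One_nat_def o_apply)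
qed

lemma hom_image_operad: "operad_hom P image_operad f"
  using operad_hom_axioms by (simp add: operad_hom_def)

end

section \<open>The infinitesimal path operad\<close>

lemma parity_sign_simps:
  "parity_sign 0 = 1" "parity_sign 1 = -1"
  "parity_sign (a + b) = parity_sign a * parity_sign b"
  "parity_sign (a - b) = parity_sign a * parity_sign b"
  "parity_sign (a + 1) = - parity_sign a" "parity_sign (a - 1) = - parity_sign a"
  "parity_sign a * parity_sign a = 1" "parity_sign a * (parity_sign a * r) = r"
  "parity_sign (- a) = parity_sign a"
  "parity_sign ((a - 1) * b) = parity_sign (a * b) * parity_sign b"
  "parity_sign (b * (a - 1)) = parity_sign (b * a) * parity_sign b"
  by (auto simp: parity_sign_def)

text \<open>The tensor product of \<open>P\<close> with the commutative DG algebra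
  $\mathbb{R}\oplus\mathbb{R}\delta\oplus\mathbb{R}\varepsilon$, where $\delta$ has degree $0$, $\varepsilon$ has degree
  $1$, $d\delta=\varepsilon$, and the products of $\delta$ and $\varepsilon$ vanish; \<open>(x, y, z)\<close> is
  $x+\delta y+\varepsilon z$. This is an infinitesimal path object: a morphism into it over a given morphism $x$ to
  \<open>P\<close> consists of a derivation $y$ along $x$ and a homotopy $z$ from $y$ to zero that is itself a derivation
  along $x$.\<close>

definition path_operad :: "'p::real_vector operad \<Rightarrow> ('p \<times> 'p \<times> 'p) operad" where
  "path_operad P = \<lparr>
     ops = (\<lambda>n k. ops P n k \<times> ops P n k \<times> ops P n (k - 1)),
     opunit = (opunit P, 0, 0),
     pcomp = (\<lambda>n k m l i (x, y, z) (x', y', z').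
       (pcomp P n k m l i x x', pcomp P n k m l i x y' + pcomp P n k m l i y x',
        pcomp P n (k - 1) m l i z x' + parity_sign k *\<^sub>R pcomp P n k m (l - 1) i x z')),
     pact = (\<lambda>n k \<sigma> (x, y, z). (pact P n k \<sigma> x, pact P n k \<sigma> y, pact P n (k - 1) \<sigma> z)),
     pdif = (\<lambda>n k (x, y, z). (pdif P n k x, pdif P n k y, y - pdif P n (k - 1) z)) \<rparr>"

lemma path_operad_sel [simp]:
  "ops (path_operad P) n k = ops P n k \<times> ops P n k \<times> ops P n (k - 1)"
  "opunit (path_operad P) = (opunit P, 0, 0)"
  "pcomp (path_operad P) n k m l i (x, y, z) (x', y', z') =
     (pcomp P n k m l i x x', pcomp P n k m l i x y' + pcomp P n k m l i y x',
      pcomp P n (k - 1) m l i z x' + parity_sign k *\<^sub>R pcomp P n k m (l - 1) i x z')"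
  "pact (path_operad P) n k \<sigma> (x, y, z) =
     (pact P n k \<sigma> x, pact P n k \<sigma> y, pact P n (k - 1) \<sigma> z)"
  "pdif (path_operad P) n k (x, y, z) = (pdif P n k x, pdif P n k y, y - pdif P n (k - 1) z)"
  by (simp_all add: path_operad_def)

context dg_operad
begin

lemma comp_closed_left_pred:
  "z \<in> ops P n (k - 1) \<Longrightarrow> x \<in> ops P m l \<Longrightarrow> i < n \<Longrightarrow>
    pcomp P n (k - 1) m l i z x \<in> ops P (n + m - 1) (k + l - 1)"
  using comp_closed[of z n "k - 1" x m l i] by (simp add: diff_add_eq)

lemma comp_closed_right_pred:
  "x \<in> ops P n k \<Longrightarrow> z \<in> ops P m (l - 1) \<Longrightarrow> i < n \<Longrightarrow>
    pcomp P n k m (l - 1) i x z \<in> ops P (n + m - 1) (k + l - 1)"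
  using comp_closed[of x n k z m "l - 1" i] by (simp add: add_diff_eq)

lemma dif_closed_pred: "z \<in> ops P n (k - 1) \<Longrightarrow> pdif P n (k - 1) z \<in> ops P n k"
  using dif_closed[of z n "k - 1"] by simp

lemma dg_operad_path: "dg_operad (path_operad P)"
proof
  note cl = zero_closed add_closed scale_closed diff_closed unit_closed comp_closed act_closed
    dif_closed comp_closed_left_pred comp_closed_right_pred dif_closed_pred
  note degs = diff_add_eq[where 'a = int] add_diff_eq[where 'a = int]
  fix n k
  show "subspace (ops (path_operad P) n k)"
    by (auto simp: subspace_def zero_prod_def cl)
  show "opunit (path_operad P) \<in> ops (path_operad P) 1 0"
    by (simp add: cl del: One_nat_def)
  {
    fix x assume x: "x \<in> ops (path_operad P) n k"
    obtain x1 x2 x3 where [simp]: "x = (x1, x2, x3)" by (cases x)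
    note [simp] = x[simplified]
    show "pcomp (path_operad P) 1 0 n k 0 (opunit (path_operad P)) x = x"
      by (simp add: unit_left comp_zero_left parity_sign_simps del: One_nat_def)
    show "pdif (path_operad P) n (k + 1) (pdif (path_operad P) n k x) = 0"
      using dif_dif[of x3 n "k - 1"]
      by (simp add: dif_dif dif_diff cl zero_prod_def)
    show "pact (path_operad P) n k id x = x"
      by (simp add: act_id)
    show "pdif (path_operad P) n k x \<in> ops (path_operad P) n (k + 1)"
      by (simp add: cl)
    fix i assume "i < n"
    then show "pcomp (path_operad P) n k 1 0 i x (opunit (path_operad P)) = x"
      by (simp add: unit_right comp_zero_right del: One_nat_def)
  }
  {
    fix x \<sigma> assume x: "x \<in> ops (path_operad P) n k" and \<sigma>: "\<sigma> permutes {..<n}"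
    obtain x1 x2 x3 where [simp]: "x = (x1, x2, x3)" by (cases x)
    note [simp] = x[simplified] \<sigma>
    show "pact (path_operad P) n k \<sigma> x \<in> ops (path_operad P) n k"
      by (simp add: cl)
    show "pdif (path_operad P) n k (pact (path_operad P) n k \<sigma> x) =
        pact (path_operad P) n (k + 1) \<sigma> (pdif (path_operad P) n k x)"
      using dif_act[of x3 n "k - 1" \<sigma>] by (simp add: dif_act act_diff cl)
    fix \<tau> assume "\<tau> permutes {..<n}"
    then show "pact (path_operad P) n k (\<sigma> \<circ> \<tau>) x =
        pact (path_operad P) n k \<sigma> (pact (path_operad P) n k \<tau> x)"
      by (simp add: act_comp)
  }
  {
    fix x y r \<sigma> assume x: "x \<in> ops (path_operad P) n k" and y: "y \<in> ops (path_operad P) n k"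
    obtain x1 x2 x3 where [simp]: "x = (x1, x2, x3)" by (cases x)
    obtain y1 y2 y3 where [simp]: "y = (y1, y2, y3)" by (cases y)
    note [simp] = x[simplified] y[simplified]
    show "pdif (path_operad P) n k (r *\<^sub>R x + y) =
        r *\<^sub>R pdif (path_operad P) n k x + pdif (path_operad P) n k y"
      by (simp add: dif_add dif_scale cl scaleR_diff_right)
    assume "\<sigma> permutes {..<n}"
    then show "pact (path_operad P) n k \<sigma> (r *\<^sub>R x + y) =
        r *\<^sub>R pact (path_operad P) n k \<sigma> x + pact (path_operad P) n k \<sigma> y"
      by (simp add: act_linear)
  }
  {
    fix x y m l i
    assume x: "x \<in> ops (path_operad P) n k" and y: "y \<in> ops (path_operad P) m l" and i: "i < n"
    obtain x1 x2 x3 where [simp]: "x = (x1, x2, x3)" by (cases x)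
    obtain y1 y2 y3 where [simp]: "y = (y1, y2, y3)" by (cases y)
    note [simp] = x[simplified] y[simplified] i
    show "pcomp (path_operad P) n k m l i x y \<in> ops (path_operad P) (n + m - 1) (k + l)"
      by (simp add: cl del: One_nat_def)
    show "pdif (path_operad P) (n + m - 1) (k + l) (pcomp (path_operad P) n k m l i x y) =
        pcomp (path_operad P) n (k + 1) m l i (pdif (path_operad P) n k x) y +
        parity_sign k *\<^sub>R pcomp (path_operad P) n k m (l + 1) i x (pdif (path_operad P) m l y)"
      using dif_comp[of x3 n "k - 1" y1 m l i] dif_comp[of x1 n k y3 m "l - 1" i]
      by (simp add: dif_comp dif_add dif_diff dif_scale cl comp_diff_left comp_diff_right degs
          parity_sign_simps scaleR_add_right scaleR_diff_right del: One_nat_def)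
    fix r
    {
      fix x' assume x': "x' \<in> ops (path_operad P) n k"
      obtain x1' x2' x3' where [simp]: "x' = (x1', x2', x3')" by (cases x')
      note [simp] = x'[simplified]
      show "pcomp (path_operad P) n k m l i (r *\<^sub>R x + x') y =
          r *\<^sub>R pcomp (path_operad P) n k m l i x y + pcomp (path_operad P) n k m l i x' y"
        by (simp add: comp_add_left comp_scale_left cl scaleR_add_right scaleR_left_commute)
    }
    {
      fix y' assume y': "y' \<in> ops (path_operad P) m l"
      obtain y1' y2' y3' where [simp]: "y' = (y1', y2', y3')" by (cases y')
      note [simp] = y'[simplified]
      show "pcomp (path_operad P) n k m l i x (r *\<^sub>R y + y') =
          r *\<^sub>R pcomp (path_operad P) n k m l i x y + pcomp (path_operad P) n k m l i x y'"
        by (simp add: comp_add_right comp_scale_right cl scaleR_add_right scaleR_left_commute)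
    }
    fix \<sigma> \<tau> assume \<sigma>: "\<sigma> permutes {..<n}" and \<tau>: "\<tau> permutes {..<m}"
    note bp = block_perm_permutes[OF i \<sigma> \<tau>]
    note [simp] = \<sigma> \<tau> bp
    show "pcomp (path_operad P) n k m l (\<sigma> i) (pact (path_operad P) n k \<sigma> x) (pact (path_operad P) m l \<tau> y) =
        pact (path_operad P) (n + m - 1) (k + l) (block_perm n m i \<sigma> \<tau>) (pcomp (path_operad P) n k m l i x y)"
      using equivariant[of x3 n "k - 1" y1 m l i \<sigma> \<tau>] equivariant[of x1 n k y3 m "l - 1" i \<sigma> \<tau>]
      by (simp add: equivariant act_add act_scale cl degs del: One_nat_def)
  }
  {
    fix x y z m l q e and i j :: nat
    assume x: "x \<in> ops (path_operad P) n k" and y: "y \<in> ops (path_operad P) m l"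
      and z: "z \<in> ops (path_operad P) q e"
    obtain x1 x2 x3 where [simp]: "x = (x1, x2, x3)" by (cases x)
    obtain y1 y2 y3 where [simp]: "y = (y1, y2, y3)" by (cases y)
    obtain z1 z2 z3 where [simp]: "z = (z1, z2, z3)" by (cases z)
    note [simp] = x[simplified] y[simplified] z[simplified]
    {
      assume ij [simp]: "i < n" "j < m"
      have [simp]: "i + j < n + m - 1" using ij by linarith
      show "pcomp (path_operad P) (n + m - 1) (k + l) q e (i + j) (pcomp (path_operad P) n k m l i x y) z =
          pcomp (path_operad P) n k (m + q - 1) (l + e) i x (pcomp (path_operad P) m l q e j y z)"
        using comp_sequential[of x3 n "k - 1" y1 m l z1 q e i j]
          comp_sequential[of x1 n k y3 m "l - 1" z1 q e i j]
          comp_sequential[of x1 n k y1 m l z3 q "e - 1" i j]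
        by (simp add: comp_sequential comp_add_left comp_add_right comp_scale_left comp_scale_right cl
            degs parity_sign_simps scaleR_add_right add.assoc del: One_nat_def)
    next
      assume ij [simp]: "i < j" "j < n"
      have [simp]: "i < n" "j + m - 1 < n + m - 1" "i < n + q - 1" using ij by linarith+
      show "pcomp (path_operad P) (n + m - 1) (k + l) q e (j + m - 1) (pcomp (path_operad P) n k m l i x y) z =
          parity_sign (l * e) *\<^sub>R
            pcomp (path_operad P) (n + q - 1) (k + e) m l i (pcomp (path_operad P) n k q e j x z) y"
        using comp_parallel[of x3 n "k - 1" y1 m l z1 q e i j]
          comp_parallel[of x1 n k y3 m "l - 1" z1 q e i j]
          comp_parallel[of x1 n k y1 m l z3 q "e - 1" i j]
        by (simp add: comp_parallel comp_add_left comp_add_right comp_scale_left comp_scale_right cl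
            degs parity_sign_simps scaleR_add_right del: One_nat_def,
            simp add: ac_simps parity_sign_simps(8))
    }
  }
qed

end

section \<open>Weights\<close>

text \<open>A relation rather than a function, because zero has every weight and sums may have none.\<close>

primrec homogeneous :: "('g \<Rightarrow> nat) \<Rightarrow> 'g opexpr \<Rightarrow> nat \<Rightarrow> bool" where
  "homogeneous wt (Gen g n k) w \<longleftrightarrow> w = wt g"
| "homogeneous wt OpUnit w \<longleftrightarrow> w = 0"
| "homogeneous wt (Zero n k) w \<longleftrightarrow> True"
| "homogeneous wt (Add s t) w \<longleftrightarrow> homogeneous wt s w \<and> homogeneous wt t w"
| "homogeneous wt (Scale r s) w \<longleftrightarrow> homogeneous wt s w"
| "homogeneous wt (Comp s i t) w \<longleftrightarrow> (\<exists>u v. w = u + v \<and> homogeneous wt s u \<and> homogeneous wt t v)"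
| "homogeneous wt (Act \<sigma> s) w \<longleftrightarrow> homogeneous wt s w"
| "homogeneous wt (Dif s) w \<longleftrightarrow> homogeneous wt s w"

lemma expr_sum_Cons: "expr_sum n k (s # ss) = Add s (expr_sum n k ss)"
  and expr_sum_Nil: "expr_sum n k [] = Zero n k"
  by (simp_all add: expr_sum_def)

lemma op_eval_expr_sum: "op_eval P v (expr_sum n k ss) = sum_list (map (op_eval P v) ss)"
  by (induction ss) (simp_all add: expr_sum_Cons expr_sum_Nil)

lemma expr_sum_well_formed:
  assumes "\<And>s. s \<in> set ss \<Longrightarrow> well_formed G s \<and> arity s = n \<and> deg s = k"
  shows "well_formed G (expr_sum n k ss) \<and> arity (expr_sum n k ss) = n \<and> deg (expr_sum n k ss) = k"
  using assms by (induction ss) (simp_all add: expr_sum_Cons expr_sum_Nil)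

lemma homogeneous_expr_sum:
  "homogeneous wt (expr_sum n k ss) w \<longleftrightarrow> (\<forall>s\<in>set ss. homogeneous wt s w)"
  by (induction ss) (simp_all add: expr_sum_Cons expr_sum_Nil)

context dg_operad
begin

lemma comp_sum_left:
  assumes "\<And>a. a \<in> A \<Longrightarrow> f a \<in> ops P n k" "y \<in> ops P m l" "i < n"
  shows "pcomp P n k m l i (\<Sum>a\<in>A. f a) y = (\<Sum>a\<in>A. pcomp P n k m l i (f a) y)"
  using assms by (induction A rule: infinite_finite_induct)
    (simp_all add: comp_zero_left comp_add_left sum_closed)

lemma comp_sum_right:
  assumes "\<And>a. a \<in> A \<Longrightarrow> f a \<in> ops P m l" "x \<in> ops P n k" "i < n"
  shows "pcomp P n k m l i x (\<Sum>a\<in>A. f a) = (\<Sum>a\<in>A. pcomp P n k m l i x (f a))"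
  using assms by (induction A rule: infinite_finite_induct)
    (simp_all add: comp_zero_right comp_add_right sum_closed)

lemma act_sum:
  assumes "\<And>a. a \<in> A \<Longrightarrow> f a \<in> ops P n k" "\<sigma> permutes {..<n}"
  shows "pact P n k \<sigma> (\<Sum>a\<in>A. f a) = (\<Sum>a\<in>A. pact P n k \<sigma> (f a))"
  using assms by (induction A rule: infinite_finite_induct)
    (simp_all add: act_zero act_add sum_closed)

lemma op_eval_rescale:
  assumes v: "\<And>g n k. (g, n, k) \<in> G \<Longrightarrow> v g \<in> ops P n k"
  shows "well_formed G s \<Longrightarrow> homogeneous wt s w \<Longrightarrow>
    op_eval P (\<lambda>g. r ^ wt g *\<^sub>R v g) s = r ^ w *\<^sub>R op_eval P v s"
proof (induction s arbitrary: w)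
  note closed = op_eval_closed[where v = v and G = G, OF v]
  {
    case (Comp s i t)
    from Comp.prems obtain a b where w: "w = a + b" "homogeneous wt s a" "homogeneous wt t b"
      by auto
    show ?case
      using Comp.prems w Comp.IH(1)[of a] Comp.IH(2)[of b] closed[of s] closed[of t]
      by (simp add: comp_scale_left comp_scale_right scale_closed power_add mult.commute)
  }
qed (use op_eval_closed[where v = v and G = G, OF v] in
    \<open>auto simp: scaleR_add_right scaleR_left_commute act_scale dif_scale\<close>)

lemma dif_op_eval_zero:
  assumes v: "\<And>g n k. (g, n, k) \<in> G \<Longrightarrow> v g \<in> ops P n k"
    and cocycle: "\<And>g n k. (g, n, k) \<in> G \<Longrightarrow> pdif P n k (v g) = 0"
  shows "well_formed G s \<Longrightarrow> pdif P (arity s) (deg s) (op_eval P v s) = 0"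
proof (induction s)
  case OpUnit
  have "pdif P 1 0 (pcomp P 1 0 1 0 0 (opunit P) (opunit P)) =
      pdif P 1 0 (opunit P) + pdif P 1 0 (opunit P)"
    using dif_comp[OF unit_closed unit_closed, of 0] unit_left[of "pdif P 1 0 (opunit P)" 1 1]
      unit_right[of "pdif P 1 0 (opunit P)" 1 1 0] dif_closed[OF unit_closed]
    by (simp add: parity_sign_simps)
  then show ?case using unit_left[OF unit_closed] by (simp del: One_nat_def)
next
  case (Comp s i t)
  note closed = op_eval_closed[where v = v and G = G, OF v]
  show ?case
    using Comp closed[of s] closed[of t] dif_comp[of "op_eval P v s" "arity s" "deg s" "op_eval P v t" "arity t" "deg t" i]
    by (auto simp: comp_zero_left comp_zero_right)
next
  case (Add s t)
  then show ?case
    using op_eval_closed[where v = v and G = G, OF v, of s] op_eval_closed[where v = v and G = G, OF v, of t]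
    by (auto simp: dif_add)
next
  case (Dif s)
  then show ?case using op_eval_closed[where v = v and G = G, OF v, of s] by (auto simp: dif_dif dif_zero)
qed (use op_eval_closed[where v = v and G = G, OF v] cocycle in
    \<open>auto simp: act_zero dif_zero dif_scale dif_act\<close>)

text \<open>Composition and permutations do not lead out of degree $0$, and the differential vanishes on everything
  generated by cocycles.\<close>

lemma op_eval_zero_of_degree:
  assumes v: "\<And>g n k. (g, n, k) \<in> G \<Longrightarrow> v g \<in> ops P n k"
    and cocycle: "\<And>g n k. (g, n, k) \<in> G \<Longrightarrow> k = 0 \<and> pdif P n k (v g) = 0"
  shows "well_formed G s \<Longrightarrow> deg s \<noteq> 0 \<Longrightarrow> op_eval P v s = 0"
proof (induction s)
  case (Comp s i t)
  note closed = op_eval_closed[where v = v and G = G, OF v]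
  have "deg s \<noteq> 0 \<or> deg t \<noteq> 0" using Comp.prems by auto
  then have "op_eval P v s = 0 \<or> op_eval P v t = 0" using Comp.IH Comp.prems by (cases "deg t = 0") auto
  then show ?case
    using Comp.prems closed[of s] closed[of t] by (auto simp: comp_zero_left comp_zero_right)
next
  case (Dif s)
  then show ?case using dif_op_eval_zero[where v = v and G = G, OF v, of s] cocycle by simp
qed (use cocycle in \<open>auto simp: act_zero\<close>)

end

lemma well_formed_weight_zero:
  "well_formed G s \<Longrightarrow> homogeneous wt s 0 \<Longrightarrow> well_formed {(g, n, k) \<in> G. wt g = 0} s"
  by (induction s) auto

lemma polynomial_zero_imp_coeffs_zero:
  fixes e :: "nat \<Rightarrow> 'a::real_vector"
  assumes "\<And>r. (\<Sum>w<W. r ^ w *\<^sub>R e w) = 0" "w < W"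
  shows "e w = 0"
  using assms
proof (induction W arbitrary: e w)
  case (Suc W)
  \<comment> \<open>Comparing the values at \<open>2 * r\<close> and \<open>r\<close> removes the leading term.\<close>
  have "(\<Sum>w<W. r ^ w *\<^sub>R ((2 ^ w - 2 ^ W) *\<^sub>R e w)) = 0" for r
  proof -
    have "(\<Sum>w<Suc W. r ^ w *\<^sub>R ((2 ^ w - 2 ^ W) *\<^sub>R e w)) =
        (\<Sum>w<Suc W. (2 * r) ^ w *\<^sub>R e w) - 2 ^ W *\<^sub>R (\<Sum>w<Suc W. r ^ w *\<^sub>R e w)"
      by (simp add: scaleR_sum_right sum_subtractf [symmetric] algebra_simps power_mult_distrib
          del: sum.lessThan_Suc)
    then show ?thesis using Suc.prems(1)[of r] Suc.prems(1)[of "2 * r"] by simp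
  qed
  then have "(2 ^ w - 2 ^ W) *\<^sub>R e w = 0" if "w < W" for w
    using Suc.IH[of "\<lambda>w. (2 ^ w - 2 ^ W) *\<^sub>R e w" w] that by blast
  then have small: "e w = 0" if "w < W" for w
    using that power_inject_exp[of "2::real" w W] by fastforce
  then have "e W = 0" using Suc.prems(1)[of 1] by simp
  then show ?case using small Suc.prems(2) by (cases "w = W") auto
qed simp

text \<open>The values of the expressions of weight \<open>w\<close> form a subspace, and composition adds weights; hence the
  sums of such values are closed under all operations.\<close>

lemma homogeneous_decomposition:
  assumes P: "dg_operad P" and v: "\<And>g n k. (g, n, k) \<in> G \<Longrightarrow> v g \<in> ops P n k" and s: "well_formed G s"
  obtains W and t :: "nat \<Rightarrow> 'g opexpr"
  where "\<And>w. well_formed G (t w) \<and> homogeneous wt (t w) w \<and> arity (t w) = arity s \<and> deg (t w) = deg s"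
    "op_eval P v s = (\<Sum>w<W. op_eval P v (t w))"
proof -
  interpret dg_operad P by (rule P)
  define part where "part w n k = {op_eval P v t |t. well_formed G t \<and> homogeneous wt t w \<and> arity t = n \<and> deg t = k}"
    for w n k
  define T where "T n k = {\<Sum>w<W. e w |W e. \<forall>w::nat. e w \<in> part w n k}" for n k
  have partI: "op_eval P v t \<in> part w n k"
    if "well_formed G t" "homogeneous wt t w" "arity t = n" "deg t = k" for t w n k
    using that by (auto simp: part_def)
  have part_zero: "0 \<in> part w n k" for w n k
    using partI[of "Zero n k" w n k] by simp
  have part_ops: "x \<in> ops P n k" if "x \<in> part w n k" for x w n k
    using that op_eval_closed[where v = v and G = G, OF v] by (auto simp: part_def)
  have part_add: "x + y \<in> part w n k" if x: "x \<in> part w n k" and y: "y \<in> part w n k" for x y w n k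
  proof -
    obtain s t where "well_formed G s" "homogeneous wt s w" "arity s = n" "deg s = k" "x = op_eval P v s"
      "well_formed G t" "homogeneous wt t w" "arity t = n" "deg t = k" "y = op_eval P v t"
      using x y by (auto simp: part_def)
    then show ?thesis using partI[of "Add s t" w n k] by simp
  qed
  have part_scale: "r *\<^sub>R x \<in> part w n k" if "x \<in> part w n k" for r x w n k
    using that partI[of "Scale r _" w n k] by (fastforce simp: part_def)
  have part_comp: "pcomp P n k m l i x y \<in> part (a + b) (n + m - 1) (k + l)"
    if x: "x \<in> part a n k" and y: "y \<in> part b m l" and i: "i < n" for n k m l i x y a b
  proof -
    obtain s t where "well_formed G s" "homogeneous wt s a" "arity s = n" "deg s = k" "x = op_eval P v s"
      "well_formed G t" "homogeneous wt t b" "arity t = m" "deg t = l" "y = op_eval P v t"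
      using x y by (auto simp: part_def)
    then show ?thesis using partI[of "Comp s i t" "a + b" "n + m - 1" "k + l"] i by auto
  qed
  have part_act: "pact P n k \<sigma> x \<in> part w n k" if "x \<in> part w n k" "\<sigma> permutes {..<n}" for n k x w \<sigma>
    using that partI[of "Act \<sigma> _" w n k] by (fastforce simp: part_def)
  have part_dif: "pdif P n k x \<in> part w n (k + 1)" if "x \<in> part w n k" for n k x w
    using that partI[of "Dif _" w n "k + 1"] by (fastforce simp: part_def)
  have TE: "\<exists>W e. x = (\<Sum>w<W. e w) \<and> (\<forall>w. e w \<in> part w n k)" if "x \<in> T n k" for x n k
    using that by (simp add: T_def)
  have TI: "(\<Sum>w<W. e w) \<in> T n k" if "\<And>w. e w \<in> part w n k" for W e n k
    using that by (auto simp: T_def)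
  have T_part: "x \<in> T n k" if "x \<in> part w n k" for x w n k
  proof -
    have "(\<Sum>u<Suc w. if u = w then x else 0) \<in> T n k"
      by (rule TI) (use that part_zero in auto)
    then show ?thesis by simp
  qed
  have T_add: "x + y \<in> T n k" if xy: "x \<in> T n k" "y \<in> T n k" for x y n k
  proof -
    obtain W e where x: "x = (\<Sum>w<W. e w)" "\<And>w. e w \<in> part w n k"
      using TE[OF xy(1)] by blast
    obtain W' e' where y: "y = (\<Sum>w<W'. e' w)" "\<And>w. e' w \<in> part w n k"
      using TE[OF xy(2)] by blast
    have "x = (\<Sum>w<max W W'. if w < W then e w else 0)" "y = (\<Sum>w<max W W'. if w < W' then e' w else 0)"
      unfolding x y by (rule sum.mono_neutral_cong_left; auto)+
    then have "x + y = (\<Sum>w<max W W'. (if w < W then e w else 0) + (if w < W' then e' w else 0))"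
      by (simp add: sum.distrib)
    also have "\<dots> \<in> T n k" by (rule TI) (use x y part_zero part_add in auto)
    finally show ?thesis .
  qed
  have T_sum: "(\<Sum>a\<in>A. f a) \<in> T n k" if "\<And>a. a \<in> A \<Longrightarrow> f a \<in> T n k" for A :: "nat set" and f n k
    using that by (induction A rule: infinite_finite_induct) (auto intro: T_add T_part[OF part_zero])
  have "op_eval P v s \<in> T (arity s) (deg s)"
    using s
  proof (induction s)
    case (Comp s i t)
    then have "op_eval P v s \<in> T (arity s) (deg s)" "op_eval P v t \<in> T (arity t) (deg t)" by auto
    then obtain W e W' e' where x: "op_eval P v s = (\<Sum>w<W. e w)" "\<And>w. e w \<in> part w (arity s) (deg s)"
      and y: "op_eval P v t = (\<Sum>w<W'. e' w)" "\<And>w. e' w \<in> part w (arity t) (deg t)"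
      by (metis TE)
    show ?case
      using Comp.prems x y part_ops[OF x(2)] part_ops[OF y(2)]
      by (auto simp: comp_sum_left comp_sum_right sum_closed simp del: One_nat_def intro!: T_sum
          intro: T_part[OF part_comp])
  next
    case (Scale r s)
    then obtain W e where x: "op_eval P v s = (\<Sum>w<W. e w)" "\<And>w. e w \<in> part w (arity s) (deg s)"
      using TE[of "op_eval P v s"] by (metis well_formed.simps(5))
    then show ?case by (auto simp: scaleR_sum_right intro!: TI part_scale)
  next
    case (Act \<sigma> s)
    then obtain W e where x: "op_eval P v s = (\<Sum>w<W. e w)" "\<And>w. e w \<in> part w (arity s) (deg s)"
      using TE[of "op_eval P v s"] by (metis well_formed.simps(7,8))
    then show ?case using Act.prems part_ops[OF x(2)] by (auto simp: act_sum intro!: TI part_act)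
  next
    case (Dif s)
    then obtain W e where x: "op_eval P v s = (\<Sum>w<W. e w)" "\<And>w. e w \<in> part w (arity s) (deg s)"
      using TE[of "op_eval P v s"] by (metis well_formed.simps(7,8))
    then show ?case using part_ops[OF x(2)] by (auto simp: dif_sum intro!: TI part_dif)
  next
    case (Gen g n k)
    then show ?case using T_part[OF partI[of "Gen g n k" "wt g"]] by simp
  next
    case OpUnit
    then show ?case using T_part[OF partI[of "OpUnit" 0]] by simp
  qed (auto simp: T_add T_part[OF part_zero])
  then obtain W e where e: "op_eval P v s = (\<Sum>w<W. e w)" "\<And>w. e w \<in> part w (arity s) (deg s)"
    by (metis TE)
  have "\<forall>w. \<exists>t. well_formed G t \<and> homogeneous wt t w \<and> arity t = arity s \<and> deg t = deg s \<and> e w = op_eval P v t"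
    using e(2) by (fastforce simp: part_def)
  then obtain t where "\<And>w. well_formed G (t w) \<and> homogeneous wt (t w) w \<and> arity (t w) = arity s \<and>
      deg (t w) = deg s \<and> e w = op_eval P v (t w)"
    by metis
  with e(1) that[of t W] show ?thesis by auto
qed

section \<open>Cocycles of positive weight act by exact operations\<close>

lemma fst_op_eval_path: "fst (op_eval (path_operad P) v s) = op_eval P (\<lambda>g. fst (v g)) s"
proof (induction s)
  case (Comp s i t)
  then show ?case by (cases "op_eval (path_operad P) v s"; cases "op_eval (path_operad P) v t") auto
next
  case (Act \<sigma> s)
  then show ?case by (cases "op_eval (path_operad P) v s") auto
next
  case (Dif s)
  then show ?case by (cases "op_eval (path_operad P) v s") auto
qed auto

text \<open>The homotopy encoded by \<open>v\<close>, as a function on expressions.\<close>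

definition path_part :: "'p::real_vector operad \<Rightarrow> ('g \<Rightarrow> 'p \<times> 'p \<times> 'p) \<Rightarrow> 'g opexpr \<Rightarrow> 'p"
  where "path_part P v s = snd (snd (op_eval (path_operad P) v s))"

text \<open>The second component is a derivation of the first one. If it multiplies the generators by their
  weights, then it multiplies every homogeneous operation by its weight.\<close>

lemma op_eval_path:
  assumes P: "dg_operad P"
    and v: "\<And>g n k. (g, n, k) \<in> G \<Longrightarrow> v g \<in> ops (path_operad P) n k"
    and wt: "\<And>g n k. (g, n, k) \<in> G \<Longrightarrow> fst (snd (v g)) = real (wt g) *\<^sub>R fst (v g)"
    and s: "well_formed G s" "homogeneous wt s w"
  shows "op_eval (path_operad P) v s =
    (op_eval P (\<lambda>g. fst (v g)) s, real w *\<^sub>R op_eval P (\<lambda>g. fst (v g)) s, path_part P v s)"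
proof -
  interpret P: dg_operad P by (rule P)
  interpret Q: dg_operad "path_operad P" by (rule P.dg_operad_path)
  have cl: "op_eval P (\<lambda>g. fst (v g)) s \<in> ops P (arity s) (deg s)" if "well_formed G s" for s
    using Q.op_eval_closed[where v = v and G = G, OF v that] fst_op_eval_path[of P v s] by auto
  have "fst (snd (op_eval (path_operad P) v s)) = real w *\<^sub>R op_eval P (\<lambda>g. fst (v g)) s"
    using s
  proof (induction s arbitrary: w)
    case (Gen g n k)
    then show ?case using wt by auto
  next
    case (Add s t)
    then show ?case by (auto simp: scaleR_add_right)
  next
    case (Scale r s)
    then show ?case using Scale.IH[of w] by (simp add: scaleR_left_commute)
  next
    case (Comp s i t)
    from Comp.prems obtain a b where w: "w = a + b" "homogeneous wt s a" "homogeneous wt t b"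
      by auto
    show ?case
      using Comp.prems w Comp.IH(1)[of a] Comp.IH(2)[of b] fst_op_eval_path[of P v s]
        fst_op_eval_path[of P v t] cl[of s] cl[of t]
      by (cases "op_eval (path_operad P) v s"; cases "op_eval (path_operad P) v t")
        (simp add: P.comp_scale_left P.comp_scale_right scaleR_add_left)
  next
    case (Act \<sigma> s)
    then show ?case using Act.IH[of w] fst_op_eval_path[of P v s] cl[of s]
      by (cases "op_eval (path_operad P) v s") (simp add: P.act_scale)
  next
    case (Dif s)
    then show ?case using Dif.IH[of w] fst_op_eval_path[of P v s] cl[of s]
      by (cases "op_eval (path_operad P) v s") (simp add: P.dif_scale)
  qed auto
  then show ?thesis
    using fst_op_eval_path[of P v s] by (simp add: path_part_def prod_eq_iff)
qed

lemma presented_by_eval_eq: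
  assumes "presented_by B b G R" "(s, t) \<in> R" "well_formed G s" "well_formed G t" "arity s = arity t"
    "deg s = deg t"
  shows "op_eval B b s = op_eval B b t"
  using assms op_eq.rel[of s t R G] by (auto simp: presented_by_def)

lemma presented_by_sound:
  assumes B: "presented_by B b G R" and P: "dg_operad P"
    and v: "\<And>g n k. (g, n, k) \<in> G \<Longrightarrow> v g \<in> ops P n k"
    and R: "\<And>s t. (s, t) \<in> R \<Longrightarrow> well_formed G s \<Longrightarrow> well_formed G t \<Longrightarrow> arity s = arity t \<Longrightarrow>
      deg s = deg t \<Longrightarrow> op_eval P v s = op_eval P v t"
    and s: "well_formed G s" "well_formed G t" "arity s = arity t" "deg s = deg t"
      "op_eval B b s = op_eval B b t"
  shows "op_eval P v s = op_eval P v t"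
proof -
  have "op_eq G R s t" using B s by (auto simp: presented_by_def)
  then show ?thesis using dg_operad.op_eval_sound[OF P, where v = v and G = G and R = R] v R by blast
qed

text \<open>Multiplying each generator by the power of \<open>r\<close> given by its weight preserves homogeneous relations. Applied to
  the vanishing differential of a sum, this gives a polynomial in \<open>r\<close> with value $0$ everywhere, whose
  coefficients are the differentials of the homogeneous parts.\<close>

lemma presented_by_cocycle_parts:
  assumes B: "presented_by B b G R"
    and R: "\<And>s t. (s, t) \<in> R \<Longrightarrow> \<exists>w. homogeneous wt s w \<and> homogeneous wt t w"
    and t: "\<And>w. well_formed G (t w) \<and> homogeneous wt (t w) w \<and> arity (t w) = n \<and> deg (t w) = k"
    and cocycle: "pdif B n k (\<Sum>w<W. op_eval B b (t w)) = 0" and w: "w < W"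
  shows "pdif B n k (op_eval B b (t w)) = 0"
proof -
  interpret dg_operad B using B by (simp add: presented_by_def)
  have b: "b g \<in> ops B n k" if "(g, n, k) \<in> G" for g n k
    using B that by (auto simp: presented_by_def)
  define D where "D = expr_sum n (k + 1) (map (\<lambda>w. Dif (t w)) [0..<W])"
  have D: "well_formed G D \<and> arity D = n \<and> deg D = k + 1"
    unfolding D_def by (rule expr_sum_well_formed) (use t in auto)
  have D_eval: "op_eval B v D = (\<Sum>w<W. pdif B n k (op_eval B v (t w)))" for v
    using t by (simp add: D_def op_eval_expr_sum interv_sum_list_conv_sum_set_nat atLeast0LessThan comp_def)
  have tb: "op_eval B b (t w) \<in> ops B n k" for w
    using op_eval_closed[where v = b and G = G, OF b, of "t w"] t[of w] by simp
  have D_zero: "op_eval B b D = op_eval B b (Zero n (k + 1))"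
    using cocycle by (simp add: D_eval dif_sum tb)
  have relations: "op_eval B (\<lambda>g. r ^ wt g *\<^sub>R b g) s = op_eval B (\<lambda>g. r ^ wt g *\<^sub>R b g) t"
    if st: "(s, t) \<in> R" "well_formed G s" "well_formed G t" "arity s = arity t" "deg s = deg t" for s t r
  proof -
    obtain w where "homogeneous wt s w" "homogeneous wt t w" using R[OF st(1)] by auto
    then show ?thesis
      using op_eval_rescale[where v = b and G = G, OF b] st presented_by_eval_eq[OF B st] by metis
  qed
  have "op_eval B (\<lambda>g. r ^ wt g *\<^sub>R b g) D = op_eval B (\<lambda>g. r ^ wt g *\<^sub>R b g) (Zero n (k + 1))" for r
    by (rule presented_by_sound[OF B dg_operad_axioms scale_closed[OF b] relations _ _ _ _ D_zero])
      (use D in simp_all)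
  moreover have "op_eval B (\<lambda>g. r ^ wt g *\<^sub>R b g) D = (\<Sum>w<W. r ^ w *\<^sub>R pdif B n k (op_eval B b (t w)))" for r
    unfolding D_eval
  proof (rule sum.cong)
    fix w
    show "pdif B n k (op_eval B (\<lambda>g. r ^ wt g *\<^sub>R b g) (t w)) = r ^ w *\<^sub>R pdif B n k (op_eval B b (t w))"
      using op_eval_rescale[where v = b and G = G and s = "t w" and wt = wt and w = w, OF b] t[of w] tb
      by (simp add: dif_scale)
  qed simp
  ultimately have "(\<Sum>w<W. r ^ w *\<^sub>R pdif B n k (op_eval B b (t w))) = 0" for r
    by simp
  then show ?thesis
    using w by (rule polynomial_zero_imp_coeffs_zero[where e = "\<lambda>w. pdif B n k (op_eval B b (t w))"])
qed

text \<open>The hypotheses say that \<open>v\<close> extends \<open>f\<close> to a morphism from \<open>B\<close> to the path operad of \<open>P\<close> whose second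
  component is the weight derivation; in the first two components the relations hold automatically. For a cocycle of
  weight \<open>w\<close>, the last component of the equation $d=0$ says that \<open>w\<close> times its image is a coboundary.\<close>

theorem cocycle_acts_exactly:
  assumes B: "presented_by B b G R"
    and R: "\<And>s t. (s, t) \<in> R \<Longrightarrow> \<exists>w. homogeneous wt s w \<and> homogeneous wt t w"
    and weight0: "\<And>g n k. (g, n, k) \<in> G \<Longrightarrow> wt g = 0 \<Longrightarrow> k = 0 \<and> pdif B n k (b g) = 0"
    and P: "dg_operad P" and hom: "operad_hom B P f"
    and z: "\<And>g n k. (g, n, k) \<in> G \<Longrightarrow> z g \<in> ops P n (k - 1)"
    and v: "\<And>g n k. (g, n, k) \<in> G \<Longrightarrow> v g = (f n k (b g), real (wt g) *\<^sub>R f n k (b g), z g)"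
    and path: "\<And>s t. (s, t) \<in> R \<Longrightarrow> well_formed G s \<Longrightarrow> well_formed G t \<Longrightarrow> path_part P v s = path_part P v t"
    and c: "c \<in> ops B n k" "pdif B n k c = 0" "k \<noteq> 0"
  shows "\<exists>h\<in>ops P n (k - 1). f n k c = pdif P n (k - 1) h"
proof -
  interpret B: dg_operad B using B by (simp add: presented_by_def)
  interpret P: dg_operad P by (rule P)
  interpret operad_hom B P f by (rule hom)
  interpret Q: dg_operad "path_operad P" by (rule P.dg_operad_path)
  have b: "b g \<in> ops B n k" if "(g, n, k) \<in> G" for g n k
    using B that by (auto simp: presented_by_def)
  have v_closed: "v g \<in> ops (path_operad P) n k" if "(g, n, k) \<in> G" for g n k
    using v[OF that] z[OF that] hom_closed[OF b[OF that]] by (simp add: P.scale_closed)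
  have v_wt: "fst (snd (v g)) = real (wt g) *\<^sub>R fst (v g)" if "(g, n, k) \<in> G" for g n k
    using v[OF that] by simp
  have eval_f: "op_eval P (\<lambda>g. fst (v g)) s = f (arity s) (deg s) (op_eval B b s)" if "well_formed G s" for s
    using hom_op_eval[OF B.dg_operad_axioms, where v = b and G = G and w = "\<lambda>g. fst (v g)", OF b] v that by simp
  have relations: "op_eval (path_operad P) v s = op_eval (path_operad P) v t"
    if st: "(s, t) \<in> R" "well_formed G s" "well_formed G t" "arity s = arity t" "deg s = deg t" for s t
  proof -
    obtain w where w: "homogeneous wt s w" "homogeneous wt t w" using R[OF st(1)] by auto
    have "op_eval P (\<lambda>g. fst (v g)) s = op_eval P (\<lambda>g. fst (v g)) t"
      using eval_f st presented_by_eval_eq[OF B st] by simp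
    then show ?thesis
      using op_eval_path[where v = v and G = G, OF P v_closed v_wt st(2) w(1)]
        op_eval_path[where v = v and G = G, OF P v_closed v_wt st(3) w(2)] path[OF st(1-3)] by simp
  qed
  obtain s where s: "well_formed G s" "arity s = n" "deg s = k" "op_eval B b s = c"
    using B c(1) unfolding presented_by_def by blast
  obtain W t where t: "\<And>w. well_formed G (t w) \<and> homogeneous wt (t w) w \<and> arity (t w) = n \<and> deg (t w) = k"
    and sum: "c = (\<Sum>w<W. op_eval B b (t w))"
    using homogeneous_decomposition[OF B.dg_operad_axioms, where v = b and G = G, OF b s(1)] s by metis
  have tb: "op_eval B b (t w) \<in> ops B n k" for w
    using B.op_eval_closed[where v = b and G = G, OF b, of "t w"] t[of w] by simp
  have "\<exists>h\<in>ops P n (k - 1). f n k (op_eval B b (t w)) = pdif P n (k - 1) h" if w: "w < W" for w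
  proof (cases "w = 0")
    case True
    have "op_eval B b (t w) = 0"
    proof (rule B.op_eval_zero_of_degree[where v = b and G = "{(g, n, k) \<in> G. wt g = 0}"])
      show "well_formed {(g, n, k) \<in> G. wt g = 0} (t w)"
        using t[of w] True by (intro well_formed_weight_zero) auto
      show "b g \<in> ops B n k" if "(g, n, k) \<in> {(g, n, k) \<in> G. wt g = 0}" for g n k
        using b that by auto
      show "k = 0 \<and> pdif B n k (b g) = 0" if "(g, n, k) \<in> {(g, n, k) \<in> G. wt g = 0}" for g n k
        using weight0[of g n k] that by auto
      show "deg (t w) \<noteq> 0" using t[of w] c(3) by auto
    qed
    then show ?thesis
      by (intro bexI[of _ 0]) (simp_all add: hom_zero[OF B.dg_operad_axioms] P.dif_zero P.zero_closed)
  next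
    case False
    have "pdif B n k (op_eval B b (t w)) = 0"
      using presented_by_cocycle_parts[OF B R t _ w] c(2) sum by simp
    then have "op_eval (path_operad P) v (Dif (t w)) = op_eval (path_operad P) v (Zero n (k + 1))"
      by (intro presented_by_sound[OF B Q.dg_operad_axioms v_closed relations]) (use t[of w] in auto)
    then have "real w *\<^sub>R f n k (op_eval B b (t w)) = pdif P n (k - 1) (path_part P v (t w))"
      using op_eval_path[where v = v and G = G and s = "t w" and w = w, OF P v_closed v_wt] t[of w] eval_f[of "t w"]
      by (simp add: zero_prod_def)
    then have "f n k (op_eval B b (t w)) = (1 / real w) *\<^sub>R pdif P n (k - 1) (path_part P v (t w))"
      using False by (metis divide_self_if of_nat_eq_0_iff scaleR_one scaleR_scaleR times_divide_eq_left mult_1)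
    moreover have "path_part P v (t w) \<in> ops P n (k - 1)"
      using Q.op_eval_closed[where v = v and G = G and s = "t w", OF v_closed] t[of w]
      by (auto simp: path_part_def)
    ultimately show ?thesis
      using P.dif_scale P.scale_closed by metis
  qed
  then obtain h where h: "\<And>w. w < W \<Longrightarrow> h w \<in> ops P n (k - 1)"
    "\<And>w. w < W \<Longrightarrow> f n k (op_eval B b (t w)) = pdif P n (k - 1) (h w)"
    by metis
  have "pdif P n (k - 1) (\<Sum>w<W. h w) = (\<Sum>w<W. pdif P n (k - 1) (h w))"
    by (rule P.dif_sum) (use h in auto)
  then have "f n k c = pdif P n (k - 1) (\<Sum>w<W. h w)"
    unfolding sum using h tb by (simp add: hom_sum[OF B.dg_operad_axioms])
  moreover have "(\<Sum>w<W. h w) \<in> ops P n (k - 1)"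
    by (rule P.sum_closed) (use h in auto)
  ultimately show ?thesis by blast
qed

section \<open>Trivialized BV-infinity structures with a single operator\<close>

primrec cbv_weight :: "cbv_gen \<Rightarrow> nat" where
  "cbv_weight Mu = 0" | "cbv_weight (Delta n) = n" | "cbv_weight (Phi n) = n"

lemma mu_power_well_formed:
  "well_formed cbv_signature (mu_power n) \<and> arity (mu_power n) = Suc n \<and> deg (mu_power n) = 0"
  by (induction n) (auto simp: cbv_signature_def)

lemma mu_power_homogeneous: "homogeneous cbv_weight (mu_power n) 0"
  by (induction n) auto

lemma homogeneous_Comp_left: "homogeneous wt s w \<Longrightarrow> homogeneous wt t 0 \<Longrightarrow> homogeneous wt (Comp s i t) w"
  and homogeneous_Comp_right: "homogeneous wt s 0 \<Longrightarrow> homogeneous wt t w \<Longrightarrow> homogeneous wt (Comp s i t) w"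
  by force+

lemma diff_op_term_homogeneous:
  "homogeneous cbv_weight D w \<Longrightarrow> homogeneous cbv_weight (diff_op_term D p q) w"
proof -
  assume "homogeneous cbv_weight D w"
  then have D: "homogeneous cbv_weight (Comp D 0 (mu_power (p - 1))) w"
    using mu_power_homogeneous by (rule homogeneous_Comp_left)
  have "homogeneous cbv_weight (Comp mu_gen 0 (Comp D 0 (mu_power (p - 1)))) w"
    by (rule homogeneous_Comp_right[OF _ D]) simp
  then have "homogeneous cbv_weight (Comp (Comp mu_gen 0 (Comp D 0 (mu_power (p - 1)))) p (mu_power (q - 1))) w"
    using mu_power_homogeneous by (rule homogeneous_Comp_left)
  with D show ?thesis unfolding diff_op_term_def by presburger
qed

lemma phi_bracket_homogeneous: "homogeneous cbv_weight (phi_bracket qs) (sum_list qs)"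
proof (induction qs rule: phi_bracket.induct)
  case (3 q q' qs)
  then show ?case by (auto simp: commutator_expr_def intro: exI[of _ q] exI[of _ "q' + sum_list qs"])
qed auto

lemma cbv_relations_homogeneous:
  assumes "(s, t) \<in> cbv_relations"
  shows "\<exists>w. homogeneous cbv_weight s w \<and> homogeneous cbv_weight t w"
proof -
  have delta: "homogeneous cbv_weight (delta_expr n) n" for n
    by (auto simp: delta_expr_def homogeneous_expr_sum)
  have order: "homogeneous cbv_weight (diff_op_expr (n + 1) (delta_gen n)) n" for n
    by (auto simp: diff_op_expr_def homogeneous_expr_sum Let_def intro!: diff_op_term_homogeneous)
  have phi: "homogeneous cbv_weight (phi_expr n) n" for n
    using phi_bracket_homogeneous by (auto simp: phi_expr_def homogeneous_expr_sum)
  show ?thesis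
    using assms delta order phi unfolding cbv_relations_def by (auto; blast)
qed

lemma expr_sum_well_formedD:
  "well_formed G (expr_sum n k ss) \<Longrightarrow> s \<in> set ss \<Longrightarrow> well_formed G s"
  by (induction ss) (auto simp: expr_sum_Cons)

lemma phi_bracket_deg: "qs \<noteq> [] \<Longrightarrow> deg (phi_bracket qs) = 1 - 2 * int (sum_list qs)"
  and phi_bracket_arity: "arity (phi_bracket qs) = 1"
  by (induction qs rule: phi_bracket.induct) (auto simp: commutator_expr_def)

lemma phi_bracket_well_formed:
  "(\<And>q. q \<in> set qs \<Longrightarrow> 1 \<le> q) \<Longrightarrow> well_formed cbv_signature (phi_bracket qs)"
  by (induction qs rule: phi_bracket.induct)
    (auto simp: commutator_expr_def cbv_signature_def phi_bracket_arity)

lemma sum_list_concat: "sum_list (concat xss) = sum_list (map sum_list xss)"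
  by (induction xss) simp_all

text \<open>The indices of a bracket in \<open>phi_expr n\<close> are positive and have sum \<open>n\<close>, so the only bracket all of whose
  indices are \<open>1\<close> is the one of length \<open>n\<close>.\<close>

lemma phi_expr_linear:
  fixes F :: "cbv_gen opexpr \<Rightarrow> 'a::real_vector"
  assumes add: "\<And>s t. F (Add s t) = F s + F t" and scale: "\<And>r s. F (Scale r s) = r *\<^sub>R F s"
    and zero: "\<And>n k. F (Zero n k) = 0" and n: "2 \<le> n"
    and vanish: "\<And>qs. (\<And>q. q \<in> set qs \<Longrightarrow> 1 \<le> q) \<Longrightarrow> (\<exists>q\<in>set qs. 2 \<le> q) \<Longrightarrow> F (phi_bracket qs) = 0"
  shows "F (phi_expr n) = F (Dif (phi_gen n)) + (1 / fact n) *\<^sub>R F (phi_bracket (replicate n 1))"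
proof -
  have expr_sum: "F (expr_sum a k ss) = sum_list (map F ss)" for a k ss
    by (induction ss) (simp_all add: expr_sum_Cons expr_sum_Nil zero add)
  define qss where "qss p = filter (\<lambda>qs. sum_list qs = n) (List.n_lists p [1..<n + 1])" for p
  have qss: "set (qss p) = {qs. length qs = p \<and> set qs \<subseteq> {1..<n + 1} \<and> sum_list qs = n}" for p
    by (auto simp: qss_def set_n_lists)
  have distinct: "distinct (qss p)" for p
    by (simp add: qss_def distinct_n_lists)
  have inner: "sum_list (map (\<lambda>qs. (1 / fact p) *\<^sub>R F (phi_bracket qs)) (qss p)) =
      (if p = n then (1 / fact n) *\<^sub>R F (phi_bracket (replicate n 1)) else 0)" if p: "p \<le> n" for p
  proof -
    have van: "F (phi_bracket qs) = 0" if "qs \<in> set (qss p)" "qs \<noteq> replicate n 1" for qs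
    proof (rule vanish)
      have qs: "length qs = p" "set qs \<subseteq> {1..<n + 1}" "sum_list qs = n"
        using that(1) by (auto simp: qss)
      show ge1: "1 \<le> q" if "q \<in> set qs" for q using that qs by auto
      show "\<exists>q\<in>set qs. 2 \<le> q"
      proof (rule ccontr)
        assume "\<not> (\<exists>q\<in>set qs. 2 \<le> q)"
        then have "q = 1" if "q \<in> set qs" for q using that ge1[OF that] by force
        then have "qs = replicate p 1" using qs by (metis replicate_eqI)
        then show False using qs that(2) by (simp add: sum_list_replicate)
      qed
    qed
    have "sum_list (map (\<lambda>qs. (1 / fact p) *\<^sub>R F (phi_bracket qs)) (qss p)) =
        (\<Sum>qs\<in>set (qss p). (1 / fact p) *\<^sub>R F (phi_bracket qs))"
      by (rule sum_list_distinct_conv_sum_set[OF distinct])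
    also have "\<dots> = (\<Sum>qs\<in>set (qss p) \<inter> {replicate n 1}. (1 / fact p) *\<^sub>R F (phi_bracket qs))"
      by (rule sum.mono_neutral_right) (use van in auto)
    also have "set (qss p) \<inter> {replicate n 1} = (if p = n then {replicate n 1} else {})"
      using n by (auto simp: qss sum_list_replicate)
    finally show ?thesis by simp
  qed
  have "F (phi_expr n) = F (Dif (phi_gen n)) +
      sum_list (map (\<lambda>p. sum_list (map (\<lambda>qs. (1 / fact p) *\<^sub>R F (phi_bracket qs)) (qss p))) [2..<n + 1])"
    by (simp add: phi_expr_def add expr_sum scale map_concat sum_list_concat comp_def qss_def sum_list_concat del: upt_Suc)
  also have "sum_list (map (\<lambda>p. sum_list (map (\<lambda>qs. (1 / fact p) *\<^sub>R F (phi_bracket qs)) (qss p))) [2..<n + 1]) =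
      (\<Sum>p\<in>{2..<n + 1}. if p = n then (1 / fact n) *\<^sub>R F (phi_bracket (replicate n 1)) else 0)"
    unfolding interv_sum_list_conv_sum_set_nat by (rule sum.cong) (use inner in auto)
  also have "\<dots> = (1 / fact n) *\<^sub>R F (phi_bracket (replicate n 1))"
    using n by simp
  finally show ?thesis .
qed

context dg_operad
begin

lemma comp_minus_left: "x \<in> ops P n k \<Longrightarrow> y \<in> ops P m l \<Longrightarrow> i < n \<Longrightarrow>
    pcomp P n k m l i (- x) y = - pcomp P n k m l i x y"
  using comp_diff_left[of 0 n k x y m l i] by (simp add: zero_closed comp_zero_left)

lemma comp_minus_right: "x \<in> ops P n k \<Longrightarrow> y \<in> ops P m l \<Longrightarrow> i < n \<Longrightarrow>
    pcomp P n k m l i x (- y) = - pcomp P n k m l i x y"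
  using comp_diff_right[of x n k 0 m l y i] by (simp add: zero_closed comp_zero_right)

lemma act_minus: "x \<in> ops P n k \<Longrightarrow> \<sigma> permutes {..<n} \<Longrightarrow> pact P n k \<sigma> (- x) = - pact P n k \<sigma> x"
  using act_diff[of 0 n k x \<sigma>] by (simp add: zero_closed act_zero)

lemma dif_minus: "x \<in> ops P n k \<Longrightarrow> pdif P n k (- x) = - pdif P n k x"
  using dif_diff[of 0 n k x] by (simp add: zero_closed dif_zero)

end

lemma phi_expr_well_formed:
  assumes "1 \<le> n"
  shows "well_formed cbv_signature (phi_expr n) \<and> arity (phi_expr n) = 1 \<and> deg (phi_expr n) = 1 - 2 * int n"
proof -
  define ss where "ss = concat (map (\<lambda>p. map (\<lambda>qs. Scale (1 / fact p) (phi_bracket qs))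
        (filter (\<lambda>qs. sum_list qs = n) (List.n_lists p [1..<n + 1]))) [2..<n + 1])"
  have ss: "\<exists>r qs. s = Scale r (phi_bracket qs) \<and> sum_list qs = n \<and> (\<forall>q\<in>set qs. 1 \<le> q)"
    if "s \<in> set ss" for s
    using that by (fastforce simp: ss_def set_n_lists)
  have "well_formed cbv_signature (expr_sum 1 (1 - 2 * int n) ss) \<and> arity (expr_sum 1 (1 - 2 * int n) ss) = 1 \<and>
      deg (expr_sum 1 (1 - 2 * int n) ss) = 1 - 2 * int n"
  proof (rule expr_sum_well_formed)
    fix s assume "s \<in> set ss"
    from ss[OF this] obtain r qs where s: "s = Scale r (phi_bracket qs)" "sum_list qs = n" "\<forall>q\<in>set qs. 1 \<le> q"
      by blast
    then have "qs \<noteq> []" using assms by auto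
    then show "well_formed cbv_signature s \<and> arity s = 1 \<and> deg s = 1 - 2 * int n"
      using s phi_bracket_deg[of qs] phi_bracket_well_formed[of qs] by (auto simp: phi_bracket_arity)
  qed
  moreover have "(Phi n, 1, - 2 * int n) \<in> cbv_signature"
    using assms by (auto simp: cbv_signature_def)
  ultimately show ?thesis
    unfolding phi_expr_def ss_def[symmetric] by simp
qed

text \<open>The homotopy sends $\Delta_n$ to $-\phi_n$ and all other generators to $0$. With $\phi_n=0$ for $n\geq2$ it is
  compatible with the relations for the following reasons. The bracket relation of index $1$ fixes
  the value on $\Delta_1$; in the others $h$ yields brackets of $\phi_1$ with itself, which vanish. Applied to
  $d(\Delta_n)+\sum_r\Delta_r\Delta_{n-r}=0$ it yields $n\Delta_n=[\phi_1,\Delta_{n-1}]$ for $n\geq2$, which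
  follows from $\Delta_n=-\frac{1}{n!}\mathrm{ad}_{\phi_1}^{n-1}(d\phi_1)$. Applied to the order condition
  on $\Delta_1$ it yields that on $\phi_1$, which is assumed.\<close>

theorem cbv_cocycle_acts_exactly:
  assumes B: "cbv_mod_delta_operad B b" and P: "dg_operad P" and hom: "operad_hom B P f"
    and x: "\<And>g n k. (g, n, k) \<in> cbv_signature \<Longrightarrow> f n k (b g) = x g"
    and phi: "\<And>n. 2 \<le> n \<Longrightarrow> x (Phi n) = 0"
    and order: "op_eval P x (diff_op_expr 2 (phi_gen 1)) = 0"
    and c: "c \<in> ops B n k" "pdif B n k c = 0" "k \<noteq> 0"
  shows "\<exists>h\<in>ops P n (k - 1). f n k c = pdif P n (k - 1) h"
proof -
  have pres: "presented_by B b cbv_signature cbv_relations"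
    using B by (simp add: cbv_mod_delta_operad_def)
  interpret B: dg_operad B using pres by (simp add: presented_by_def)
  interpret P: dg_operad P by (rule P)
  interpret operad_hom B P f by (rule hom)
  define z where "z g = (case g of Delta n \<Rightarrow> - x (Phi n) | _ \<Rightarrow> 0)" for g
  define v where "v g = (x g, real (cbv_weight g) *\<^sub>R x g, z g)" for g
  let ?X = "op_eval P x" and ?Z = "path_part P v"
  have b: "b g \<in> ops B n k" if "(g, n, k) \<in> cbv_signature" for g n k
    using pres that by (auto simp: presented_by_def)
  have x_closed: "x g \<in> ops P n k" if "(g, n, k) \<in> cbv_signature" for g n k
    using hom_closed[OF b[OF that]] x[OF that] by simp
  have Delta_closed: "x (Delta n) \<in> ops P 1 (1 - 2 * int n)" and Phi_closed: "x (Phi n) \<in> ops P 1 (- 2 * int n)"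
    if "1 \<le> n" for n
    using that by (auto intro!: x_closed simp: cbv_signature_def)
  have z_closed: "z g \<in> ops P n (k - 1)" if "(g, n, k) \<in> cbv_signature" for g n k
    using that Phi_closed P.scale_closed[of "x (Phi _)" 1 _ "-1"]
    by (auto simp: z_def cbv_signature_def P.zero_closed)
  have X_closed: "?X s \<in> ops P (arity s) (deg s)" if "well_formed cbv_signature s" for s
    using P.op_eval_closed[where v = x and G = cbv_signature, OF x_closed that] .
  have X_rel: "?X s = ?X t"
    if "(s, t) \<in> cbv_relations" "well_formed cbv_signature s" "well_formed cbv_signature t" "arity s = arity t" "deg s = deg t" for s t
    using hom_op_eval[OF B.dg_operad_axioms, where v = b and G = cbv_signature and w = x, OF b x, of s]
      hom_op_eval[OF B.dg_operad_axioms, where v = b and G = cbv_signature and w = x, OF b x, of t]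
      presented_by_eval_eq[OF pres that] that by simp
  have mu_X: "?X (mu_power n) \<in> ops P (Suc n) 0" for n
    using X_closed[of "mu_power n"] mu_power_well_formed[of n] by simp
  have Z_simps: "?Z (Gen g n k) = z g" "?Z OpUnit = 0" "?Z (Zero n k) = 0" "?Z (Add s t) = ?Z s + ?Z t"
    "?Z (Scale r s) = r *\<^sub>R ?Z s" for g n k s t r
    by (simp_all add: path_part_def v_def)
  have fst_v: "fst (op_eval (path_operad P) v s) = ?X s" for s
    by (simp add: fst_op_eval_path v_def)
  have Z_Comp: "?Z (Comp s i t) = pcomp P (arity s) (deg s - 1) (arity t) (deg t) i (?Z s) (?X t) +
      parity_sign (deg s) *\<^sub>R pcomp P (arity s) (deg s) (arity t) (deg t - 1) i (?X s) (?Z t)" for s i t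
    using fst_v[of s] fst_v[of t] unfolding path_part_def
    by (cases "op_eval (path_operad P) v s"; cases "op_eval (path_operad P) v t") auto
  have Z_Act: "?Z (Act \<sigma> s) = pact P (arity s) (deg s - 1) \<sigma> (?Z s)" for s \<sigma>
    unfolding path_part_def by (cases "op_eval (path_operad P) v s") auto
  have Z_Dif: "?Z (Dif (Gen g n k)) = real (cbv_weight g) *\<^sub>R x g - pdif P n (k - 1) (z g)" for g n k
    by (simp add: path_part_def v_def)
  have z_Delta: "z (Delta n) = - x (Phi n)" and z_Phi: "z (Phi n) = 0" and z_Mu: "z Mu = 0" for n
    by (simp_all add: z_def)
  have Z_mu: "?Z (mu_power n) = 0" for n
    using mu_X[of n] mu_power_well_formed[of n] x_closed[of Mu 2 0]
    by (induction n) (simp_all add: Z_simps Z_Comp z_Mu P.comp_zero_left P.comp_zero_right mu_X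
        mu_power_well_formed cbv_signature_def)
  note minus = P.comp_minus_left P.comp_minus_right P.act_minus P.dif_minus
  have parity: "parity_sign (- 2 * int q) = 1" "parity_sign (- (2 * int q)) = 1" "parity_sign (- (2 * int q * d)) = 1"
    "parity_sign (1 - 2 * int q) = -1" for q d
    by (auto simp: parity_sign_def)
  \<comment> \<open>In the first component, the bracket relation expresses the \<open>\<Delta>\<^sub>n\<close> by \<open>\<phi>\<^sub>1\<close>.\<close>
  have X_bracket: "?X (phi_bracket (q # q' # qs)) =
      pcomp P 1 (- 2 * int q) 1 (deg (phi_bracket (q' # qs))) 0 (x (Phi q)) (?X (phi_bracket (q' # qs))) -
      pcomp P 1 (deg (phi_bracket (q' # qs))) 1 (- 2 * int q) 0 (?X (phi_bracket (q' # qs))) (x (Phi q))" for q q' qs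
    by (simp add: commutator_expr_def parity phi_bracket_arity)
  have bracket_closed: "?X (phi_bracket qs) \<in> ops P 1 (deg (phi_bracket qs))" if "\<And>q. q \<in> set qs \<Longrightarrow> 1 \<le> q" for qs
    using X_closed[OF phi_bracket_well_formed[OF that]] by (simp add: phi_bracket_arity)
  have X_vanish: "?X (phi_bracket qs) = 0" if "\<And>q. q \<in> set qs \<Longrightarrow> 1 \<le> q" "\<exists>q\<in>set qs. 2 \<le> q" for qs
    using that
  proof (induction qs rule: phi_bracket.induct)
    case (3 q q' qs)
    then have "2 \<le> q \<or> ?X (phi_bracket (q' # qs)) = 0" by fastforce
    then show ?case
      using 3(2) bracket_closed[of "q' # qs"] Phi_closed[of q]
      by (auto simp: X_bracket phi P.comp_zero_left P.comp_zero_right simp del: phi_bracket.simps One_nat_def)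
  qed (auto simp: phi P.dif_zero)
  define A where "A n = ?X (phi_bracket (replicate n 1))" for n
  have A_closed: "A n \<in> ops P 1 (1 - 2 * int n)" if "1 \<le> n" for n
    using bracket_closed[of "replicate n 1"] phi_bracket_deg[of "replicate n 1"] that
    by (simp add: A_def sum_list_replicate)
  have A_1: "A 1 = pdif P 1 (- 2) (x (Phi 1))" by (simp add: A_def)
  have A_Suc: "A (Suc n) = pcomp P 1 (- 2) 1 (1 - 2 * int n) 0 (x (Phi 1)) (A n) -
      pcomp P 1 (1 - 2 * int n) 1 (- 2) 0 (A n) (x (Phi 1))" if n: "1 \<le> n" for n
  proof -
    obtain m where "n = Suc m" using n by (cases n) auto
    then show ?thesis
      using X_bracket[of 1 1 "replicate m 1"] phi_bracket_deg[of "replicate n 1"]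
      by (simp add: A_def sum_list_replicate del: phi_bracket.simps)
  qed
  have Delta_A: "x (Delta n) = - ((1 / fact n) *\<^sub>R A n)" if n: "1 \<le> n" for n
  proof -
    have "?X (phi_expr n) = ?X (Scale (- 1) (delta_gen n))"
      by (rule X_rel) (use n phi_expr_well_formed[OF n] in \<open>auto simp: cbv_relations_def cbv_signature_def\<close>)
    moreover have "?X (phi_expr n) = (1 / fact n) *\<^sub>R A n"
    proof (cases "n = 1")
      case True
      then show ?thesis by (simp add: phi_expr_def expr_sum_Nil A_def)
    next
      case False
      then show ?thesis
        using n phi_expr_linear[of ?X n] X_vanish phi[of n] by (simp add: A_def P.dif_zero)
    qed
    ultimately show ?thesis by (simp add: eq_neg_iff_add_eq_0 add.commute)
  qed
  have Delta_Suc: "real (Suc n) *\<^sub>R x (Delta (Suc n)) =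
      pcomp P 1 (- 2) 1 (1 - 2 * int n) 0 (x (Phi 1)) (x (Delta n)) -
      pcomp P 1 (1 - 2 * int n) 1 (- 2) 0 (x (Delta n)) (x (Phi 1))" if n: "1 \<le> n" for n
  proof -
    have "real (Suc n) *\<^sub>R x (Delta (Suc n)) = - ((1 / fact n) *\<^sub>R A (Suc n))"
      by (simp add: Delta_A)
    also have "\<dots> = pcomp P 1 (- 2) 1 (1 - 2 * int n) 0 (x (Phi 1)) (x (Delta n)) -
      pcomp P 1 (1 - 2 * int n) 1 (- 2) 0 (x (Delta n)) (x (Phi 1))"
      using A_closed[OF n] Phi_closed[of 1]
      by (simp add: A_Suc[OF n] Delta_A[OF n] minus P.scale_closed P.comp_scale_left P.comp_scale_right
          scaleR_diff_right del: One_nat_def)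
    finally show ?thesis .
  qed
  \<comment> \<open>In the last component, all brackets vanish because \<open>\<phi>\<^sub>1\<close> commutes with itself.\<close>
  have Z_bracket: "?Z (phi_bracket (q # q' # qs)) =
      pcomp P 1 (- 2 * int q) 1 (deg (phi_bracket (q' # qs)) - 1) 0 (x (Phi q)) (?Z (phi_bracket (q' # qs))) -
      pcomp P 1 (deg (phi_bracket (q' # qs)) - 1) 1 (- 2 * int q) 0 (?Z (phi_bracket (q' # qs))) (x (Phi q))"
    if "\<And>p. p \<in> set (q # q' # qs) \<Longrightarrow> 1 \<le> p" for q q' qs
    using bracket_closed[of "q' # qs"] that
    by (simp add: commutator_expr_def Z_simps Z_Comp z_Phi parity phi_bracket_arity P.comp_zero_left
        P.comp_zero_right del: phi_bracket.simps(2) One_nat_def)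
  have Z_vanish: "?Z (phi_bracket (q # q' # qs)) = 0" if "\<And>p. p \<in> set (q # q' # qs) \<Longrightarrow> 1 \<le> p" for q q' qs
    using that
  proof (induction qs arbitrary: q q')
    case Nil
    have "?Z (phi_bracket [q']) = real q' *\<^sub>R x (Phi q')"
      by (simp add: Z_Dif z_Phi P.dif_zero)
    moreover have "q = 1 \<and> q' = 1 \<or> x (Phi q) = 0 \<or> x (Phi q') = 0"
      using Nil[of q] Nil[of q'] phi[of q] phi[of q'] by force
    moreover have "deg (phi_bracket [q']) - 1 = - 2 * int q'" by simp
    ultimately show ?case
      using Nil[of q] Nil[of q'] Phi_closed[of q] Phi_closed[of q'] P.scale_closed[of "x (Phi q')" 1 "- 2 * int q'" "real q'"]
        Z_bracket[of q q' "[]", OF Nil]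
      by (auto simp: P.comp_zero_left P.comp_zero_right simp del: phi_bracket.simps One_nat_def)
  next
    case (Cons p qs)
    have "?Z (phi_bracket (q' # p # qs)) = 0" by (rule Cons.IH) (use Cons.prems in auto)
    then show ?case
      using Cons.prems[of q] Phi_closed[of q] Z_bracket[of q q' "p # qs", OF Cons.prems]
      by (simp add: P.comp_zero_left P.comp_zero_right del: phi_bracket.simps One_nat_def)
  qed
  have Z_phi: "?Z (phi_expr n) = x (Phi n)" if n: "1 \<le> n" for n
  proof (cases "n = 1")
    case True
    then show ?thesis by (simp add: phi_expr_def expr_sum_Nil Z_simps Z_Dif z_Phi P.dif_zero)
  next
    case False
    have vanish: "?Z (phi_bracket qs) = 0" if "\<And>q. q \<in> set qs \<Longrightarrow> 1 \<le> q" "\<exists>q\<in>set qs. 2 \<le> q" for qs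
      using that Z_vanish phi
      by (cases qs rule: phi_bracket.cases) (auto simp: Z_Dif z_Phi P.dif_zero simp del: phi_bracket.simps(3))
    have "?Z (phi_expr n) = ?Z (Dif (phi_gen n)) + (1 / fact n) *\<^sub>R ?Z (phi_bracket (replicate n 1))"
      by (rule phi_expr_linear) (use vanish False n in \<open>auto simp: Z_simps\<close>)
    moreover obtain m where "n = Suc (Suc m)" using n False by (metis One_nat_def Suc_le_D le_antisym not_less_eq_eq)
    moreover have "?Z (phi_bracket (1 # 1 # replicate m 1)) = 0"
      by (rule Z_vanish) (auto split: if_splits)
    ultimately show ?thesis
      using phi[of n] by (simp add: Z_Dif z_Phi P.dif_zero del: phi_bracket.simps)
  qed
  have Z_expr_sum: "?Z (expr_sum n k ss) = sum_list (map ?Z ss)" for n k ss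
    by (induction ss) (simp_all add: expr_sum_Cons expr_sum_Nil Z_simps)
  have Z_delta: "?Z (delta_expr n) = 0" if n: "1 \<le> n" for n
  proof (cases "n = 1")
    case True
    then show ?thesis
      using Delta_A[of 1] A_1 Phi_closed[of 1]
      by (simp add: delta_expr_def expr_sum_Nil Z_simps Z_Dif z_Delta minus)
  next
    case False
    then obtain m where m: "n = Suc m" "1 \<le> m" using n by (cases n) auto
    let ?a = "\<lambda>r. - pcomp P 1 (- 2 * int r) 1 (1 - 2 * int (n - r)) 0 (x (Phi r)) (x (Delta (n - r)))"
    let ?b = "\<lambda>r. pcomp P 1 (1 - 2 * int r) 1 (- 2 * int (n - r)) 0 (x (Delta r)) (x (Phi (n - r)))"
    have summand: "?Z (Comp (delta_gen r) 0 (delta_gen (n - r))) = ?a r + ?b r" if "r \<in> {1..<n}" for r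
    proof -
      obtain s where "n - r = s" "1 \<le> s" using \<open>r \<in> {1..<n}\<close> by auto
      then show ?thesis
        using \<open>r \<in> {1..<n}\<close> Phi_closed[of r] Phi_closed[of s] Delta_closed[of r] Delta_closed[of s]
        by (simp add: Z_Comp Z_simps z_Delta parity minus)
    qed
    have a: "?a r = 0" if "r \<in> {1..<n}" "r \<noteq> 1" for r
      using that phi[of r] Delta_closed[of "n - r"] by (subst phi) (auto simp: P.comp_zero_left)
    have b: "?b r = 0" if "r \<in> {1..<n}" "r \<noteq> m" for r
      using that m phi[of "n - r"] Delta_closed[of r] by (subst phi[of "n - r"]) (auto simp: P.comp_zero_right)
    have "(\<Sum>r\<in>{1..<n}. ?a r) = (\<Sum>r\<in>{1}. ?a r)" "(\<Sum>r\<in>{1..<n}. ?b r) = (\<Sum>r\<in>{m}. ?b r)"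
      by (rule sum.mono_neutral_right; use m a b in auto)+
    then have "(\<Sum>r\<in>{1..<n}. ?a r + ?b r) = ?a 1 + ?b m"
      by (simp only: sum.distrib) simp
    moreover have "?a 1 + ?b m = - (real n *\<^sub>R x (Delta n))"
      using Delta_Suc[OF m(2)] m(1) by simp
    moreover have "?Z (delta_expr n) = real n *\<^sub>R x (Delta n) + (\<Sum>r\<in>{1..<n}. ?a r + ?b r)"
    proof -
      have "?Z (delta_expr n) = ?Z (Dif (delta_gen n)) +
          (\<Sum>r\<in>{1..<n}. ?Z (Comp (delta_gen r) 0 (delta_gen (n - r))))"
        by (simp add: delta_expr_def Z_simps Z_expr_sum comp_def interv_sum_list_conv_sum_set_nat del: upt_Suc)
      also have "?Z (Dif (delta_gen n)) = real n *\<^sub>R x (Delta n)"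
        using phi[of n] m by (simp add: Z_Dif z_Delta P.dif_zero)
      also have "(\<Sum>r\<in>{1..<n}. ?Z (Comp (delta_gen r) 0 (delta_gen (n - r)))) = (\<Sum>r\<in>{1..<n}. ?a r + ?b r)"
        by (rule sum.cong[OF HOL.refl summand])
      finally show ?thesis .
    qed
    ultimately show ?thesis by simp
  qed
  have Z_term: "?Z (diff_op_term (delta_gen n) p q) = - ?X (diff_op_term (phi_gen n) p q)" if n: "1 \<le> n" for n p q
  proof -
    have inner: "?Z (Comp (delta_gen n) 0 (mu_power (p - 1))) = - ?X (Comp (phi_gen n) 0 (mu_power (p - 1)))"
      using Phi_closed[OF n] Delta_closed[OF n] mu_X[of "p - 1"] mu_power_well_formed[of "p - 1"]
      by (simp add: Z_Comp Z_simps z_Delta Z_mu P.comp_zero_right minus)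
    show ?thesis
    proof (cases "q = 0")
      case True
      then show ?thesis using inner by (simp add: diff_op_term_def)
    next
      case False
      let ?T = "\<lambda>D. Comp D 0 (mu_power (p - 1))" and ?M = "mu_power (q - 1)"
      let ?U = "\<lambda>D. Comp mu_gen 0 (?T D)"
      have wf: "well_formed cbv_signature (?T D)" "well_formed cbv_signature (?U D)"
        if "D = delta_gen n \<or> D = phi_gen n" for D
        using that n mu_power_well_formed[of "p - 1"] by (auto simp: cbv_signature_def)
      have U: "?Z (?U (delta_gen n)) = - ?X (?U (phi_gen n))"
        using inner X_closed[OF wf(1)[of "phi_gen n"]] X_closed[OF wf(1)[of "delta_gen n"]]
          x_closed[of Mu 2 0] mu_power_well_formed[of "p - 1"]
        by (simp add: Z_Comp[of mu_gen] Z_simps z_Mu P.comp_zero_left minus parity_sign_simps cbv_signature_def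
            del: op_eval.simps(6)) simp
      have "?Z (Comp (?U (delta_gen n)) p ?M) = - ?X (Comp (?U (phi_gen n)) p ?M)"
        using U X_closed[OF wf(2)[of "phi_gen n"]] X_closed[OF wf(2)[of "delta_gen n"]] mu_X[of "q - 1"]
          mu_power_well_formed[of "q - 1"] mu_power_well_formed[of "p - 1"]
        by (subst Z_Comp) (simp add: Z_mu P.comp_zero_right minus del: op_eval.simps(6), simp)
      then show ?thesis using False by (simp add: diff_op_term_def)
    qed
  qed
  have term_wf: "well_formed cbv_signature (diff_op_term (phi_gen n) p q)" if "1 \<le> n" for n p q
    using that mu_power_well_formed by (auto simp: diff_op_term_def cbv_signature_def)
  have term_arity: "arity (diff_op_term (phi_gen n) p q) = arity (diff_op_term (delta_gen n) p q)"
    "deg (diff_op_term (phi_gen n) p q) = deg (diff_op_term (delta_gen n) p q) - 1" for n p q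
    by (simp_all add: diff_op_term_def)
  have X_term_zero: "?X (diff_op_term (phi_gen n) p q) = 0" if n: "2 \<le> n" for n p q
  proof -
    have T: "?X (Comp (phi_gen n) 0 (mu_power (p - 1))) = 0"
      using mu_X[of "p - 1"] mu_power_well_formed[of "p - 1"] phi[OF n] by (simp add: P.comp_zero_left)
    then show ?thesis
      using mu_X[of "q - 1"] mu_power_well_formed[of "p - 1"] mu_power_well_formed[of "q - 1"] x_closed[of Mu 2 0]
      by (cases q) (simp_all add: diff_op_term_def P.comp_zero_left P.comp_zero_right cbv_signature_def)
  qed
  have Z_order: "?Z (diff_op_expr (n + 1) (delta_gen n)) = 0"
    if n: "1 \<le> n" and wf: "well_formed cbv_signature (diff_op_expr (n + 1) (delta_gen n))" for n
  proof -
    define Ss where "Ss = filter (\<lambda>S. S \<noteq> []) (subseqs [0..<n + 2])"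
    define perm where "perm S = list_perm (S @ list_minus [0..<n + 2] S)" for S
    define trm where "trm D S = diff_op_term D (length S) (length (list_minus [0..<n + 2] S))" for D S
    have expr: "diff_op_expr (n + 1) D = expr_sum (n + 2) (deg D)
        (map (\<lambda>S. Scale ((-1) ^ length S) (Act (perm S) (trm D S))) Ss)" for D
      by (simp add: diff_op_expr_def Let_def Ss_def perm_def trm_def del: upt_Suc)
    have permutes: "perm S permutes {..<arity (trm (delta_gen n) S)}" if "S \<in> set Ss" for S
      using expr_sum_well_formedD[OF wf[unfolded expr], of "Scale ((-1) ^ length S) (Act (perm S) (trm (delta_gen n) S))"] that
      by auto
    have act: "?Z (Act (perm S) (trm (delta_gen n) S)) = - ?X (Act (perm S) (trm (phi_gen n) S))"
      if "S \<in> set Ss" for S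
    proof -
      have "?Z (Act (perm S) (trm (delta_gen n) S)) =
          pact P (arity (trm (phi_gen n) S)) (deg (trm (phi_gen n) S)) (perm S) (- ?X (trm (phi_gen n) S))"
        by (simp only: trm_def Z_Act Z_term[OF n] term_arity)
      also have "\<dots> = - pact P (arity (trm (phi_gen n) S)) (deg (trm (phi_gen n) S)) (perm S) (?X (trm (phi_gen n) S))"
        using permutes[OF that] term_wf[OF n] by (intro P.act_minus X_closed) (simp_all only: trm_def term_arity)
      finally show ?thesis by (simp only: op_eval.simps)
    qed
    have "?Z (diff_op_expr (n + 1) (delta_gen n)) = - ?X (diff_op_expr (n + 1) (phi_gen n))"
      unfolding expr Z_expr_sum op_eval_expr_sum using act
      by (simp add: comp_def Z_simps uminus_sum_list_map cong: map_cong)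
    also have "?X (diff_op_expr (n + 1) (phi_gen n)) = 0"
    proof (cases "n = 1")
      case True
      then show ?thesis using order by (simp add: numeral_2_eq_2)
    next
      case False
      have "?X (Scale ((-1) ^ length S) (Act (perm S) (trm (phi_gen n) S))) = 0" if "S \<in> set Ss" for S
        using permutes[OF that] X_term_zero[of n] n False
        by (simp only: trm_def term_arity op_eval.simps) (simp add: P.act_zero)
      then show ?thesis
        unfolding expr op_eval_expr_sum by (simp add: comp_def cong: map_cong)
    qed
    finally show ?thesis by simp
  qed
  have Z_rel: "?Z s = ?Z t" if "(s, t) \<in> cbv_relations" "well_formed cbv_signature s" for s t
    using that Z_delta Z_order Z_phi x_closed[of Mu 2 0]
    by (auto simp: cbv_relations_def Z_simps Z_Comp Z_Act z_Mu z_Delta Z_Dif P.act_zero P.dif_zero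
        P.comp_zero_left P.comp_zero_right cbv_signature_def)
  have "pdif B 2 0 (b Mu) = 0"
    using presented_by_eval_eq[OF pres, of "Dif mu_gen" "Zero 2 1"]
    by (simp add: cbv_relations_def cbv_signature_def)
  then show ?thesis
    by (intro cocycle_acts_exactly[OF pres cbv_relations_homogeneous _ P hom z_closed _ Z_rel c])
      (use x in \<open>auto simp: v_def cbv_signature_def\<close>)
qed

section \<open>The interior product is a differential operator of order two\<close>

subsection \<open>Signs of rearrangements of lists\<close>

primrec list_sign :: "(nat \<Rightarrow> int) \<Rightarrow> nat list \<Rightarrow> real" where
  "list_sign d [] = 1"
| "list_sign d (x # l) = prod_list (map (\<lambda>y. if y < x then parity_sign (d x * d y) else 1) l) * list_sign d l"

lemma list_sign_cong: "(\<And>x. x \<in> set l \<Longrightarrow> d x = d' x) \<Longrightarrow> list_sign d l = list_sign d' l"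
proof (induction l)
  case (Cons x l)
  then have "map (\<lambda>y. if y < x then parity_sign (d x * d y) else 1) l =
      map (\<lambda>y. if y < x then parity_sign (d' x * d' y) else 1) l"
    by (intro map_cong) auto
  moreover have "list_sign d l = list_sign d' l" using Cons by auto
  ultimately show ?case by (simp only: list_sign.simps Cons.prems list.set_intros)
qed simp

lemma list_sign_double_prod:
  "list_sign d l = (\<Prod>i<length l. \<Prod>j<length l.
     if i < j \<and> l ! j < l ! i then parity_sign (d (l ! i) * d (l ! j)) else 1)"
proof (induction l)
  case (Cons x l)
  have head: "(\<Prod>j<length l. if l ! j < x then parity_sign (d x * d (l ! j)) else 1) =
      prod_list (map (\<lambda>y. if y < x then parity_sign (d x * d y) else 1) l)"
    by (simp add: prod.list_conv_set_nth atLeast0LessThan)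
  show ?case
    by (simp only: length_Cons prod.lessThan_Suc_shift Cons list_sign.simps)
      (simp add: head prod.lessThan_Suc_shift cong: if_cong del: prod.lessThan_Suc)
qed simp

lemma koszul_sign_list:
  assumes "length l = length ds"
  shows "koszul_sign (list_perm l) ds = list_sign ((!) ds) l"
proof -
  let ?n = "length ds"
  have "koszul_sign (list_perm l) ds =
      (\<Prod>(i, j) \<in> {..<?n} \<times> {..<?n}. if i < j \<and> l ! j < l ! i then parity_sign (ds ! (l ! i) * ds ! (l ! j)) else 1)"
    unfolding koszul_sign_def
    by (rule prod.mono_neutral_cong_left) (use assms in \<open>auto simp: list_perm_def split: if_splits\<close>)
  then show ?thesis
    using assms by (simp add: list_sign_double_prod prod.cartesian_product)
qed

abbreviation shuffle_sign :: "nat list \<Rightarrow> real"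
  where "shuffle_sign \<equiv> list_sign (\<lambda>_. 1)"

lemma shuffle_sign_map_Suc: "shuffle_sign (map Suc l) = shuffle_sign l"
  by (induction l) (simp_all add: comp_def)

text \<open>Moving the entry \<open>0\<close> to the front passes the entries of \<open>S\<close>, all of which are larger.\<close>

lemma shuffle_sign_zero: "shuffle_sign (map Suc S @ 0 # map Suc T) = (-1) ^ length S * shuffle_sign (S @ T)"
proof (induction S)
  case Nil
  have "map (\<lambda>y. if y < 0 then parity_sign (1 * 1) else 1) (map Suc T) = map (\<lambda>_. 1) T"
    by simp
  then show ?case by (simp add: shuffle_sign_map_Suc comp_def prod_list_replicate map_replicate_const)
next
  case (Cons x S)
  then show ?case by (simp add: comp_def parity_sign_def)
qed

lemma length_append_list_minus:
  assumes "distinct xs" "S \<in> set (subseqs xs)"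
  shows "length (S @ list_minus xs S) = length xs" "set (S @ list_minus xs S) = set xs"
proof -
  have S: "set S \<subseteq> set xs" "distinct S"
    using assms subseqs_powset[of xs] subseqs_distinctD by auto
  then show s: "set (S @ list_minus xs S) = set xs"
    by (auto simp: list_minus_def)
  have "distinct (S @ list_minus xs S)"
    using S assms by (auto simp: list_minus_def)
  then show "length (S @ list_minus xs S) = length xs"
    using s assms by (metis distinct_card)
qed

subsection \<open>Contraction with a vector field is a derivation\<close>

definition shuffle_term :: "'m form \<Rightarrow> 'm form \<Rightarrow> 'm vfield list \<Rightarrow> nat list \<Rightarrow> nat list \<Rightarrow> 'm \<Rightarrow> real" where
  "shuffle_term \<alpha> \<beta> Xs S T =
     shuffle_sign (S @ T) *\<^sub>R (\<alpha> (map ((!) Xs) S) * \<beta> (map ((!) Xs) T))"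

lemma wedge_shuffle_term:
  "wedge \<alpha> \<beta> Xs = sum_list (map (\<lambda>S. shuffle_term \<alpha> \<beta> Xs S (list_minus [0..<length Xs] S)) (subseqs [0..<length Xs]))"
proof -
  have "koszul_sign (list_perm (S @ list_minus [0..<n] S)) (replicate n 1) = shuffle_sign (S @ list_minus [0..<n] S)"
    if "S \<in> set (subseqs [0..<n])" for S n
  proof -
    note l = length_append_list_minus[OF distinct_upt that]
    have "koszul_sign (list_perm (S @ list_minus [0..<n] S)) (replicate n 1) =
        list_sign ((!) (replicate n 1)) (S @ list_minus [0..<n] S)"
      by (rule koszul_sign_list) (use l in simp)
    also have "\<dots> = shuffle_sign (S @ list_minus [0..<n] S)"
    proof (rule list_sign_cong)
      fix x assume "x \<in> set (S @ list_minus [0..<n] S)"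
      then have "x < n" using l(2) by (metis atLeastLessThan_iff set_upt)
      then show "replicate n 1 ! x = 1" by simp
    qed
    finally show ?thesis .
  qed
  then show ?thesis
    unfolding wedge_def Let_def shuffle_term_def
    by (intro arg_cong[where f = sum_list] map_cong HOL.refl) (simp only:)
qed

lemma subseqs_map: "subseqs (map f xs) = map (map f) (subseqs xs)"
  by (induction xs) (simp_all add: Let_def comp_def)

definition contract :: "'m vfield \<Rightarrow> 'm form \<Rightarrow> 'm form"
  where "contract X \<omega> = (\<lambda>Zs. \<omega> (X # Zs))"

text \<open>The shuffles are split according to whether the first vector field is an argument of \<open>\<alpha>\<close> or of \<open>\<beta>\<close>.\<close>

lemma wedge_Cons:
  "wedge \<alpha> \<beta> (X # Xs) = wedge (contract X \<alpha>) \<beta> Xs +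
     sum_list (map (\<lambda>S. (-1) ^ length S *\<^sub>R shuffle_term \<alpha> (contract X \<beta>) Xs S (list_minus [0..<length Xs] S))
       (subseqs [0..<length Xs]))"
proof -
  let ?n = "length Xs"
  have upt: "[0..<Suc ?n] = 0 # map Suc [0..<?n]"
    by (simp add: upt_conv_Cons map_Suc_upt del: upt_Suc)
  have minus1: "list_minus (0 # map Suc [0..<?n]) (0 # map Suc S) = map Suc (list_minus [0..<?n] S)" for S
    by (simp add: list_minus_def filter_map comp_def inj_image_mem_iff)
  have minus2: "list_minus (0 # map Suc [0..<?n]) (map Suc S) = 0 # map Suc (list_minus [0..<?n] S)" for S
    by (simp add: list_minus_def filter_map comp_def inj_image_mem_iff)
  have term1: "shuffle_term \<alpha> \<beta> (X # Xs) (0 # map Suc S) (map Suc T) = shuffle_term (contract X \<alpha>) \<beta> Xs S T" for S T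
  proof -
    have "map (\<lambda>y. if y < 0 then parity_sign (1 * 1) else 1) (map Suc (S @ T)) = map (\<lambda>_. 1) (S @ T)"
      by simp
    then have "shuffle_sign (0 # map Suc (S @ T)) = shuffle_sign (S @ T)"
      by (simp only: list_sign.simps shuffle_sign_map_Suc) (simp add: map_replicate_const)
    then show ?thesis by (simp add: shuffle_term_def contract_def comp_def del: list_sign.simps)
  qed
  have term2: "shuffle_term \<alpha> \<beta> (X # Xs) (map Suc S) (0 # map Suc T) =
      (-1) ^ length S *\<^sub>R shuffle_term \<alpha> (contract X \<beta>) Xs S T" for S T
    by (simp add: shuffle_term_def contract_def comp_def shuffle_sign_zero)
  show ?thesis
    by (simp only: wedge_shuffle_term list.size(4) add_0_right add_Suc_right One_nat_def upt)
      (simp add: subseqs_map Let_def comp_def minus1 minus2 term1 term2)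
qed

lemma forms_length: "\<omega> \<in> forms A k \<Longrightarrow> length Xs \<noteq> k \<Longrightarrow> \<omega> Xs = 0"
  and forms_fields: "\<omega> \<in> forms A k \<Longrightarrow> \<not> set Xs \<subseteq> vector_fields A \<Longrightarrow> \<omega> Xs = 0"
  by (auto simp: forms_def)

lemma de_rham_sel:
  "cgrp (de_rham A) k = (if 0 \<le> k then forms A (nat k) else {0})"
  "cdif (de_rham A) k = exterior_derivative A"
  by (simp_all add: de_rham_def)

lemma contract_forms:
  assumes X: "X \<in> vector_fields A" and \<omega>: "\<omega> \<in> forms A (Suc k)"
  shows "contract X \<omega> \<in> forms A k"
  unfolding forms_def
proof (intro CollectI conjI allI impI ballI)
  note F = \<omega>[unfolded forms_def, THEN CollectD]
  fix Xs
  show "if length Xs = k \<and> set Xs \<subseteq> vector_fields A then contract X \<omega> Xs \<in> smooth_functions A else contract X \<omega> Xs = 0"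
    using conjunct1[OF F, rule_format, of "X # Xs"] X by (auto simp: contract_def)
  {
    fix i Y Z f assume "f \<in> smooth_functions A" "length Xs = k" "set Xs \<subseteq> vector_fields A" "i < k"
      "Y \<in> vector_fields A" "Z \<in> vector_fields A"
    then show "contract X \<omega> (Xs[i := \<lambda>h. f * Y h + Z h]) = f * contract X \<omega> (Xs[i := Y]) + contract X \<omega> (Xs[i := Z])"
      using conjunct1[OF conjunct2[OF F], rule_format, of f "X # Xs" "Suc i" Y Z] X by (simp add: contract_def)
  next
    fix i j assume "length Xs = k" "i < j" "j < k" "Xs ! i = Xs ! j"
    then show "contract X \<omega> Xs = 0"
      using conjunct2[OF conjunct2[OF F], rule_format, of "X # Xs" "Suc i" "Suc j"] by (simp add: contract_def)
  }
qed

lemma contract_closed: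
  assumes X: "X \<in> vector_fields A" and \<omega>: "\<omega> \<in> cgrp (de_rham A) k"
  shows "contract X \<omega> \<in> cgrp (de_rham A) (k - 1)"
proof (cases "1 \<le> k")
  case True
  then show ?thesis using contract_forms[OF X, of \<omega> "nat (k - 1)"] \<omega> by (simp add: de_rham_sel Suc_nat_eq_nat_zadd1)
next
  case False
  then have "contract X \<omega> = 0"
    using \<omega> forms_length[of \<omega> A 0] by (auto simp: de_rham_sel contract_def fun_eq_iff split: if_splits)
  then show ?thesis using False by (simp add: de_rham_sel)
qed

lemma scaleR_sum_list: "c *\<^sub>R sum_list (map f xs) = sum_list (map (\<lambda>x. c *\<^sub>R f x) xs)"
  for f :: "'a \<Rightarrow> 'b::real_vector"
  by (induction xs) (simp_all add: scaleR_add_right)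

text \<open>In the second sum of \<open>wedge_Cons\<close>, a form of degree \<open>k\<close> only sees the shuffles with \<open>length S = k\<close>; this
  turns the signs into a constant.\<close>

lemma contract_wedge:
  assumes \<alpha>: "\<alpha> \<in> cgrp (de_rham A) k"
  shows "contract X (wedge \<alpha> \<beta>) = wedge (contract X \<alpha>) \<beta> + parity_sign k *\<^sub>R wedge \<alpha> (contract X \<beta>)"
proof
  fix Xs
  have "(-1) ^ length S *\<^sub>R shuffle_term \<alpha> (contract X \<beta>) Xs S T =
      parity_sign k *\<^sub>R shuffle_term \<alpha> (contract X \<beta>) Xs S T" for S T
  proof (cases "int (length S) = k")
    case True
    then have "(-1) ^ length S = parity_sign k" by (auto simp: parity_sign_def)
    then show ?thesis by simp
  next
    case False
    then have "\<alpha> (map ((!) Xs) S) = 0"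
      using \<alpha> forms_length[of \<alpha> A "nat k"] by (auto simp: de_rham_sel split: if_splits)
    then show ?thesis by (simp add: shuffle_term_def)
  qed
  then have "contract X (wedge \<alpha> \<beta>) Xs = wedge (contract X \<alpha>) \<beta> Xs + sum_list (map (\<lambda>S. parity_sign k *\<^sub>R
      shuffle_term \<alpha> (contract X \<beta>) Xs S (list_minus [0..<length Xs] S)) (subseqs [0..<length Xs]))"
    by (simp only: contract_def[of X "wedge \<alpha> \<beta>"] wedge_Cons)
  also have "\<dots> = wedge (contract X \<alpha>) \<beta> Xs + parity_sign k *\<^sub>R wedge \<alpha> (contract X \<beta>) Xs"
    by (simp only: wedge_shuffle_term[of \<alpha>] scaleR_sum_list)
  finally show "contract X (wedge \<alpha> \<beta>) Xs =
      (wedge (contract X \<alpha>) \<beta> + parity_sign k *\<^sub>R wedge \<alpha> (contract X \<beta>)) Xs"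
    by (simp only: plus_fun_apply scaleR_fun_def)
qed

subsection \<open>Compositions of two derivations\<close>

text \<open>The difference $D(uv)-D(u)v-u\,D(v)$ is a sum of products of a first derivative of $u$ and one of $v$,
  hence a derivation in either argument, up to signs. Expanding all terms and sorting the factors into the order $a$, $b$, $c$ leaves
  nothing.\<close>

lemma composite_of_derivations_order_two:
  fixes mult :: "'v::real_vector \<Rightarrow> 'v \<Rightarrow> 'v" (infixl "\<star>" 70) and C :: "int \<Rightarrow> 'v set"
    and \<iota> \<kappa> :: "'v \<Rightarrow> 'v"
  assumes add_left: "\<And>u v w. (u + v) \<star> w = u \<star> w + v \<star> w" and add_right: "\<And>u v w. w \<star> (u + v) = w \<star> u + w \<star> v"
    and scale_left: "\<And>r u v. (r *\<^sub>R u) \<star> v = r *\<^sub>R (u \<star> v)" and scale_right: "\<And>r u v. u \<star> (r *\<^sub>R v) = r *\<^sub>R (u \<star> v)"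
    and closed: "\<And>u v k l. u \<in> C k \<Longrightarrow> v \<in> C l \<Longrightarrow> u \<star> v \<in> C (k + l)"
    and comm: "\<And>u v k l. u \<in> C k \<Longrightarrow> v \<in> C l \<Longrightarrow> v \<star> u = parity_sign (k * l) *\<^sub>R (u \<star> v)"
    and assoc: "\<And>u v w k l m. u \<in> C k \<Longrightarrow> v \<in> C l \<Longrightarrow> w \<in> C m \<Longrightarrow> (u \<star> v) \<star> w = u \<star> (v \<star> w)"
    and \<iota>: "\<And>u v. \<iota> (u + v) = \<iota> u + \<iota> v" "\<And>r u. \<iota> (r *\<^sub>R u) = r *\<^sub>R \<iota> u" "\<And>u k. u \<in> C k \<Longrightarrow> \<iota> u \<in> C (k - 1)"
      "\<And>u v k. u \<in> C k \<Longrightarrow> \<iota> (u \<star> v) = \<iota> u \<star> v + parity_sign k *\<^sub>R (u \<star> \<iota> v)"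
    and \<kappa>: "\<And>u k. u \<in> C k \<Longrightarrow> \<kappa> u \<in> C (k - 1)"
      "\<And>u v k. u \<in> C k \<Longrightarrow> \<kappa> (u \<star> v) = \<kappa> u \<star> v + parity_sign k *\<^sub>R (u \<star> \<kappa> v)"
    and a: "a \<in> C p" and b: "b \<in> C q" and c: "c \<in> C r"
  defines "D \<equiv> \<lambda>u. \<iota> (\<kappa> u)"
  shows "D ((a \<star> b) \<star> c) = D (a \<star> b) \<star> c + parity_sign (q * r) *\<^sub>R (D (a \<star> c) \<star> b) +
      (parity_sign (p * q) * parity_sign (p * r)) *\<^sub>R (D (b \<star> c) \<star> a) - D a \<star> (b \<star> c) -
      parity_sign (p * q) *\<^sub>R (D b \<star> (a \<star> c)) - (parity_sign (p * r) * parity_sign (q * r)) *\<^sub>R (D c \<star> (a \<star> b))"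
proof -
  have D_closed: "D u \<in> C (k - 2)" if "u \<in> C k" for u k
    using \<iota>(3)[OF \<kappa>(1)[OF that]] by (simp add: D_def)
  have parity2: "parity_sign ((k - 2) * l) = parity_sign (k * l)" "parity_sign (l * (k - 2)) = parity_sign (l * k)" for k l
    by (auto simp: parity_sign_def)
  have second_order: "D (u \<star> v) = D u \<star> v - parity_sign k *\<^sub>R (\<kappa> u \<star> \<iota> v) + parity_sign k *\<^sub>R (\<iota> u \<star> \<kappa> v) + u \<star> D v"
    if "u \<in> C k" for u v k
    by (simp add: D_def \<kappa>(2)[OF that] \<iota>(1,2) \<iota>(4)[OF that] \<iota>(4)[OF \<kappa>(1)[OF that]] parity_sign_simps scaleR_add_right)
  have swap_last: "(u \<star> w) \<star> v = parity_sign (j * l) *\<^sub>R (u \<star> (v \<star> w))"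
    if "u \<in> C i" "v \<in> C j" "w \<in> C l" for u v w i j l
    using assoc[OF that(1,3,2)] comm[OF that(2,3)] by (simp add: scale_right)
  have rotate: "(v \<star> w) \<star> u = (parity_sign (i * j) * parity_sign (i * l)) *\<^sub>R (u \<star> (v \<star> w))"
    if "u \<in> C i" "v \<in> C j" "w \<in> C l" for u v w i j l
    using comm[OF that(1) closed[OF that(2,3)]] by (simp add: distrib_left parity_sign_simps)
  have swap_first: "v \<star> (u \<star> w) = parity_sign (i * j) *\<^sub>R (u \<star> (v \<star> w))"
    if "u \<in> C i" "v \<in> C j" "w \<in> C l" for u v w i j l
    using assoc[OF that(2,1,3)] assoc[OF that] comm[OF that(1,2)] by (simp add: scale_left)
  have rotate': "w \<star> (u \<star> v) = (parity_sign (i * l) * parity_sign (j * l)) *\<^sub>R (u \<star> (v \<star> w))"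
    if "u \<in> C i" "v \<in> C j" "w \<in> C l" for u v w i j l
    using comm[OF closed[OF that(1,2)] that(3)] assoc[OF that] by (simp add: distrib_right parity_sign_simps)
  note Da = D_closed[OF a] and Db = D_closed[OF b] and Dc = D_closed[OF c]
  note a1 = \<iota>(3)[OF a] and b1 = \<iota>(3)[OF b] and c1 = \<iota>(3)[OF c]
  note a2 = \<kappa>(1)[OF a] and b2 = \<kappa>(1)[OF b] and c2 = \<kappa>(1)[OF c]
  have ab_c: "D (a \<star> b) \<star> c = D a \<star> (b \<star> c) - parity_sign p *\<^sub>R (\<kappa> a \<star> (\<iota> b \<star> c)) + parity_sign p *\<^sub>R (\<iota> a \<star> (\<kappa> b \<star> c)) + a \<star> (D b \<star> c)"
    using scale_left[of "-1"] unfolding second_order[OF a]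
    by (simp add: add_left scale_left diff_conv_add_uminus assoc[OF Da b c] assoc[OF a2 b1 c] assoc[OF a1 b2 c] assoc[OF a Db c]
        del: add_uminus_conv_diff)
  have minus_left: "(u - v) \<star> w = u \<star> w - v \<star> w" for u v w
    using add_left[of "u - v" v w] by simp
  have ac_b: "parity_sign (q * r) *\<^sub>R (D (a \<star> c) \<star> b) = D a \<star> (b \<star> c) - (parity_sign p * parity_sign q) *\<^sub>R (\<kappa> a \<star> (b \<star> \<iota> c)) +
      (parity_sign p * parity_sign q) *\<^sub>R (\<iota> a \<star> (b \<star> \<kappa> c)) + a \<star> (b \<star> D c)"
    unfolding second_order[OF a]
    by (simp add: add_left minus_left scale_left swap_last[OF Da b c] swap_last[OF a2 b c1] swap_last[OF a1 b c2]
        swap_last[OF a b Dc] parity2 parity_sign_simps scaleR_add_right scaleR_diff_right ac_simps)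
  have bc_a: "(parity_sign (p * q) * parity_sign (p * r)) *\<^sub>R (D (b \<star> c) \<star> a) = a \<star> (D b \<star> c) - parity_sign q *\<^sub>R (a \<star> (\<kappa> b \<star> \<iota> c)) +
      parity_sign q *\<^sub>R (a \<star> (\<iota> b \<star> \<kappa> c)) + a \<star> (b \<star> D c)"
    unfolding second_order[OF b]
    by (simp add: add_left minus_left scale_left rotate[OF a Db c] rotate[OF a b2 c1] rotate[OF a b1 c2]
        rotate[OF a b Dc] parity2 parity_sign_simps scaleR_add_right scaleR_diff_right ac_simps)
  have "D ((a \<star> b) \<star> c) = D (a \<star> b) \<star> c - (parity_sign p * parity_sign q) *\<^sub>R (\<kappa> a \<star> (b \<star> \<iota> c) + parity_sign p *\<^sub>R (a \<star> (\<kappa> b \<star> \<iota> c))) +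
      (parity_sign p * parity_sign q) *\<^sub>R (\<iota> a \<star> (b \<star> \<kappa> c) + parity_sign p *\<^sub>R (a \<star> (\<iota> b \<star> \<kappa> c))) + a \<star> (b \<star> D c)"
    unfolding second_order[OF closed[OF a b]]
    by (simp add: parity2 parity_sign_simps \<iota>(4)[OF a] \<kappa>(2)[OF a] add_left scale_left assoc[OF a2 b c1] assoc[OF a b2 c1]
        assoc[OF a1 b c2] assoc[OF a b1 c2] assoc[OF a b Dc])
  moreover have "parity_sign (p * q) *\<^sub>R (D b \<star> (a \<star> c)) = a \<star> (D b \<star> c)"
    by (simp add: swap_first[OF a Db c] parity2 parity_sign_simps ac_simps)
  moreover have "(parity_sign (p * r) * parity_sign (q * r)) *\<^sub>R (D c \<star> (a \<star> b)) = a \<star> (b \<star> D c)"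
    by (simp add: rotate'[OF a b Dc] parity2 parity_sign_simps ac_simps)
  ultimately show ?thesis
    unfolding ac_b bc_a by (simp add: scaleR_add_right parity2 parity_sign_simps ac_simps)
qed

lemma wedge_bilinear:
  "wedge (\<alpha> + \<alpha>') \<beta> = wedge \<alpha> \<beta> + wedge \<alpha>' \<beta>" "wedge \<beta> (\<alpha> + \<alpha>') = wedge \<beta> \<alpha> + wedge \<beta> \<alpha>'"
  "wedge (\<lambda>Zs. f * \<alpha> Zs) \<beta> = (\<lambda>Zs. f * wedge \<alpha> \<beta> Zs)"
  "wedge (r *\<^sub>R \<alpha>) \<beta> = r *\<^sub>R wedge \<alpha> \<beta>" "wedge \<alpha> (r *\<^sub>R \<beta>) = r *\<^sub>R wedge \<alpha> \<beta>"
proof -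
  have sum_add: "sum_list (map (\<lambda>S. F S + G S) Ss) = sum_list (map F Ss) + sum_list (map G Ss)"
    for F G :: "nat list \<Rightarrow> 'm \<Rightarrow> real" and Ss
    by (induction Ss) (simp_all add: algebra_simps)
  have sum_mult: "sum_list (map (\<lambda>S. g * F S) Ss) = g * sum_list (map F Ss)"
    for g :: "'m \<Rightarrow> real" and F and Ss :: "nat list list"
    by (induction Ss) (simp_all add: algebra_simps)
  have terms: "shuffle_term (\<alpha> + \<alpha>') \<beta> Xs S T = shuffle_term \<alpha> \<beta> Xs S T + shuffle_term \<alpha>' \<beta> Xs S T"
    "shuffle_term \<beta> (\<alpha> + \<alpha>') Xs S T = shuffle_term \<beta> \<alpha> Xs S T + shuffle_term \<beta> \<alpha>' Xs S T"
    "shuffle_term (\<lambda>Zs. f * \<alpha> Zs) \<beta> Xs S T = f * shuffle_term \<alpha> \<beta> Xs S T"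
    "shuffle_term (r *\<^sub>R \<alpha>) \<beta> Xs S T = r *\<^sub>R shuffle_term \<alpha> \<beta> Xs S T"
    "shuffle_term \<alpha> (r *\<^sub>R \<beta>) Xs S T = r *\<^sub>R shuffle_term \<alpha> \<beta> Xs S T" for Xs S T
    by (rule ext; simp add: shuffle_term_def scaleR_fun_def algebra_simps)+
  show "wedge (\<alpha> + \<alpha>') \<beta> = wedge \<alpha> \<beta> + wedge \<alpha>' \<beta>" "wedge \<beta> (\<alpha> + \<alpha>') = wedge \<beta> \<alpha> + wedge \<beta> \<alpha>'"
    "wedge (\<lambda>Zs. f * \<alpha> Zs) \<beta> = (\<lambda>Zs. f * wedge \<alpha> \<beta> Zs)"
    by (rule ext; simp only: wedge_shuffle_term terms sum_add sum_mult plus_fun_apply)+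
  show "wedge (r *\<^sub>R \<alpha>) \<beta> = r *\<^sub>R wedge \<alpha> \<beta>" "wedge \<alpha> (r *\<^sub>R \<beta>) = r *\<^sub>R wedge \<alpha> \<beta>"
    by (rule ext; simp only: wedge_shuffle_term terms scaleR_sum_list[symmetric] scaleR_fun_def[of r "wedge \<alpha> \<beta>"])+
qed

subsection \<open>Interior products with bivector fields\<close>

text \<open>The condition on differential operators of order $\leq2$ on three homogeneous forms, for operators of even
  degree, with the Koszul signs of the shuffles written out and solved for the term $D(abc)$.\<close>

definition order_two :: "('m, 'e::real_normed_vector) atlas \<Rightarrow> ('m form \<Rightarrow> 'm form) \<Rightarrow> bool" where
  "order_two A D \<longleftrightarrow> (\<forall>p q r. \<forall>a\<in>cgrp (de_rham A) p. \<forall>b\<in>cgrp (de_rham A) q. \<forall>c\<in>cgrp (de_rham A) r.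
     D (wedge (wedge a b) c) = wedge (D (wedge a b)) c + parity_sign (q * r) *\<^sub>R wedge (D (wedge a c)) b +
       (parity_sign (p * q) * parity_sign (p * r)) *\<^sub>R wedge (D (wedge b c)) a - wedge (D a) (wedge b c) -
       parity_sign (p * q) *\<^sub>R wedge (D b) (wedge a c) -
       (parity_sign (p * r) * parity_sign (q * r)) *\<^sub>R wedge (D c) (wedge a b))"

lemma order_two_add:
  assumes "order_two A D" "order_two A D'"
  shows "order_two A (\<lambda>\<omega>. D \<omega> + D' \<omega>)"
  unfolding order_two_def
proof (intro allI ballI)
  fix p q r a b c
  assume abc: "a \<in> cgrp (de_rham A) p" "b \<in> cgrp (de_rham A) q" "c \<in> cgrp (de_rham A) r"
  show "D (wedge (wedge a b) c) + D' (wedge (wedge a b) c) = wedge (D (wedge a b) + D' (wedge a b)) c +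
      parity_sign (q * r) *\<^sub>R wedge (D (wedge a c) + D' (wedge a c)) b +
      (parity_sign (p * q) * parity_sign (p * r)) *\<^sub>R wedge (D (wedge b c) + D' (wedge b c)) a -
      wedge (D a + D' a) (wedge b c) - parity_sign (p * q) *\<^sub>R wedge (D b + D' b) (wedge a c) -
      (parity_sign (p * r) * parity_sign (q * r)) *\<^sub>R wedge (D c + D' c) (wedge a b)"
    using assms[unfolded order_two_def, rule_format, OF abc] by (simp add: wedge_bilinear scaleR_add_right)
qed

lemma order_two_mult:
  assumes "order_two A D"
  shows "order_two A (\<lambda>\<omega> Zs. f * D \<omega> Zs)"
  using assms unfolding order_two_def
  by (simp add: wedge_bilinear) (simp add: fun_eq_iff scaleR_fun_def algebra_simps)

lemma order_two_zero:
  fixes A :: "('m, 'e::real_normed_vector) atlas"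
  shows "order_two A (\<lambda>\<omega>. 0)"
proof -
  have "wedge 0 \<beta> = 0" for \<beta> :: "'m form"
    using wedge_bilinear(4)[of 0 0 \<beta>] by simp
  then show ?thesis by (simp add: order_two_def)
qed

lemma append_forms:
  assumes \<omega>: "\<omega> \<in> forms A k" and Zs: "length Zs + l = k" "set Zs \<subseteq> vector_fields A"
  shows "(\<lambda>Ys. \<omega> (Ys @ Zs)) \<in> forms A l"
  unfolding forms_def
proof (intro CollectI conjI allI impI ballI)
  note F = \<omega>[unfolded forms_def, THEN CollectD]
  fix Xs
  show "if length Xs = l \<and> set Xs \<subseteq> vector_fields A then \<omega> (Xs @ Zs) \<in> smooth_functions A else \<omega> (Xs @ Zs) = 0"
    using conjunct1[OF F, rule_format, of "Xs @ Zs"] Zs by (auto split: if_splits)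
  {
    fix i Y Z f assume "f \<in> smooth_functions A" "length Xs = l" "set Xs \<subseteq> vector_fields A" "i < l"
      "Y \<in> vector_fields A" "Z \<in> vector_fields A"
    then show "\<omega> (Xs[i := \<lambda>h. f * Y h + Z h] @ Zs) = f * \<omega> (Xs[i := Y] @ Zs) + \<omega> (Xs[i := Z] @ Zs)"
      using conjunct1[OF conjunct2[OF F], rule_format, of f "Xs @ Zs" i Y Z] Zs by (simp add: list_update_append1)
  next
    fix i j assume "length Xs = l" "i < j" "j < l" "Xs ! i = Xs ! j"
    then show "\<omega> (Xs @ Zs) = 0"
      using conjunct2[OF conjunct2[OF F], rule_format, of "Xs @ Zs" i j] Zs by (simp add: nth_append)
  }
qed

text \<open>A bivector field is a functional on \<open>2\<close>-forms extended by zero. In degrees where partial evaluation of \<open>\<omega>\<close>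
  does not give a \<open>2\<close>-form, the contractions vanish as well.\<close>

lemma interior_bivector:
  assumes \<pi>: "\<pi> = sum_list (map (\<lambda>(f, Xs) \<omega>. f * vf_product A Xs \<omega>) ts)"
    and ts: "\<forall>(f, Xs)\<in>set ts. f \<in> smooth_functions A \<and> length Xs = 2 \<and> set Xs \<subseteq> vector_fields A"
    and \<omega>: "\<omega> \<in> cgrp (de_rham A) k"
  shows "interior \<pi> \<omega> = sum_list (map (\<lambda>(f, Xs) Zs. f * contract (Xs ! 0) (contract (Xs ! 1) \<omega>) Zs) ts)"
proof
  fix Zs
  have vf: "vf_product A Xs (\<lambda>Ys. \<omega> (Ys @ Zs)) = contract (Xs ! 0) (contract (Xs ! 1) \<omega>) Zs"
    if Xs: "length Xs = 2" "set Xs \<subseteq> vector_fields A" for Xs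
  proof -
    obtain X Y where XY: "Xs = [X, Y]"
      using Xs(1) by (auto simp: length_Suc_conv numeral_2_eq_2)
    show ?thesis
    proof (cases "0 \<le> k \<and> length Zs + 2 = nat k \<and> set Zs \<subseteq> vector_fields A")
      case True
      then show ?thesis
        using append_forms[of \<omega> A "nat k" Zs 2] \<omega> by (simp add: de_rham_sel vf_product_def contract_def XY numeral_2_eq_2)
    next
      case False
      then have "\<omega> (Y # X # Zs) = 0"
        using \<omega> forms_length[of \<omega> A "nat k" "Y # X # Zs"] forms_fields[of \<omega> A "nat k" "Y # X # Zs"]
        by (auto simp: de_rham_sel split: if_splits)
      then show ?thesis by (simp add: vf_product_def contract_def XY)
    qed
  qed
  show "interior \<pi> \<omega> Zs = sum_list (map (\<lambda>(f, Xs) Zs. f * contract (Xs ! 0) (contract (Xs ! 1) \<omega>) Zs) ts) Zs"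
    unfolding interior_def \<pi> using ts by (induction ts) (auto simp: vf)
qed

lemma contract_linear:
  "contract X (\<alpha> + \<beta>) = contract X \<alpha> + contract X \<beta>" "contract X (s *\<^sub>R \<alpha>) = s *\<^sub>R contract X \<alpha>"
  by (simp_all add: contract_def fun_eq_iff scaleR_fun_def)

text \<open>The condition is linear over functions in the operator, so it suffices to treat decomposable
  bivector fields, whose interior product is a composition of two contractions.\<close>

lemma order_two_interior:
  assumes \<pi>: "\<pi> \<in> polyvectors A 2"
    and closed: "\<And>u v k l. u \<in> cgrp (de_rham A) k \<Longrightarrow> v \<in> cgrp (de_rham A) l \<Longrightarrow> wedge u v \<in> cgrp (de_rham A) (k + l)"
    and comm: "\<And>u v k l. u \<in> cgrp (de_rham A) k \<Longrightarrow> v \<in> cgrp (de_rham A) l \<Longrightarrow>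
      wedge v u = parity_sign (k * l) *\<^sub>R wedge u v"
    and assoc: "\<And>u v w k l m. u \<in> cgrp (de_rham A) k \<Longrightarrow> v \<in> cgrp (de_rham A) l \<Longrightarrow> w \<in> cgrp (de_rham A) m \<Longrightarrow>
      wedge (wedge u v) w = wedge u (wedge v w)"
  shows "order_two A (interior \<pi>)"
proof -
  obtain ts where ts: "\<pi> = sum_list (map (\<lambda>(f, Xs) \<omega>. f * vf_product A Xs \<omega>) ts)"
    "\<forall>(f, Xs)\<in>set ts. f \<in> smooth_functions A \<and> length Xs = 2 \<and> set Xs \<subseteq> vector_fields A"
    using \<pi> unfolding polyvectors_def by blast
  have pair: "order_two A (\<lambda>\<omega>. contract X (contract Y \<omega>))" if X: "X \<in> vector_fields A" and Y: "Y \<in> vector_fields A" for X Y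
    unfolding order_two_def
  proof (intro allI ballI)
    fix p q r a b c
    assume abc: "a \<in> cgrp (de_rham A) p" "b \<in> cgrp (de_rham A) q" "c \<in> cgrp (de_rham A) r"
    show "contract X (contract Y (wedge (wedge a b) c)) = wedge (contract X (contract Y (wedge a b))) c +
       parity_sign (q * r) *\<^sub>R wedge (contract X (contract Y (wedge a c))) b +
       (parity_sign (p * q) * parity_sign (p * r)) *\<^sub>R wedge (contract X (contract Y (wedge b c))) a -
       wedge (contract X (contract Y a)) (wedge b c) -
       parity_sign (p * q) *\<^sub>R wedge (contract X (contract Y b)) (wedge a c) -
       (parity_sign (p * r) * parity_sign (q * r)) *\<^sub>R wedge (contract X (contract Y c)) (wedge a b)"
      by (rule composite_of_derivations_order_two[where C = "cgrp (de_rham A)" and mult = wedge and \<iota> = "contract X" and \<kappa> = "contract Y",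
        OF wedge_bilinear(1,2,4,5) closed comm assoc
        contract_linear contract_closed[OF X] contract_wedge contract_closed[OF Y] contract_wedge abc])
  qed
  have "order_two A (\<lambda>\<omega>. sum_list (map (\<lambda>(f, Xs) Zs. f * contract (Xs ! 0) (contract (Xs ! 1) \<omega>) Zs) ts))"
    using ts(2)
  proof (induction ts)
    case Nil
    show ?case using order_two_zero[of A] by (simp add: zero_fun_def)
  next
    case (Cons t ts)
    obtain f Xs where t: "t = (f, Xs)" by (cases t)
    have "Xs ! 0 \<in> vector_fields A" "Xs ! 1 \<in> vector_fields A"
      using Cons.prems t nth_mem[of 0 Xs] nth_mem[of 1 Xs] by auto
    then have f: "order_two A (\<lambda>\<omega> Zs. f * contract (Xs ! 0) (contract (Xs ! 1) \<omega>) Zs)"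
      by (rule order_two_mult[OF pair])
    show ?case
      unfolding t list.map sum_list.Cons prod.case
      by (rule order_two_add[OF f Cons.IH]) (use Cons.prems in simp)
  qed
  note sum = this[unfolded order_two_def, rule_format]
  show ?thesis
    unfolding order_two_def
  proof (intro allI ballI)
    fix p q r a b c
    assume abc: "a \<in> cgrp (de_rham A) p" "b \<in> cgrp (de_rham A) q" "c \<in> cgrp (de_rham A) r"
    note expand = interior_bivector[OF ts abc(1)] interior_bivector[OF ts abc(2)] interior_bivector[OF ts abc(3)]
      interior_bivector[OF ts closed[OF abc(1,2)]] interior_bivector[OF ts closed[OF abc(1,3)]]
      interior_bivector[OF ts closed[OF abc(2,3)]] interior_bivector[OF ts closed[OF closed[OF abc(1,2)] abc(3)]]
    show "interior \<pi> (wedge (wedge a b) c) = wedge (interior \<pi> (wedge a b)) c +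
       parity_sign (q * r) *\<^sub>R wedge (interior \<pi> (wedge a c)) b +
       (parity_sign (p * q) * parity_sign (p * r)) *\<^sub>R wedge (interior \<pi> (wedge b c)) a - wedge (interior \<pi> a) (wedge b c) -
       parity_sign (p * q) *\<^sub>R wedge (interior \<pi> b) (wedge a c) -
       (parity_sign (p * r) * parity_sign (q * r)) *\<^sub>R wedge (interior \<pi> c) (wedge a b)"
      unfolding expand by (rule sum[OF abc])
  qed
qed

section \<open>Evaluation in the endomorphism operad of the de Rham complex\<close>

lemma endomorphism_operad_sel:
  "ops (endomorphism_operad V) = end_ops V"
  "opunit (endomorphism_operad V) = restrict_op V 1 (\<lambda>xs. snd (hd xs))"
  "pcomp (endomorphism_operad V) n k m l i f g xs =
     parity_sign (l * total_degree (take i xs)) *\<^sub>R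
       f (take i xs @ (total_degree (take m (drop i xs)) + l, g (take m (drop i xs))) # drop (i + m) xs)"
  "pact (endomorphism_operad V) n k \<sigma> f = restrict_op V n (\<lambda>xs.
     koszul_sign \<sigma> (map fst xs) *\<^sub>R f (map (\<lambda>i. xs ! \<sigma> i) [0..<n]))"
  "pdif (endomorphism_operad V) n k f = restrict_op V n (\<lambda>xs.
     cdif V (total_degree xs + k) (f xs) -
     parity_sign k *\<^sub>R (\<Sum>i<n. parity_sign (total_degree (take i xs)) *\<^sub>R
       f (xs[i := (fst (xs ! i) + 1, cdif V (fst (xs ! i)) (snd (xs ! i)))])))"
  by (simp_all add: endomorphism_operad_def Let_def)

lemma end_ops_closed: "f \<in> end_ops V n e \<Longrightarrow> length xs = n \<Longrightarrow> set xs \<subseteq> tagged_elements V \<Longrightarrow>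
    f xs \<in> cgrp V (total_degree xs + e)"
  by (auto simp: end_ops_def split: if_splits)

lemma presented_by_hom_relation:
  assumes B: "presented_by B b G R" and hom: "operad_hom B P f"
    and x: "\<And>g n k. (g, n, k) \<in> G \<Longrightarrow> f n k (b g) = x g"
    and st: "(s, t) \<in> R" "well_formed G s" "well_formed G t" "arity s = arity t" "deg s = deg t"
  shows "op_eval P x s = op_eval P x t"
proof -
  have "b g \<in> ops B n k" if "(g, n, k) \<in> G" for g n k
    using B that by (auto simp: presented_by_def)
  then show ?thesis
    using operad_hom.hom_op_eval[OF hom, where v = b and G = G and w = x] B x st presented_by_eval_eq[OF B st]
    by (metis presented_by_def)
qed

context
  fixes A :: "('m::{t2_space, second_countable_topology}, 'e::real_normed_vector) atlas"
    and \<pi> \<eta> :: "'m polyvector" and B :: "'b::real_vector operad" and b :: "cbv_gen \<Rightarrow> 'b"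
    and \<theta> :: "nat \<Rightarrow> int \<Rightarrow> 'b \<Rightarrow> (int \<times> 'm form) list \<Rightarrow> 'm form"
  assumes B: "cbv_mod_delta_operad B b" and theta: "jacobi_cbv_algebra A \<pi> \<eta> B b \<theta>"
begin

lemma wedge_operation:
  "u \<in> cgrp (de_rham A) k \<Longrightarrow> v \<in> cgrp (de_rham A) l \<Longrightarrow>
     jacobi_operations A \<pi> \<eta> Mu [(k, u), (l, v)] = wedge u v"
  by (auto simp: restrict_op_def tagged_elements_def)

lemma interior_operation:
  "u \<in> cgrp (de_rham A) k \<Longrightarrow> jacobi_operations A \<pi> \<eta> (Phi 1) [(k, u)] = interior \<pi> u"
  by (auto simp: unary_op_def restrict_op_def tagged_elements_def)

lemma unit_operation:
  "u \<in> cgrp (de_rham A) k \<Longrightarrow> opunit (endomorphism_operad (de_rham A)) [(k, u)] = u"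
  by (auto simp: endomorphism_operad_sel restrict_op_def tagged_elements_def)

lemma jacobi_operations_closed:
  assumes "(g, n, k) \<in> cbv_signature"
  shows "jacobi_operations A \<pi> \<eta> g \<in> end_ops (de_rham A) n k"
proof -
  have "b g \<in> ops B n k"
    using B assms by (auto simp: cbv_mod_delta_operad_def presented_by_def)
  then have "\<theta> n k (b g) \<in> end_ops (de_rham A) n k"
    using theta operad_hom.hom_closed by (fastforce simp: jacobi_cbv_algebra_def endomorphism_operad_sel)
  then show ?thesis using theta assms by (auto simp: jacobi_cbv_algebra_def)
qed

lemma wedge_closed:
  assumes "u \<in> cgrp (de_rham A) k" "v \<in> cgrp (de_rham A) l"
  shows "wedge u v \<in> cgrp (de_rham A) (k + l)"
  using end_ops_closed[OF jacobi_operations_closed[of Mu 2 0], of "[(k, u), (l, v)]"] assms wedge_operation[OF assms]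
  by (simp add: cbv_signature_def tagged_elements_def total_degree_def)

lemma interior_closed:
  assumes "u \<in> cgrp (de_rham A) k"
  shows "interior \<pi> u \<in> cgrp (de_rham A) (k - 2)"
  using end_ops_closed[OF jacobi_operations_closed[of "Phi 1" 1 "- 2"], of "[(k, u)]"] assms interior_operation[OF assms]
  by (simp add: cbv_signature_def tagged_elements_def total_degree_def)

lemma cbv_relation_holds:
  assumes "(s, t) \<in> cbv_relations" "well_formed cbv_signature s" "well_formed cbv_signature t" "arity s = arity t" "deg s = deg t"
  shows "op_eval (endomorphism_operad (de_rham A)) (jacobi_operations A \<pi> \<eta>) s =
    op_eval (endomorphism_operad (de_rham A)) (jacobi_operations A \<pi> \<eta>) t"
proof (rule presented_by_hom_relation[OF _ _ _ assms])
  show "presented_by B b cbv_signature cbv_relations" using B by (simp add: cbv_mod_delta_operad_def)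
qed (use theta in \<open>auto simp: jacobi_cbv_algebra_def\<close>)

text \<open>That \<open>\<theta>\<close> is an action already contains associativity and graded commutativity of the wedge product,
  as relations for \<open>\<mu>\<close>; the next two lemmas read them off.\<close>

lemma wedge_assoc:
  assumes "u \<in> cgrp (de_rham A) k" "v \<in> cgrp (de_rham A) l" "w \<in> cgrp (de_rham A) m"
  shows "wedge (wedge u v) w = wedge u (wedge v w)"
proof -
  have "op_eval (endomorphism_operad (de_rham A)) (jacobi_operations A \<pi> \<eta>) (Comp mu_gen 0 mu_gen) =
      op_eval (endomorphism_operad (de_rham A)) (jacobi_operations A \<pi> \<eta>) (Comp mu_gen 1 mu_gen)"
    by (rule cbv_relation_holds) (auto simp: cbv_relations_def cbv_signature_def)
  from fun_cong[OF this, of "[(k, u), (l, v), (m, w)]"] show ?thesis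
    using assms by (simp add: endomorphism_operad_sel total_degree_def wedge_operation wedge_closed parity_sign_simps
        numeral_2_eq_2 del: jacobi_operations.simps)
qed

lemma wedge_commute:
  assumes "u \<in> cgrp (de_rham A) k" "v \<in> cgrp (de_rham A) l"
  shows "wedge v u = parity_sign (k * l) *\<^sub>R wedge u v"
proof -
  have \<sigma>: "list_perm [1, 0] = Transposition.transpose 0 1"
    by (auto simp: list_perm_def Transposition.transpose_def fun_eq_iff nth_Cons')
  have perm: "list_perm [1, 0] permutes {..<2}"
    unfolding \<sigma> by (rule permutes_swap_id) auto
  have "op_eval (endomorphism_operad (de_rham A)) (jacobi_operations A \<pi> \<eta>) (Act (list_perm [1, 0]) mu_gen) =
      op_eval (endomorphism_operad (de_rham A)) (jacobi_operations A \<pi> \<eta>) mu_gen"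
    by (rule cbv_relation_holds) (use perm in \<open>auto simp: cbv_relations_def cbv_signature_def\<close>)
  from fun_cong[OF this, of "[(k, u), (l, v)]"] have "parity_sign (k * l) *\<^sub>R wedge v u = wedge u v"
    using assms by (simp add: endomorphism_operad_sel restrict_op_def tagged_elements_def koszul_sign_list wedge_operation
        numeral_2_eq_2 list_perm_def mult.commute del: jacobi_operations.simps)
  then have "parity_sign (k * l) *\<^sub>R wedge u v = (parity_sign (k * l) * parity_sign (k * l)) *\<^sub>R wedge v u"
    by (metis scaleR_scaleR)
  then show ?thesis by (simp add: parity_sign_simps)
qed

lemma diff_op_term_values:
  assumes u: "u \<in> cgrp (de_rham A) k" and v: "v \<in> cgrp (de_rham A) l" and w: "w \<in> cgrp (de_rham A) m"
  defines "eval \<equiv> op_eval (endomorphism_operad (de_rham A)) (jacobi_operations A \<pi> \<eta>)"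
  shows "eval (diff_op_term (phi_gen 1) 1 2) [(k, u), (l, v), (m, w)] = wedge (interior \<pi> u) (wedge v w)"
    and "eval (diff_op_term (phi_gen 1) 2 1) [(k, u), (l, v), (m, w)] = wedge (interior \<pi> (wedge u v)) w"
    and "eval (diff_op_term (phi_gen 1) 3 0) [(k, u), (l, v), (m, w)] = interior \<pi> (wedge (wedge u v) w)"
  unfolding eval_def using assms(1-3) wedge_closed[OF wedge_closed[OF u v] w]
  by (simp_all add: diff_op_term_def numeral_2_eq_2 numeral_3_eq_3 endomorphism_operad_sel(3) total_degree_def
      parity_sign_simps unit_operation wedge_operation interior_operation[unfolded One_nat_def] wedge_closed interior_closed add.assoc
      del: jacobi_operations.simps)

text \<open>The seven summands correspond to the nonempty subsets of \<open>{0, 1, 2}\<close>; evaluated on three forms, they are the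
  terms of \<open>order_two\<close>.\<close>

lemma interior_order_relation:
  assumes \<pi>: "\<pi> \<in> polyvectors A 2"
  shows "op_eval (endomorphism_operad (de_rham A)) (jacobi_operations A \<pi> \<eta>) (diff_op_expr 2 (phi_gen 1)) = 0"
proof
  let ?V = "de_rham A" and ?eval = "op_eval (endomorphism_operad (de_rham A)) (jacobi_operations A \<pi> \<eta>)"
  define P where "P l D = pact (endomorphism_operad ?V) 3 (- 2) (list_perm l) D" for l D
  let ?T = "\<lambda>p q. ?eval (diff_op_term (phi_gen 1) p q)"
  have expand: "?eval (diff_op_expr 2 (phi_gen 1)) = - P [0, 1, 2] (?T 3 0) + P [0, 1, 2] (?T 2 1) + P [0, 2, 1] (?T 2 1) -
      P [0, 1, 2] (?T 1 2) + P [1, 2, 0] (?T 2 1) - P [1, 0, 2] (?T 1 2) - P [2, 0, 1] (?T 1 2)"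
  proof -
    have upt: "[0..<3] = [0, 1, 2]"
      by (simp add: numeral_3_eq_3 numeral_2_eq_2)
    have subsets: "filter (\<lambda>S. S \<noteq> []) (subseqs [0, 1, 2]) = [[0, 1, 2], [0, 1], [0, 2], [0], [1, 2], [1], [2 :: nat]]"
      by simp
    define t where "t = diff_op_term (phi_gen 1)"
    have t_arity: "arity (t p q) = 3 \<and> deg (t p q) = - 2" if "(p, q) \<in> {(1, 2), (2, 1), (3, 0)}" for p q
      using that mu_power_well_formed by (auto simp: t_def diff_op_term_def)
    have arity: "arity (t 1 2) = 3" "deg (t 1 2) = - 2" "arity (t 2 1) = 3" "deg (t 2 1) = - 2" "arity (t 3 0) = 3" "deg (t 3 0) = - 2"
      using t_arity by auto
    have three: "2 + 1 = (3 :: nat)" and degree: "deg (phi_gen 1) = - 2"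
      by simp_all
    have sizes: "length [x] = 1" "length [x, y] = 2" "length [x, y, z] = 3" for x y z :: nat
      by simp_all
    have complements: "list_minus [0, 1, 2] [0, 1, 2] = []" "list_minus [0, 1, 2] [0, 1] = [2 :: nat]"
      "list_minus [0, 1, 2] [0, 2] = [1 :: nat]" "list_minus [0, 1, 2] [0] = [1, 2 :: nat]" "list_minus [0, 1, 2] [1, 2] = [0 :: nat]"
      "list_minus [0, 1, 2] [1] = [0, 2 :: nat]" "list_minus [0, 1, 2] [2] = [0, 1 :: nat]"
      by (simp_all add: list_minus_def)
    have "diff_op_expr 2 (phi_gen 1) = expr_sum 3 (- 2) (map (\<lambda>S. let T = list_minus [0, 1, 2] S in
        Scale ((-1) ^ length S) (Act (list_perm (S @ T)) (t (length S) (length T))))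
        (filter (\<lambda>S. S \<noteq> []) (subseqs [0, 1, 2])))"
      unfolding diff_op_expr_def three upt t_def degree ..
    also have "\<dots> = expr_sum 3 (- 2) [Scale (- 1) (Act (list_perm [0, 1, 2]) (t 3 0)),
        Scale 1 (Act (list_perm [0, 1, 2]) (t 2 1)), Scale 1 (Act (list_perm [0, 2, 1]) (t 2 1)),
        Scale (- 1) (Act (list_perm [0, 1, 2]) (t 1 2)), Scale 1 (Act (list_perm [1, 2, 0]) (t 2 1)),
        Scale (- 1) (Act (list_perm [1, 0, 2]) (t 1 2)), Scale (- 1) (Act (list_perm [2, 0, 1]) (t 1 2))]"
      unfolding subsets list.map Let_def complements sizes list.size(3) append_Cons append_Nil power_one_right
      by (simp only: power2_minus power3_eq_cube power_one mult_minus_left mult_minus_right mult_1 minus_minus)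
    finally have expr: "diff_op_expr 2 (phi_gen 1) = \<dots>" .
    show ?thesis
      unfolding expr op_eval_expr_sum list.map op_eval.simps arity P_def t_def[symmetric] by simp
  qed
  fix xs
  show "?eval (diff_op_expr 2 (phi_gen 1)) xs = 0 xs"
  proof (cases "length xs = 3 \<and> set xs \<subseteq> tagged_elements ?V")
    case False
    then have "P l D xs = 0" for l D
      unfolding P_def endomorphism_operad_sel(4) restrict_op_def by (rule if_not_P)
    then show ?thesis
      unfolding expand plus_fun_apply minus_apply uminus_apply by (simp add: zero_fun_def)
  next
    case True
    then have "length xs = Suc (Suc (Suc 0))" by simp
    then obtain x y z where "xs = [x, y, z]"
      by (auto simp: length_Suc_conv)
    then obtain p a q b r c where xs: "xs = [(p, a), (q, b), (r, c)]"
      by (cases x, cases y, cases z) simp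
    have abc: "a \<in> cgrp ?V p" "b \<in> cgrp ?V q" "c \<in> cgrp ?V r"
      using True by (auto simp: xs tagged_elements_def)
    have P: "P l D xs = list_sign ((!) [p, q, r]) l *\<^sub>R D (map ((!) xs) l)" if l: "length l = 3" for l D
    proof -
      have "map (\<lambda>i. xs ! list_perm l i) [0..<3] = map ((!) xs) l"
        using l by (intro nth_equalityI) (auto simp: list_perm_def)
      moreover have "map fst xs = [p, q, r]" by (simp add: xs)
      ultimately show ?thesis
        using True l koszul_sign_list[of l "[p, q, r]"] by (simp add: P_def endomorphism_operad_sel(4) restrict_op_def)
    qed
    have P_values: "P [0, 1, 2] (?T 3 0) xs = interior \<pi> (wedge (wedge a b) c)"
      "P [0, 1, 2] (?T 2 1) xs = wedge (interior \<pi> (wedge a b)) c"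
      "P [0, 2, 1] (?T 2 1) xs = parity_sign (r * q) *\<^sub>R wedge (interior \<pi> (wedge a c)) b"
      "P [0, 1, 2] (?T 1 2) xs = wedge (interior \<pi> a) (wedge b c)"
      "P [1, 2, 0] (?T 2 1) xs = (parity_sign (q * p) * parity_sign (r * p)) *\<^sub>R wedge (interior \<pi> (wedge b c)) a"
      "P [1, 0, 2] (?T 1 2) xs = parity_sign (q * p) *\<^sub>R wedge (interior \<pi> b) (wedge a c)"
      "P [2, 0, 1] (?T 1 2) xs = (parity_sign (r * p) * parity_sign (r * q)) *\<^sub>R wedge (interior \<pi> c) (wedge a b)"
      using diff_op_term_values(3)[OF abc] diff_op_term_values(2)[OF abc] diff_op_term_values(2)[OF abc(1,3,2)]
        diff_op_term_values(1)[OF abc] diff_op_term_values(2)[OF abc(2,3,1)] diff_op_term_values(1)[OF abc(2,1,3)]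
        diff_op_term_values(1)[OF abc(3,1,2)]
      by (simp_all add: P[unfolded xs] xs)
    have "order_two A (interior \<pi>)"
    proof (rule order_two_interior[OF \<pi>])
      show "wedge u v \<in> cgrp ?V (k + l)" if "u \<in> cgrp ?V k" "v \<in> cgrp ?V l" for u v k l
        using that by (rule wedge_closed)
      show "wedge v u = parity_sign (k * l) *\<^sub>R wedge u v" if "u \<in> cgrp ?V k" "v \<in> cgrp ?V l" for u v k l
        using that by (rule wedge_commute)
      show "wedge (wedge u v) w = wedge u (wedge v w)"
        if "u \<in> cgrp ?V k" "v \<in> cgrp ?V l" "w \<in> cgrp ?V m" for u v w k l m
        using that by (rule wedge_assoc)
    qed
    from this[unfolded order_two_def, rule_format, OF abc] show ?thesis
      unfolding expand plus_fun_apply minus_apply uminus_apply P_values by (simp add: zero_fun_def mult.commute)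
  qed
qed

end

section \<open>Exact operations vanish on cohomology\<close>

text \<open>The unit operation is multilinear and takes the value $0$ outside the graded pieces. A combination of two
  elements of a piece is the value of the unit operation on it, so it can only lie outside the piece if it is
  $0$; but $0$ lies in the piece as the value of the zero operation.\<close>

lemma algebra_cochains_subspace:
  assumes P: "dg_operad P" and alg: "operad_algebra P V \<theta>" and x: "x \<in> cgrp V k" and y: "y \<in> cgrp V k"
  shows "r *\<^sub>R x + y \<in> cgrp V k"
proof -
  interpret P: dg_operad P by (rule P)
  interpret operad_hom P "endomorphism_operad V" \<theta> by (rule alg)
  let ?u = "opunit (endomorphism_operad V)"
  have u: "?u [(k, z)] = (if z \<in> cgrp V k then z else 0)" for z
    by (auto simp: endomorphism_operad_sel restrict_op_def tagged_elements_def)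
  have "?u \<in> end_ops V 1 0"
    using hom_closed[OF P.unit_closed] by (simp add: hom_unit endomorphism_operad_sel(1) del: One_nat_def)
  then have "?u ([(k, x)][0 := (k, r *\<^sub>R x + y)]) = r *\<^sub>R ?u ([(k, x)][0 := (k, x)]) + ?u ([(k, x)][0 := (k, y)])"
    using x y unfolding end_ops_def by (auto simp: tagged_elements_def simp del: list_update.simps)
  then have unit: "(if r *\<^sub>R x + y \<in> cgrp V k then r *\<^sub>R x + y else 0) = r *\<^sub>R x + y"
    using x y by (simp add: u)
  have "\<theta> 1 0 0 \<in> end_ops V 1 0"
    using hom_closed[OF P.zero_closed] by (simp add: endomorphism_operad_sel(1) del: One_nat_def)
  then have "0 \<in> cgrp V k"
    using end_ops_closed[of 0 V 1 0 "[(k, x)]"] x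
    by (simp add: hom_zero[OF P] tagged_elements_def total_degree_def del: One_nat_def)
  then show ?thesis using unit by (auto split: if_splits)
qed

lemma smooth_functions_zero: "0 \<in> smooth_functions A"
proof -
  have "Ck_on k U (\<lambda>x :: 'e :: real_normed_vector. 0 :: real)" for k U
    by (induction k) (auto simp: frechet_derivative_const)
  then show ?thesis
    by (auto simp: smooth_functions_def smooth_on_def comp_def)
qed

lemma de_rham_zero: "0 \<in> cgrp (de_rham A) k"
  using smooth_functions_zero[of A] by (auto simp: de_rham_sel forms_def)

lemma exterior_derivative_linear:
  assumes x: "x \<in> cgrp (de_rham A) k" and y: "y \<in> cgrp (de_rham A) k"
  shows "exterior_derivative A (r *\<^sub>R x + y) = r *\<^sub>R exterior_derivative A x + exterior_derivative A y"
proof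
  fix Xs
  have smooth: "x Ys \<in> smooth_functions A" "y Ys \<in> smooth_functions A" for Ys
    using x y smooth_functions_zero[of A] by (auto simp: de_rham_sel forms_def split: if_splits)
  have X: "X (r *\<^sub>R x Ys + y Ys) = r *\<^sub>R X (x Ys) + X (y Ys)" if "X \<in> vector_fields A" for X Ys
    using that smooth unfolding vector_fields_def by auto
  show "exterior_derivative A (r *\<^sub>R x + y) Xs = (r *\<^sub>R exterior_derivative A x + exterior_derivative A y) Xs"
  proof (cases "set Xs \<subseteq> vector_fields A")
    case True
    then have "(Xs ! i) (r *\<^sub>R x Ys + y Ys) = r *\<^sub>R (Xs ! i) (x Ys) + (Xs ! i) (y Ys)" if "i < length Xs" for i Ys
      using X nth_mem[OF that] by blast
    then show ?thesis
      using True by (simp add: exterior_derivative_def scaleR_fun_def[of r "_ :: 'a form"] scaleR_add_right scaleR_sum_right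
          sum.distrib scaleR_left_commute case_prod_unfold algebra_simps)
  next
    case False
    then show ?thesis by (simp add: exterior_derivative_def scaleR_fun_def[of r "exterior_derivative A x"])
  qed
qed

lemma presented_by_dif_zero:
  assumes H: "presented_by H m G R"
    and zero: "\<And>g n k. (g, n, k) \<in> G \<Longrightarrow> (Dif (Gen g n k), Zero n (k + 1)) \<in> R"
    and x: "x \<in> ops H n k"
  shows "pdif H n k x = 0"
proof -
  interpret dg_operad H using H by (simp add: presented_by_def)
  obtain s where s: "well_formed G s" "arity s = n" "deg s = k" "op_eval H m s = x"
    using H x unfolding presented_by_def by blast
  have "pdif H (arity s) (deg s) (op_eval H m s) = 0"
  proof (rule dif_op_eval_zero[OF _ _ s(1)])
    show "m g \<in> ops H n k" if "(g, n, k) \<in> G" for g n k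
      using H that by (auto simp: presented_by_def)
    show "pdif H n k (m g) = 0" if "(g, n, k) \<in> G" for g n k
      using presented_by_eval_eq[OF H zero[OF that]] that by simp
  qed
  then show ?thesis using s by simp
qed

text \<open>When the differential of \<open>Q\<close> vanishes, the cohomology classes of \<open>Q\<close> are singletons, so surjectivity on
  cohomology is surjectivity from cocycles.\<close>

lemma quasi_iso_lift_cocycle:
  assumes P: "dg_operad P" and Q: "dg_operad Q" and p: "quasi_iso P Q p"
    and zero: "\<And>n k x. x \<in> ops Q n k \<Longrightarrow> pdif Q n k x = 0" and h: "h \<in> ops Q n k"
  shows "\<exists>c. c \<in> cocycles (arity_complex P n) k \<and> p n k c = h"
proof -
  interpret P: dg_operad P by (rule P)
  interpret Q: dg_operad Q by (rule Q)
  interpret operad_hom P Q p using p by (simp add: quasi_iso_def)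
  have class_Q: "coclass (arity_complex Q n) k x = {x}" if "x \<in> ops Q n k" for x
    using that zero[where n = n] Q.zero_closed[of n "k - 1"] by (auto simp: coclass_def cocycles_def arity_complex_def)
  have self: "x \<in> coclass (arity_complex P n) k x" if "x \<in> cocycles (arity_complex P n) k" for x
    using that P.zero_closed[of n "k - 1"] P.dif_zero[of n "k - 1"]
    by (auto simp: coclass_def arity_complex_def intro!: image_eqI[of 0 _ 0])
  have "{h} \<in> cohomology (arity_complex Q n) k"
    using class_Q[OF h] h zero[OF h] by (auto simp: cohomology_def cocycles_def arity_complex_def intro!: image_eqI[of _ _ h])
  then have "{h} \<in> (\<lambda>X. coclass (arity_complex Q n) k (p n k (SOME x. x \<in> X))) ` cohomology (arity_complex P n) k"
    using p by (simp add: quasi_iso_def bij_betw_def)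
  then obtain X where X: "{h} = coclass (arity_complex Q n) k (p n k (SOME x. x \<in> X))"
    "X \<in> cohomology (arity_complex P n) k"
    by (rule imageE)
  define c where "c = (SOME x. x \<in> X)"
  obtain x where x: "x \<in> cocycles (arity_complex P n) k" "X = coclass (arity_complex P n) k x"
    using X(2) by (auto simp: cohomology_def)
  have "c \<in> X" unfolding c_def using self[OF x(1)] x(2) by (auto intro: someI)
  then have c: "c \<in> cocycles (arity_complex P n) k" using x by (simp add: coclass_def)
  then have "p n k c \<in> ops Q n k" by (intro hom_closed) (simp add: cocycles_def arity_complex_def)
  then have "p n k c = h" using X(1) class_Q by (simp add: c_def)
  with c show ?thesis by blast
qed

context
  fixes A :: "('m::{t2_space, second_countable_topology}, 'e::real_normed_vector) atlas"
    and \<pi> \<eta> :: "'m polyvector" and B :: "'b::real_vector operad" and b :: "cbv_gen \<Rightarrow> 'b"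
    and \<theta> :: "nat \<Rightarrow> int \<Rightarrow> 'b \<Rightarrow> (int \<times> 'm form) list \<Rightarrow> 'm form"
  assumes B: "cbv_mod_delta_operad B b" and theta: "jacobi_cbv_algebra A \<pi> \<eta> B b \<theta>"
begin

lemma jacobi_cocycle_acts_exactly:
  assumes \<pi>: "\<pi> \<in> polyvectors A 2" and c: "c \<in> ops B n k" "pdif B n k c = 0" "k \<noteq> 0"
  shows "\<exists>h\<in>end_ops (de_rham A) n (k - 1). \<theta> n k c = pdif (endomorphism_operad (de_rham A)) n (k - 1) h"
proof -
  have dg: "dg_operad B" using B by (simp add: cbv_mod_delta_operad_def presented_by_def)
  interpret operad_hom B "endomorphism_operad (de_rham A)" \<theta>
    using theta by (simp add: jacobi_cbv_algebra_def)
  have "\<exists>h\<in>ops image_operad n (k - 1). \<theta> n k c = pdif image_operad n (k - 1) h"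
  proof (rule cbv_cocycle_acts_exactly[OF B dg_operad_image[OF dg] hom_image_operad _ _ _ c])
    show "\<theta> n k (b g) = jacobi_operations A \<pi> \<eta> g" if "(g, n, k) \<in> cbv_signature" for g n k
      using theta that by (auto simp: jacobi_cbv_algebra_def)
    show "jacobi_operations A \<pi> \<eta> (Phi n) = 0" if "2 \<le> n" for n
      using that by simp
    show "op_eval image_operad (jacobi_operations A \<pi> \<eta>) (diff_op_expr 2 (phi_gen 1)) = 0"
      unfolding op_eval_image_operad by (rule interior_order_relation[OF B theta \<pi>])
  qed
  then show ?thesis
    using hom_closed by (auto simp: endomorphism_operad_sel(1))
qed

text \<open>On cocycles, all terms of the differential of \<open>h\<close> except the differential of its value vanish.\<close>

lemma coclass_exact_operation:
  assumes h: "h \<in> end_ops (de_rham A) n (k - 1)"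
    and xs: "length xs = n" "\<And>l x. (l, x) \<in> set xs \<Longrightarrow> x \<in> cocycles (de_rham A) l"
  shows "coclass (de_rham A) (total_degree xs + k) (pdif (endomorphism_operad (de_rham A)) n (k - 1) h xs) =
    coclass (de_rham A) (total_degree xs + k) 0"
proof -
  let ?V = "de_rham A"
  let ?j = "total_degree xs + k"
  have dg: "dg_operad B" using B by (simp add: cbv_mod_delta_operad_def presented_by_def)
  have alg: "operad_algebra B ?V \<theta>" using theta by (simp add: jacobi_cbv_algebra_def)
  have tagged: "set xs \<subseteq> tagged_elements ?V"
    using xs(2) by (auto simp: tagged_elements_def cocycles_def)
  have closed: "h xs \<in> cgrp ?V (?j - 1)"
    using end_ops_closed[OF h xs(1) tagged] by (simp add: algebra_simps)
  have "h (xs[i := (fst (xs ! i) + 1, cdif ?V (fst (xs ! i)) (snd (xs ! i)))]) = 0" if i: "i < n" for i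
  proof -
    have "cdif ?V (fst (xs ! i)) (snd (xs ! i)) = 0"
      using xs(2)[of "fst (xs ! i)" "snd (xs ! i)"] i xs(1) by (simp add: cocycles_def)
    moreover have "h (xs[i := (l, 1 *\<^sub>R 0 + 0)]) = 1 *\<^sub>R h (xs[i := (l, 0)]) + h (xs[i := (l, 0)])" for l
      using h i xs(1) tagged de_rham_zero[of A l] unfolding end_ops_def by blast
    ultimately show ?thesis by simp
  qed
  then have value_eq: "pdif (endomorphism_operad ?V) n (k - 1) h xs = exterior_derivative A (h xs)"
    using xs(1) tagged by (simp add: endomorphism_operad_sel(5) restrict_op_def de_rham_sel(2))
  have "(\<exists>w\<in>cgrp ?V (?j - 1). y - exterior_derivative A (h xs) = exterior_derivative A w) \<longleftrightarrow>
      (\<exists>w\<in>cgrp ?V (?j - 1). y = exterior_derivative A w)" for y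
  proof
    assume "\<exists>w\<in>cgrp ?V (?j - 1). y - exterior_derivative A (h xs) = exterior_derivative A w"
    then obtain w where w: "w \<in> cgrp ?V (?j - 1)" "y - exterior_derivative A (h xs) = exterior_derivative A w" by blast
    then have "y = exterior_derivative A (1 *\<^sub>R h xs + w)"
      using exterior_derivative_linear[OF closed w(1), of 1] by (simp add: algebra_simps)
    then show "\<exists>w\<in>cgrp ?V (?j - 1). y = exterior_derivative A w"
      using algebra_cochains_subspace[OF dg alg closed w(1)] by blast
  next
    assume "\<exists>w\<in>cgrp ?V (?j - 1). y = exterior_derivative A w"
    then obtain w where w: "w \<in> cgrp ?V (?j - 1)" "y = exterior_derivative A w" by blast
    then have "y - exterior_derivative A (h xs) = exterior_derivative A ((- 1) *\<^sub>R h xs + w)"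
      using exterior_derivative_linear[OF closed w(1), of "- 1"] by simp
    then show "\<exists>w\<in>cgrp ?V (?j - 1). y - exterior_derivative A (h xs) = exterior_derivative A w"
      using algebra_cochains_subspace[OF dg alg closed w(1)] by blast
  qed
  then show ?thesis
    unfolding value_eq coclass_def image_iff de_rham_sel(2) by simp
qed

end

theorem corollary5p30:
  fixes A :: "('m::{t2_space, second_countable_topology}, 'e::real_normed_vector) atlas"
    and \<pi> \<eta> :: "'m polyvector"
    and H :: "'h::real_vector operad" and m :: "nat \<Rightarrow> 'h"
    and Hinf :: "'i::real_vector operad" and E :: "nat \<Rightarrow> int \<Rightarrow> 'i set"
    and p :: "nat \<Rightarrow> int \<Rightarrow> 'i \<Rightarrow> 'h"
    and Cinf E' :: "nat \<Rightarrow> int \<Rightarrow> 'i set"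
    and B :: "'b::real_vector operad" and b :: "cbv_gen \<Rightarrow> 'b"
    and \<iota> :: "nat \<Rightarrow> int \<Rightarrow> 'h \<Rightarrow> 'b"
    and \<psi> :: "nat \<Rightarrow> int \<Rightarrow> 'i \<Rightarrow> 'b"
    and \<theta> :: "nat \<Rightarrow> int \<Rightarrow> 'b \<Rightarrow> (int \<times> 'm form) list \<Rightarrow> 'm form"
  assumes jacobi: "jacobi_manifold A \<pi> \<eta>"
    and H: "hypercommutative_operad H m"
    and Hinf: "minimal_resolution Hinf E p H"
    and Cinf_sub: "\<And>n k. Cinf n k \<subseteq> ops Hinf n k" "\<And>n k. E' n k \<subseteq> E n k"
    and Cinf: "minimal_resolution (Hinf\<lparr>ops := Cinf\<rparr>) E' p (degree_zero_part H)"
    and B: "cbv_mod_delta_operad B b"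
    and iota: "operad_hom (degree_zero_part H) B \<iota>" "\<iota> 2 0 (m 2) = b Mu"
    and psi: "quasi_iso Hinf B \<psi>"
    and psi_Cinf: "\<And>n k x. x \<in> Cinf n k \<Longrightarrow> \<psi> n k x = \<iota> n k (p n k x)"
    and theta: "jacobi_cbv_algebra A \<pi> \<eta> B b \<theta>"
  shows "\<forall>n > 2. \<forall>Xs. length Xs = n \<and> (\<forall>(k, X) \<in> set Xs. X \<in> cohomology (de_rham A) k) \<longrightarrow>
    induced_operation Hinf (de_rham A) (\<lambda>n k x. \<theta> n k (\<psi> n k x)) p n (2 * (2 - int n)) (m n) Xs =
    coclass (de_rham A) (total_degree Xs + 2 * (2 - int n)) 0"
proof (intro allI impI, elim conjE)
  fix n :: nat and Xs :: "(int \<times> 'm form set) list"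
  assume n: "2 < n" and len: "length Xs = n" and Xs: "\<forall>(k, X) \<in> set Xs. X \<in> cohomology (de_rham A) k"
  let ?V = "de_rham A" and ?e = "2 * (2 - int n)"
  have pres: "presented_by H m hyp_signature hyp_relations"
    using H by (simp add: hypercommutative_operad_def)
  have Hinf': "dg_operad Hinf" "quasi_iso Hinf H p"
    using Hinf by (auto simp: minimal_resolution_def)
  have H_dif: "pdif H n k x = 0" if "x \<in> ops H n k" for n k x
    by (rule presented_by_dif_zero[OF pres _ that]) (auto simp: hyp_signature_def hyp_relations_def)
  have "m n \<in> ops H n ?e"
    using pres n by (auto simp: presented_by_def hyp_signature_def)
  then have ex: "\<exists>c. c \<in> cocycles (arity_complex Hinf n) ?e \<and> p n ?e c = m n"
    using quasi_iso_lift_cocycle[OF Hinf'(1) _ Hinf'(2) H_dif] pres by (auto simp: presented_by_def)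
  define c where "c = (SOME c. c \<in> cocycles (arity_complex Hinf n) ?e \<and> p n ?e c = m n)"
  have c: "c \<in> ops Hinf n ?e" "pdif Hinf n ?e c = 0"
    using someI_ex[OF ex] by (auto simp: c_def cocycles_def arity_complex_def)
  interpret psi: operad_hom Hinf B \<psi> using psi by (simp add: quasi_iso_def)
  have "\<psi> n ?e c \<in> ops B n ?e" "pdif B n ?e (\<psi> n ?e c) = 0"
    using psi.hom_closed[OF c(1)] psi.hom_dif[OF c(1)] c(2) psi.hom_zero[OF Hinf'(1)] by simp_all
  moreover have "\<pi> \<in> polyvectors A 2" using jacobi by (simp add: jacobi_manifold_def)
  ultimately obtain h where h: "h \<in> end_ops ?V n (?e - 1)"
    "\<theta> n ?e (\<psi> n ?e c) = pdif (endomorphism_operad ?V) n (?e - 1) h"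
    using jacobi_cocycle_acts_exactly[OF B theta, of "\<psi> n ?e c" n ?e] n by auto
  define xs where "xs = map (\<lambda>(k, X). (k, SOME x. x \<in> X)) Xs"
  have degree: "total_degree xs = total_degree Xs"
    by (simp add: xs_def total_degree_def comp_def case_prod_unfold)
  have "x \<in> cocycles ?V k" if kx: "(k, x) \<in> set xs" for k x
  proof -
    obtain X where X: "(k, X) \<in> set Xs" "x = (SOME x. x \<in> X)"
      using kx by (auto simp: xs_def)
    then obtain y where y: "y \<in> cocycles ?V k" "X = coclass ?V k y"
      using Xs by (auto simp: cohomology_def)
    have "exterior_derivative A 0 = 0"
      using exterior_derivative_linear[OF de_rham_zero[of A 0] de_rham_zero[of A 0], of 1] by simp
    then have "y \<in> X"
      using y de_rham_zero[of A "k - 1"] by (auto simp: coclass_def de_rham_sel(2) intro!: image_eqI[of 0 _ 0])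
    then have "x \<in> X" using X(2) someI[of "\<lambda>x. x \<in> X" y] by simp
    then show ?thesis by (simp add: y(2) coclass_def)
  qed
  then have "coclass ?V (total_degree xs + ?e) (pdif (endomorphism_operad ?V) n (?e - 1) h xs) =
      coclass ?V (total_degree xs + ?e) 0"
    using len by (intro coclass_exact_operation[OF B theta h(1)]) (auto simp: xs_def)
  then show "induced_operation Hinf ?V (\<lambda>n k x. \<theta> n k (\<psi> n k x)) p n ?e (m n) Xs =
      coclass ?V (total_degree Xs + ?e) 0"
    unfolding induced_operation_def Let_def c_def[symmetric] xs_def[symmetric] h(2) degree .
qed

end
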